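(* Let $d\ge2$ and fix $\mu>0$. There exists some constant $\tilde p=\tilde p(\mu)\in(0,1)$ such that for all $p\in(\tilde p,1)$ the speed $\lambda\mapsto v(\lambda)=v_{\mu,p}(\lambda)$ of the $\lambda$-biased random walk on dynamical percolation on $\mathbb{Z}^d$ with parameters $\mu$ and $p$ is strictly increasing in $\lambda>0$.
   Context: Dynamical percolation on $\mathbb{Z}^d$ (nearest-neighbour graph with edge set $E$) with parameters $\mu>0$ and $p\in(0,1)$ is the Markov process $(\eta_t)_{t\ge0}$ on $\{0,1\}^{E}$ in which each edge carries an independent Poisson process of rate $\mu$; at each point of the process of $e$, the state of $e$ is refreshed: $\eta_t(e)=1$ ($e$ open) with probability $p$ and $\eta_t(e)=0$ ($e$ closed) with probability $1-p$, independently of everything else. The initial state $\eta_0$ has the Bernoulli-$p$ product law $\pi_p$. For $\lambda>0$ put $Z_\lambda=e^{\lambda}+e^{-\lambda}+2d-2$. The $\lambda$-biased random walk $(X_t)_{t\ge0}$ on dynamical percolation starts at $X_0=0$ and carries an independent rate $1$ Poisson clock. When the clock rings at time $t$ and the walker is at $x$, it chooses the neighbour $x+\mathrm{e}_1$ with probability $e^{\lambda}/Z_\lambda$, $x-\mathrm{e}_1$ with probability $e^{-\lambda}/Z_\lambda$, and each $x\pm\mathrm{e}_i$ ($i=2,\dots,d$) with probability $1/Z_\lambda$. If $y$ is the chosen neighbour and $\eta_t(\{x,y\})=1$, the walker moves to $y$; otherwise it stays at $x$. The speed $v_{\mu,p}(\lambda)$ is the deterministic number such that almost surely $\lim_{t\to\infty}X_t/t=(v_{\mu,p}(\lambda),0,\dots,0)$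 (this limit exists). The dimension $d$ is fixed throughout, so constants may depend on $d$. *)

theory Defs
  imports "HOL-Probability.Probability"
begin

text \<open>
  The lattice \<open>\<int>\<^sup>d\<close> is the type \<open>int ^ 'd\<close> with \<open>d = CARD('d)\<close>. Since the index type carries no
  order, the coordinate \<open>k :: 'd\<close> along which the walk is biased (the first coordinate in the
  usual notation) is a parameter.
\<close>

definition lattice_edges :: "(int ^ 'd::finite) set set" where
  "lattice_edges = {{x, x + axis i 1} | x i. True}"

definition unit_steps :: "(int ^ 'd::finite) set" where
  "unit_steps = {axis i 1 | i. True} \<union> {axis i (- 1) | i. True}"


text \<open>
  A Poisson process of rate \<open>r\<close> is given by its independent exponential gaps: the \<open>n\<close>-th point
  (counted from \<open>0\<close>) is the sum of the gaps \<open>0, \<dots>, n\<close>. Almost surely the gaps are positive with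
  divergent sum, so that \<open>rings_until g t\<close> is the finite number \<open>N\<close> of points in \<open>[0, t]\<close>, and
  these are the points \<open>0, \<dots>, N - 1\<close>.
\<close>

definition exponential_gap :: "real \<Rightarrow> real measure" where
  "exponential_gap r = density lborel (exponential_density r)"

definition ring_time :: "(nat \<Rightarrow> real) \<Rightarrow> nat \<Rightarrow> real" where
  "ring_time g n = (\<Sum>i\<le>n. g i)"

definition rings_until :: "(nat \<Rightarrow> real) \<Rightarrow> real \<Rightarrow> nat" where
  "rings_until g t = card {n. ring_time g n \<le> t}"


text \<open>
  Randomness of one edge: its state at time \<open>0\<close> and, for each \<open>n\<close>, the \<open>n\<close>-th gap of its clock
  together with the state drawn at the \<open>n\<close>-th ring; \<open>True\<close> means open.
\<close>

type_synonym edge_sample = "bool \<times> (nat \<Rightarrow> real \<times> bool)"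

definition edge_space :: "real \<Rightarrow> real \<Rightarrow> edge_sample measure" where
  "edge_space \<mu> p =
     measure_pmf (bernoulli_pmf p) \<Otimes>\<^sub>M
     (\<Pi>\<^sub>M n\<in>UNIV. exponential_gap \<mu> \<Otimes>\<^sub>M measure_pmf (bernoulli_pmf p))"

definition edge_open :: "edge_sample \<Rightarrow> real \<Rightarrow> bool" where
  "edge_open a t =
     (case rings_until (\<lambda>n. fst (snd a n)) t of
        0 \<Rightarrow> fst a
      | Suc n \<Rightarrow> snd (snd a n))"


definition Z_bias :: "'d::finite itself \<Rightarrow> real \<Rightarrow> real" where
  "Z_bias _ l = exp l + exp (- l) + 2 * real CARD('d) - 2"

definition step_prob :: "'d::finite \<Rightarrow> real \<Rightarrow> int ^ 'd \<Rightarrow> real" where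
  "step_prob k l z =
     (if z = axis k 1 then exp l / Z_bias TYPE('d) l
      else if z = axis k (- 1) then exp (- l) / Z_bias TYPE('d) l
      else if z \<in> unit_steps then 1 / Z_bias TYPE('d) l
      else 0)"

definition step_pmf :: "'d::finite \<Rightarrow> real \<Rightarrow> (int ^ 'd) pmf" where
  "step_pmf k l = embed_pmf (step_prob k l)"

text \<open>
  Randomness of the walker: for each \<open>n\<close>, the \<open>n\<close>-th gap of its clock and the increment proposed
  at the \<open>n\<close>-th ring.
\<close>

type_synonym 'd walker_sample = "nat \<Rightarrow> real \<times> (int ^ 'd)"

type_synonym 'd sample = "((int ^ 'd) set \<Rightarrow> edge_sample) \<times> 'd walker_sample"

definition walker_space :: "'d::finite \<Rightarrow> real \<Rightarrow> 'd walker_sample measure" where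
  "walker_space k l = (\<Pi>\<^sub>M n\<in>UNIV. exponential_gap 1 \<Otimes>\<^sub>M measure_pmf (step_pmf k l))"

definition sample_space :: "'d::finite \<Rightarrow> real \<Rightarrow> real \<Rightarrow> real \<Rightarrow> 'd sample measure" where
  "sample_space k \<mu> p l =
     (\<Pi>\<^sub>M e\<in>lattice_edges. edge_space \<mu> p) \<Otimes>\<^sub>M walker_space k l"

definition eta :: "'d sample \<Rightarrow> real \<Rightarrow> (int ^ 'd::finite) set \<Rightarrow> bool" where
  "eta \<omega> t e = edge_open (fst \<omega> e) t"

definition walker_gaps :: "'d sample \<Rightarrow> nat \<Rightarrow> real" where
  "walker_gaps \<omega> n = fst (snd \<omega> n)"

text \<open>The position of the walker after the first \<open>n\<close> rings of its clock.\<close>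

primrec skeleton :: "'d::finite sample \<Rightarrow> nat \<Rightarrow> int ^ 'd" where
  "skeleton \<omega> 0 = 0"
| "skeleton \<omega> (Suc n) =
     (let x = skeleton \<omega> n; y = x + snd (snd \<omega> n)
      in if eta \<omega> (ring_time (walker_gaps \<omega>) n) {x, y} then y else x)"

definition walk :: "'d::finite sample \<Rightarrow> real \<Rightarrow> int ^ 'd" where
  "walk \<omega> t = skeleton \<omega> (rings_until (walker_gaps \<omega>) t)"

definition has_speed :: "'d::finite \<Rightarrow> real \<Rightarrow> real \<Rightarrow> real \<Rightarrow> real \<Rightarrow> bool" where
  "has_speed k \<mu> p l v \<longleftrightarrow>
     (AE \<omega> in sample_space k \<mu> p l.
        ((\<lambda>t. (\<chi> i. real_of_int (walk \<omega> t $ i) / t) :: real ^ 'd) \<longlongrightarrow> axis k v) at_top)"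

definition speed :: "'d::finite \<Rightarrow> real \<Rightarrow> real \<Rightarrow> real \<Rightarrow> real" where
  "speed k \<mu> p l = (THE v. has_speed k \<mu> p l v)"


lemma unit_steps_eq:
  "(unit_steps :: (int ^ 'd::finite) set) = range (\<lambda>i. axis i 1) \<union> range (\<lambda>i. axis i (- 1))"
  by (auto simp: unit_steps_def)

lemma finite_unit_steps: "finite (unit_steps :: (int ^ 'd::finite) set)"
  unfolding unit_steps_eq by (intro finite_UnI finite_imageI finite_class.finite_UNIV)

lemma Z_bias_pos: "Z_bias TYPE('d::finite) l > 0"
proof -
  have "real CARD('d) \<ge> 1" by (simp add: Suc_leI)
  moreover have "exp l > 0" "exp (- l) > 0" by simp_all
  ultimately show ?thesis unfolding Z_bias_def by linarith
qed

lemma step_prob_nonneg: "step_prob k l z \<ge> 0"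
  using Z_bias_pos[where 'd = 'a, of l] by (auto simp: step_prob_def)

lemma sum_step_prob: "(\<Sum>z\<in>unit_steps. step_prob (k :: 'd::finite) l z) = 1"
proof -
  let ?Z = "Z_bias TYPE('d) l"
  let ?P = "range (\<lambda>i::'d. axis i (1::int))" and ?M = "range (\<lambda>i::'d. axis i (- 1 :: int))"
  have inj: "inj (\<lambda>i::'d. axis i (1::int))" "inj (\<lambda>i::'d. axis i (- 1 :: int))"
    by (auto simp: inj_on_def axis_eq_axis)
  have U: "unit_steps = ?P \<union> ?M" by (auto simp: unit_steps_def)
  have disj: "?P \<inter> ?M = {}" by (auto simp: axis_eq_axis)
  have p: "step_prob k l (axis i 1) = (if i = k then exp l / ?Z else 1 / ?Z)" for i
    by (auto simp: step_prob_def axis_eq_axis unit_steps_def)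
  have m: "step_prob k l (axis i (- 1)) = (if i = k then exp (- l) / ?Z else 1 / ?Z)" for i
    by (auto simp: step_prob_def axis_eq_axis unit_steps_def)
  have s: "(\<Sum>i\<in>UNIV. if i = k then a else b) = a + (real CARD('d) - 1) * b" for a b :: real
  proof -
    have "(\<Sum>i\<in>UNIV. if i = k then a else b) = a + (\<Sum>i\<in>UNIV - {k}. b)"
      by (subst sum.remove[of _ k]) (auto intro!: sum.cong)
    also have "real (card (UNIV - {k})) = real CARD('d) - 1"
      by (simp add: card_Diff_singleton of_nat_diff Suc_leI)
    then have "(\<Sum>i\<in>UNIV - {k}. b) = (real CARD('d) - 1) * b" by simp
    finally show ?thesis .
  qed
  have "(\<Sum>z\<in>unit_steps. step_prob k l z) =
        (\<Sum>z\<in>?P. step_prob k l z) + (\<Sum>z\<in>?M. step_prob k l z)"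
    unfolding U using disj by (intro sum.union_disjoint) auto
  also have "\<dots> = (\<Sum>i\<in>UNIV. step_prob k l (axis i 1)) + (\<Sum>i\<in>UNIV. step_prob k l (axis i (- 1)))"
    using inj by (simp add: sum.reindex)
  also have "\<dots> = (exp l + (real CARD('d) - 1) + exp (- l) + (real CARD('d) - 1)) / ?Z"
    unfolding p m s by (simp add: add_divide_distrib diff_divide_distrib)
  also have "\<dots> = ?Z / ?Z" by (simp add: Z_bias_def)
  also have "\<dots> = 1" using Z_bias_pos[where 'd = 'd, of l] by simp
  finally show ?thesis .
qed

lemma pmf_step_pmf: "pmf (step_pmf k l) z = step_prob (k :: 'd::finite) l z"
  unfolding step_pmf_def
proof (rule pmf_embed_pmf)
  have "(\<integral>\<^sup>+ z. ennreal (step_prob k l z) \<partial>count_space UNIV) =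
        (\<Sum>z\<in>unit_steps. ennreal (step_prob k l z))"
    by (rule nn_integral_count_space'[OF finite_unit_steps])
       (auto simp: step_prob_def unit_steps_def)
  also have "\<dots> = 1" by (simp add: sum_ennreal step_prob_nonneg sum_step_prob)
  finally show "(\<integral>\<^sup>+ z. ennreal (step_prob k l z) \<partial>count_space UNIV) = 1" .
qed (rule step_prob_nonneg)

lemma prob_space_exponential_gap: "r > 0 \<Longrightarrow> prob_space (exponential_gap r)"
  unfolding exponential_gap_def by (rule prob_space_exponential_density)

lemma prob_space_edge_space: "\<mu> > 0 \<Longrightarrow> prob_space (edge_space \<mu> p)"
  unfolding edge_space_def
  by (intro prob_space_pair prob_space_PiM prob_space_exponential_gap measure_pmf.prob_space_axioms)

lemma prob_space_sample_space: "\<mu> > 0 \<Longrightarrow> prob_space (sample_space k \<mu> p l)"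
  unfolding sample_space_def walker_space_def
  by (intro prob_space_pair prob_space_PiM prob_space_edge_space prob_space_exponential_gap
        measure_pmf.prob_space_axioms) simp_all

lemma has_speed_unique:
  assumes "\<mu> > 0" "has_speed k \<mu> p l v" "has_speed (k :: 'd::finite) \<mu> p l w"
  shows "v = w"
proof -
  interpret prob_space "sample_space k \<mu> p l" by (rule prob_space_sample_space) fact
  have "AE \<omega> in sample_space k \<mu> p l. (axis k v :: real ^ 'd) = axis k w"
    using assms(2,3) unfolding has_speed_def
    by eventually_elim (rule tendsto_unique[OF trivial_limit_at_top_linorder])
  then show ?thesis by (auto simp: axis_eq_axis)
qed

lemma speed_eqI: "\<mu> > 0 \<Longrightarrow> has_speed k \<mu> p l v \<Longrightarrow> speed k \<mu> p l = v"
  unfolding speed_def by (blast intro: the_equality has_speed_unique)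

end

theory Submission
  imports Defs
begin

text \<open>
  Fix the walker's clock and the proposed steps. Whether the \<open>n\<close>-th proposal succeeds depends on
  the past only through the last attempt on the same edge, so it may be sampled as follows: draw an
  age \<open>A n\<close>, exponential of rate \<open>\<mu>\<close>, and a mark \<open>B n\<close>, Bernoulli of parameter \<open>p\<close>, all independent;
  if the edge was last attempted less than \<open>A n\<close> ago, repeat the outcome of that attempt, otherwise
  use \<open>B n\<close>. Here \<open>A n\<close> is the time since the last refresh of the edge, seen backwards.

  If no age drawn from the \<open>m\<close>-th ring on reaches back beyond that ring, then the outcomes from then
  on do not depend on what happened before. Looking backwards from the \<open>i\<close>-th ring, the reach of the
  ages is the Markov chain \<open>w \<mapsto> max w A - g\<close>, which has a geometrically decaying chance to stay
  positive, uniformly in \<open>\<lambda>\<close> and \<open>p\<close>. The resulting decay of correlations gives the law of large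
  numbers, hence the speed.

  For \<open>\<lambda> < \<lambda>'\<close> couple the proposals so that they differ only where the second one is the
  favoured step, and replace them one at a time. One replacement gains at least \<open>1\<close>, up to the
  effect of failed proposals before the memory is lost; a failure needs a mark \<open>False\<close>, so
  this effect is \<open>O(1 - p)\<close>, with a constant that depends on \<open>\<mu>\<close> only. Hence the speed increases
  once \<open>p\<close> is close to \<open>1\<close>.
\<close>

section \<open>Infinite products and a law of large numbers\<close>

text \<open>Raising the bias does not push the walk forward path by path: another step leads to
  other edges, and closed ones may cost more than the step has gained. What saves the comparison is
  that the reach of the ages reads neither steps nor marks. So the expected damage of one
  replacement is at most the product of the chance \<open>q\<close> that the two proposals differ,
  the chance \<open>1 - p\<close> of a mark \<open>False\<close>, and a constant of \<mu>. The
  guaranteed gain has expectation \<open>q\<close>. Hence \<open>q\<close>, which is tiny when the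
  two biases are close, cancels, and one threshold for \<open>p\<close> serves all pairs of biases.

  The description by ages holds in law, and it is established only for the position after a fixed
  number of rings. This suffices, because the law of large numbers is drawn from second moments at
  fixed numbers of rings. Both descriptions are compared through the probability of a prescribed
  sequence of outcomes: once the outcomes are prescribed, the attempted edges are deterministic, and
  the probability is a product over the rings.\<close>

abbreviation iid :: "'a measure \<Rightarrow> (nat \<Rightarrow> 'a) measure" where
  "iid M \<equiv> (\<Pi>\<^sub>M i\<in>UNIV. M)"

lemma sequence_spaceI: "prob_space M \<Longrightarrow> sequence_space M"
  by (simp add: sequence_space_def product_prob_space_def product_prob_space_axioms_def
      product_sigma_finite_def prob_space_imp_sigma_finite)

lemma measurable_fun_upd_nat [measurable]:
  "(\<lambda>(w, x). w(k := x)) \<in> iid M \<Otimes>\<^sub>M M \<rightarrow>\<^sub>M iid M"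
  using measurable_add_dim[of k UNIV "\<lambda>_. M"] by simp

text \<open>An infinite product has no last factor to split off. Overwriting coordinate
  \<open>k\<close> by an independent copy keeps the law, since on a cylinder set the condition on
  \<open>k\<close> merely moves from the sequence to the copy. Any single coordinate can thus be
  integrated out by itself.\<close>

lemma PiM_resample:
  assumes "prob_space M"
  shows "distr (iid M \<Otimes>\<^sub>M M) (iid M) (\<lambda>(w, x). w(k := x)) = iid M"
    (is "distr (?S \<Otimes>\<^sub>M M) _ ?f = _")
proof -
  interpret sequence_space M by (rule sequence_spaceI) fact
  show ?thesis
  proof (rule PiM_eq)
    fix J E assume J: "finite J" "J \<subseteq> (UNIV::nat set)" "\<And>j. j \<in> J \<Longrightarrow> E j \<in> sets M"
    let ?X = "prod_emb UNIV (\<lambda>_. M) J (\<Pi>\<^sub>E j\<in>J. E j)"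
    let ?Y = "prod_emb UNIV (\<lambda>_. M) (J - {k}) (\<Pi>\<^sub>E j\<in>J - {k}. E j)"
    let ?Z = "if k \<in> J then E k else space M"
    have sub: "\<And>j x. j \<in> J \<Longrightarrow> x \<in> E j \<Longrightarrow> x \<in> space M"
      using J(3)[THEN sets.sets_into_space] by auto
    have eq: "?f -` ?X \<inter> space (?S \<Otimes>\<^sub>M M) = ?Y \<times> ?Z"
      using sub by (auto simp: space_pair_measure space_PiM prod_emb_def PiE_iff split: if_splits)
    have "emeasure (distr (?S \<Otimes>\<^sub>M M) ?S ?f) ?X = emeasure (?S \<Otimes>\<^sub>M M) (?Y \<times> ?Z)"
      by (subst emeasure_distr) (auto intro!: sets_PiM_I simp: J eq)
    also have "\<dots> = emeasure ?S ?Y * emeasure M ?Z"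
      using J by (intro M.emeasure_pair_measure_Times) (auto intro!: sets_PiM_I)
    also have "emeasure ?S ?Y = (\<Prod>j\<in>J - {k}. emeasure M (E j))"
      using J by (intro emeasure_PiM_emb) auto
    also have "\<dots> * emeasure M ?Z = (\<Prod>j\<in>J. emeasure M (E j))"
      using J(1) M.emeasure_space_1 by (cases "k \<in> J") (auto simp: prod.remove mult.commute)
    finally show "emeasure (distr (?S \<Otimes>\<^sub>M M) ?S ?f) ?X = (\<Prod>j\<in>J. emeasure M (E j))" .
  qed simp
qed

lemma nn_integral_PiM_resample:
  assumes M: "prob_space M" and [measurable]: "f \<in> borel_measurable (iid M)"
  shows "(\<integral>\<^sup>+w. f w \<partial>iid M) = (\<integral>\<^sup>+w. \<integral>\<^sup>+x. f (w(k := x)) \<partial>M \<partial>iid M)"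
proof -
  interpret M: prob_space M by fact
  show ?thesis
    by (subst PiM_resample[OF M, symmetric, of k], subst nn_integral_distr)
       (simp_all add: M.nn_integral_fst[symmetric] split_beta')
qed

text \<open>Makes it possible to integrate gaps, steps, ages and marks one family at a time,
  although each ring carries them together.\<close>

lemma nn_integral_PiM_zip:
  assumes M: "prob_space M" and N: "prob_space N"
    and f [measurable]: "f \<in> borel_measurable (iid (M \<Otimes>\<^sub>M N))"
  shows "(\<integral>\<^sup>+w. f w \<partial>iid (M \<Otimes>\<^sub>M N)) =
    (\<integral>\<^sup>+u. \<integral>\<^sup>+v. f (\<lambda>i. (u i, v i)) \<partial>iid N \<partial>iid M)"
proof -
  let ?S = "iid M" and ?T = "iid N"
  let ?P = "iid (M \<Otimes>\<^sub>M N)"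
  let ?f = "\<lambda>(u, v). \<lambda>i::nat. (u i, v i)"
  have MN: "prob_space (M \<Otimes>\<^sub>M N)" by (rule prob_space_pair[OF M N])
  interpret M: prob_space M by fact
  interpret N: prob_space N by fact
  interpret S: sequence_space M by (rule sequence_spaceI) fact
  interpret T: sequence_space N by (rule sequence_spaceI) fact
  interpret P: sequence_space "M \<Otimes>\<^sub>M N" by (rule sequence_spaceI) fact
  have meas: "?f \<in> ?S \<Otimes>\<^sub>M ?T \<rightarrow>\<^sub>M ?P"
    unfolding split_beta' by (rule measurable_PiM_single') (auto simp: space_PiM space_pair_measure PiE_iff)
  \<comment> \<open>The sets \<open>E j\<close> need not be rectangles, so the product does not
    separate into a part in \<open>u\<close> and a part in \<open>v\<close>. Coordinate
    \<open>j\<close> is resampled in both sequences, after which its factor comes out of the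
    integral.\<close>
  have prod: "(\<integral>\<^sup>+u. \<integral>\<^sup>+v. (\<Prod>j\<in>J. indicator (E j) (u j, v j)) \<partial>?T \<partial>?S) =
      (\<Prod>j\<in>J. emeasure (M \<Otimes>\<^sub>M N) (E j))"
    if "finite J" "\<And>j. j \<in> J \<Longrightarrow> E j \<in> sets (M \<Otimes>\<^sub>M N)" for J and E :: "nat \<Rightarrow> _"
    using that
  proof (induction J)
    case empty
    show ?case by (simp add: T.emeasure_space_1 S.emeasure_space_1)
  next
    case (insert j J)
    have [measurable]: "E i \<in> sets (M \<Otimes>\<^sub>M N)" if "i \<in> insert j J" for i
      using insert.prems that by simp
    have *: "(\<lambda>x. \<Prod>i\<in>insert j J. indicator (E i) (fst x i, snd x i) :: ennreal) \<in> borel_measurable (?S \<Otimes>\<^sub>M ?T)"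
      by measurable
    let ?h = "\<lambda>u v. \<Prod>i\<in>insert j J. indicator (E i) (u i, v i) :: ennreal"
    have h: "(\<lambda>(u, v). ?h u v) \<in> borel_measurable (?S \<Otimes>\<^sub>M ?T)" using * by (simp add: split_beta')
    have hJ': "(\<lambda>x. \<Prod>i\<in>J. indicator (E i) (fst x i, snd x i) :: ennreal) \<in> borel_measurable (?S \<Otimes>\<^sub>M ?T)"
      by measurable
    have hJ: "(\<lambda>v. \<Prod>i\<in>J. indicator (E i) (u i, v i) :: ennreal) \<in> borel_measurable ?T" if "u \<in> space ?S" for u
      using measurable_compose_Pair1[OF that hJ'] by simp
    have upd: "?h (u(j := x)) (v(j := y)) =
        indicator (E j) (x, y) * (\<Prod>i\<in>J. indicator (E i) (u i, v i))" for u v x y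
      using insert.hyps by (auto intro!: arg_cong2[where f="(*)"] prod.cong)
    have "(\<integral>\<^sup>+u. \<integral>\<^sup>+v. ?h u v \<partial>?T \<partial>?S) = (\<integral>\<^sup>+u. \<integral>\<^sup>+x. (\<integral>\<^sup>+v. ?h (u(j := x)) v \<partial>?T) \<partial>M \<partial>?S)"
      by (rule nn_integral_PiM_resample[OF M]) (use h in measurable)
    also have "\<dots> = (\<integral>\<^sup>+u. \<integral>\<^sup>+x. \<integral>\<^sup>+v. \<integral>\<^sup>+y. ?h (u(j := x)) (v(j := y)) \<partial>N \<partial>?T \<partial>M \<partial>?S)"
    proof (rule nn_integral_cong, rule nn_integral_cong)
      fix u x assume u: "u \<in> space ?S" "x \<in> space M"
      then have "u(j := x) \<in> space ?S" by (auto simp: space_PiM PiE_iff)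
      then have "?h (u(j := x)) \<in> borel_measurable ?T"
        using measurable_compose_Pair1[OF _ h] by (simp del: fun_upd_apply)
      then show "(\<integral>\<^sup>+v. ?h (u(j := x)) v \<partial>?T) = (\<integral>\<^sup>+v. \<integral>\<^sup>+y. ?h (u(j := x)) (v(j := y)) \<partial>N \<partial>?T)"
        by (rule nn_integral_PiM_resample[OF N])
    qed
    also have "\<dots> = (\<integral>\<^sup>+u. \<integral>\<^sup>+x. \<integral>\<^sup>+v. (\<integral>\<^sup>+y. indicator (E j) (x, y) \<partial>N) * (\<Prod>i\<in>J. indicator (E i) (u i, v i)) \<partial>?T \<partial>M \<partial>?S)"
      unfolding upd by (intro nn_integral_cong nn_integral_multc) simp
    also have "\<dots> = (\<integral>\<^sup>+u. \<integral>\<^sup>+x. (\<integral>\<^sup>+y. indicator (E j) (x, y) \<partial>N) * (\<integral>\<^sup>+v. (\<Prod>i\<in>J. indicator (E i) (u i, v i)) \<partial>?T) \<partial>M \<partial>?S)"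
      by (rule nn_integral_cong, rule nn_integral_cong, rule nn_integral_cmult) (rule hJ)
    also have "\<dots> = (\<integral>\<^sup>+u. (\<integral>\<^sup>+x. (\<integral>\<^sup>+y. indicator (E j) (x, y) \<partial>N) \<partial>M) * (\<integral>\<^sup>+v. (\<Prod>i\<in>J. indicator (E i) (u i, v i)) \<partial>?T) \<partial>?S)"
      by (intro nn_integral_cong nn_integral_multc) simp
    also have "\<dots> = (\<integral>\<^sup>+x. (\<integral>\<^sup>+y. indicator (E j) (x, y) \<partial>N) \<partial>M) * (\<integral>\<^sup>+u. (\<integral>\<^sup>+v. (\<Prod>i\<in>J. indicator (E i) (u i, v i)) \<partial>?T) \<partial>?S)"
      by (intro nn_integral_cmult) simp
    also have "(\<integral>\<^sup>+x. (\<integral>\<^sup>+y. indicator (E j) (x, y) \<partial>N) \<partial>M) = emeasure (M \<Otimes>\<^sub>M N) (E j)"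
      by (subst N.emeasure_pair_measure) auto
    also have "(\<integral>\<^sup>+u. (\<integral>\<^sup>+v. (\<Prod>i\<in>J. indicator (E i) (u i, v i)) \<partial>?T) \<partial>?S) = (\<Prod>j\<in>J. emeasure (M \<Otimes>\<^sub>M N) (E j))"
      using insert by auto
    finally show ?case using insert.hyps by simp
  qed
  have zip: "distr (?S \<Otimes>\<^sub>M ?T) ?P ?f = ?P"
  proof (rule P.PiM_eq)
    fix J E assume J: "finite J" "J \<subseteq> (UNIV::nat set)" "\<And>j. j \<in> J \<Longrightarrow> E j \<in> sets (M \<Otimes>\<^sub>M N)"
    let ?X = "prod_emb UNIV (\<lambda>_. M \<Otimes>\<^sub>M N) J (\<Pi>\<^sub>E j\<in>J. E j)"
    have X: "?X \<in> sets ?P" using J by (intro sets_PiM_I) auto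
    have ind: "indicator ?X (?f (u, v)) = (\<Prod>j\<in>J. indicator (E j) (u j, v j) :: ennreal)"
      if "u \<in> space ?S" "v \<in> space ?T" for u v
      using that J(1) by (auto simp: prod_emb_def space_PiM PiE_iff space_pair_measure indicator_def)
    have "emeasure (distr (?S \<Otimes>\<^sub>M ?T) ?P ?f) ?X = (\<integral>\<^sup>+x. indicator ?X (?f x) \<partial>(?S \<Otimes>\<^sub>M ?T))"
      using X by (subst nn_integral_distr[OF meas, symmetric]) auto
    also have "\<dots> = (\<integral>\<^sup>+u. \<integral>\<^sup>+v. indicator ?X (?f (u, v)) \<partial>?T \<partial>?S)"
      by (subst T.nn_integral_fst[symmetric]) (auto intro!: measurable_compose[OF meas] borel_measurable_indicator X)
    also have "\<dots> = (\<integral>\<^sup>+u. \<integral>\<^sup>+v. (\<Prod>j\<in>J. indicator (E j) (u j, v j)) \<partial>?T \<partial>?S)"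
      by (intro nn_integral_cong ind)
    finally show "emeasure (distr (?S \<Otimes>\<^sub>M ?T) ?P ?f) ?X = (\<Prod>j\<in>J. emeasure (M \<Otimes>\<^sub>M N) (E j))"
      using prod[OF J(1,3)] by simp
  qed simp
  have "(\<integral>\<^sup>+w. f w \<partial>?P) = (\<integral>\<^sup>+x. f (?f x) \<partial>(?S \<Otimes>\<^sub>M ?T))"
    using meas by (subst zip[symmetric], subst nn_integral_distr) auto
  also have "\<dots> = (\<integral>\<^sup>+u. \<integral>\<^sup>+v. f (?f (u, v)) \<partial>?T \<partial>?S)"
    using measurable_compose[OF meas f] by (subst T.nn_integral_fst[symmetric]) auto
  finally show ?thesis by simp
qed

lemma distr_PiM_map:
  assumes M: "prob_space M" and f [measurable]: "f \<in> M \<rightarrow>\<^sub>M N"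
    and eq: "distr M N f = N"
  shows "distr (iid M) (iid N) (\<lambda>w i. f (w i)) = iid N"
proof -
  have PN: "prob_space N" using prob_space.prob_space_distr[OF M f] eq by simp
  interpret M: sequence_space M by (rule sequence_spaceI) fact
  interpret N: sequence_space N by (rule sequence_spaceI) fact
  have meas: "(\<lambda>w i. f (w i)) \<in> iid M \<rightarrow>\<^sub>M iid N"
    by (rule measurable_PiM_single') (auto simp: space_PiM PiE_iff dest: measurable_space[OF f])
  show ?thesis
  proof (rule N.PiM_eq)
    fix J E assume J: "finite J" "J \<subseteq> (UNIV::nat set)" "\<And>j. j \<in> J \<Longrightarrow> E j \<in> sets N"
    let ?X = "prod_emb UNIV (\<lambda>_. N) J (\<Pi>\<^sub>E j\<in>J. E j)"
    let ?Y = "prod_emb UNIV (\<lambda>_. M) J (\<Pi>\<^sub>E j\<in>J. f -` E j \<inter> space M)"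
    have eq': "(\<lambda>w i. f (w i)) -` ?X \<inter> space (iid M) = ?Y"
      using measurable_space[OF f] by (auto simp: space_PiM prod_emb_def PiE_iff)
    have "emeasure (distr (iid M) (iid N) (\<lambda>w i. f (w i))) ?X = emeasure (iid M) ?Y"
      using J by (subst emeasure_distr[OF meas]) (auto intro!: sets_PiM_I simp: eq')
    also have "\<dots> = (\<Prod>j\<in>J. emeasure M (f -` E j \<inter> space M))"
      using J by (intro M.emeasure_PiM_emb) auto
    also have "\<dots> = (\<Prod>j\<in>J. emeasure N (E j))"
      using J by (intro prod.cong refl) (metis emeasure_distr eq f)
    finally show "emeasure (distr (iid M) (iid N) (\<lambda>w i. f (w i))) ?X = (\<Prod>j\<in>J. emeasure N (E j))" .
  qed simp
qed

text \<open>Between consecutive squares a monotone sequence is squeezed by its values at the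
  squares, and the ratio of consecutive squares tends to 1.\<close>

lemma tendsto_of_squares_mono:
  fixes X :: "nat \<Rightarrow> real"
  assumes mono: "incseq X" and lim: "(\<lambda>k. X (k\<^sup>2) / real (k\<^sup>2)) \<longlonglongrightarrow> v"
  shows "(\<lambda>n. X n / real n) \<longlonglongrightarrow> v"
proof -
  \<comment> \<open>Subtracting \<open>X 0\<close> makes all terms nonnegative, as needed to compare
    fractions with different denominators.\<close>
  define Y where "Y n = X n - X 0" for n
  have Y: "0 \<le> Y n" "m \<le> n \<Longrightarrow> Y m \<le> Y n" for m n
    using mono by (auto simp: Y_def incseq_def)
  have X0: "(\<lambda>n. X 0 / real n) \<longlonglongrightarrow> 0" by (rule lim_const_over_n)
  have sq: "filterlim (\<lambda>k::nat. k\<^sup>2) at_top at_top"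
    by (rule filterlim_at_top_mono[OF filterlim_ident]) (auto simp: power2_eq_square)
  have limY: "(\<lambda>k. Y (k\<^sup>2) / real (k\<^sup>2)) \<longlonglongrightarrow> v"
    using tendsto_diff[OF lim filterlim_compose[OF X0 sq]] by (simp add: Y_def diff_divide_distrib)
  define s where "s n = nat \<lfloor>sqrt (real n)\<rfloor>" for n
  have s: "real (s n) \<le> sqrt (real n)" "sqrt (real n) < real (s n) + 1" for n
    unfolding s_def using real_sqrt_ge_zero[of "real n"] by linarith+
  have le: "real (s n) ^ 2 \<le> real n" for n
    using power_mono[OF s(1)[of n], of 2] by simp
  have ge: "real n \<le> (real (s n) + 1) ^ 2" for n
    using power_mono[OF less_imp_le[OF s(2)[of n]], of 2] by simp
  have le': "(s n)\<^sup>2 \<le> n" for n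
    by (rule of_nat_le_iff[where 'a=real, THEN iffD1]) (use le[of n] in simp)
  have ge': "n \<le> (Suc (s n))\<^sup>2" for n
    by (rule of_nat_le_iff[where 'a=real, THEN iffD1]) (use ge[of n] in \<open>simp add: add.commute\<close>)
  have s_lim: "filterlim s at_top at_top"
    unfolding filterlim_at_top
  proof
    fix Z show "\<forall>\<^sub>F n in at_top. Z \<le> s n"
      using eventually_ge_at_top[of "Z\<^sup>2"]
    proof eventually_elim
      case (elim n)
      have "real Z = sqrt (real (Z\<^sup>2))" by simp
      also have "\<dots> \<le> sqrt (real n)" using elim by (intro real_sqrt_le_mono) (simp only: of_nat_le_iff)
      finally show ?case unfolding s_def by linarith
    qed
  qed
  have l1: "(\<lambda>k. Y (k\<^sup>2) / real (k\<^sup>2) * (real k / (real k + 1))\<^sup>2) \<longlonglongrightarrow> v * 1\<^sup>2"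
    by (intro tendsto_intros limY LIMSEQ_n_over_Suc_n[where 'a=real, unfolded of_nat_Suc add.commute[of 1]])
  have l2: "(\<lambda>k. Y ((Suc k)\<^sup>2) / real ((Suc k)\<^sup>2) * ((real k + 1) / real k)\<^sup>2) \<longlonglongrightarrow> v * 1\<^sup>2"
    by (intro tendsto_intros LIMSEQ_Suc[OF limY])
       (use LIMSEQ_Suc_n_over_n[where 'a=real] in \<open>simp add: add.commute\<close>)
  have ev: "\<forall>\<^sub>F n in at_top. n > 0 \<and> s n > 0"
    using eventually_gt_at_top[of 0] filterlim_at_top[THEN iffD1, OF s_lim, rule_format, of 1]
    by eventually_elim simp
  have "(\<lambda>n. Y n / real n) \<longlonglongrightarrow> v"
  proof (rule tendsto_sandwich)
    show "(\<lambda>n. Y ((s n)\<^sup>2) / real ((s n)\<^sup>2) * (real (s n) / (real (s n) + 1))\<^sup>2) \<longlonglongrightarrow> v"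
      using filterlim_compose[OF l1 s_lim] by simp
    show "(\<lambda>n. Y ((Suc (s n))\<^sup>2) / real ((Suc (s n))\<^sup>2) * ((real (s n) + 1) / real (s n))\<^sup>2) \<longlonglongrightarrow> v"
      using filterlim_compose[OF l2 s_lim] by simp
    show "\<forall>\<^sub>F n in at_top. Y ((s n)\<^sup>2) / real ((s n)\<^sup>2) * (real (s n) / (real (s n) + 1))\<^sup>2 \<le> Y n / real n"
      using ev
    proof eventually_elim
      case (elim n)
      have "Y ((s n)\<^sup>2) / real ((s n)\<^sup>2) * (real (s n) / (real (s n) + 1))\<^sup>2 = Y ((s n)\<^sup>2) / (real (s n) + 1)\<^sup>2"
        using elim by (simp add: power_divide)
      also have "\<dots> \<le> Y n / real n"
        using elim ge[of n] by (intro frac_le Y le') auto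
      finally show ?case .
    qed
    show "\<forall>\<^sub>F n in at_top. Y n / real n \<le> Y ((Suc (s n))\<^sup>2) / real ((Suc (s n))\<^sup>2) * ((real (s n) + 1) / real (s n))\<^sup>2"
      using ev
    proof eventually_elim
      case (elim n)
      have "Y n / real n \<le> Y ((Suc (s n))\<^sup>2) / (real (s n))\<^sup>2"
        using elim le[of n] by (intro frac_le Y ge') auto
      then show ?case using elim by (simp add: power_divide add.commute)
    qed
  qed
  from tendsto_add[OF this X0] show ?thesis by (simp add: Y_def diff_divide_distrib)
qed

text \<open>The squared deviation of \<open>X n / n\<close> at \<open>n = k^2\<close> has
  expectation of order \<open>1 / k^2\<close>, which is summable. Second moments therefore give
  almost sure convergence along the squares, and monotonicity fills in the rest.\<close>

lemma (in prob_space) strong_law_mono: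
  fixes X :: "nat \<Rightarrow> 'a \<Rightarrow> real"
  assumes [measurable]: "\<And>n. X n \<in> borel_measurable M"
    and mono: "AE w in M. incseq (\<lambda>n. X n w)"
    and bound: "\<And>n. (\<integral>\<^sup>+w. ennreal ((X n w - real n * v)\<^sup>2) \<partial>M) \<le> ennreal (C * real n)"
  shows "AE w in M. (\<lambda>n. X n w / real n) \<longlonglongrightarrow> v"
proof -
  let ?D = "\<lambda>k w. ((X (k\<^sup>2) w - real (k\<^sup>2) * v) / real (k\<^sup>2))\<^sup>2"
  \<comment> \<open>The hypothesis admits a negative \<open>C\<close>, which \<open>ennreal\<close>
    reads as 0.\<close>
  let ?C = "max C 0"
  have D: "(\<integral>\<^sup>+w. ennreal (?D (Suc k) w) \<partial>M) \<le> ennreal (?C * (1 / (real (Suc k))\<^sup>2))" for k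
  proof -
    let ?n = "(Suc k)\<^sup>2"
    have n: "real ?n > 0" by simp
    have "(\<integral>\<^sup>+w. ennreal (?D (Suc k) w) \<partial>M) = (\<integral>\<^sup>+w. ennreal (1 / (real ?n)\<^sup>2) * ennreal ((X ?n w - real ?n * v)\<^sup>2) \<partial>M)"
      by (intro nn_integral_cong) (simp add: ennreal_mult[symmetric] power_divide)
    also have "\<dots> = ennreal (1 / (real ?n)\<^sup>2) * (\<integral>\<^sup>+w. ennreal ((X ?n w - real ?n * v)\<^sup>2) \<partial>M)"
      by (intro nn_integral_cmult) measurable
    also have "\<dots> \<le> ennreal (1 / (real ?n)\<^sup>2) * ennreal (?C * real ?n)"
      by (intro mult_left_mono order_trans[OF bound] ennreal_leI mult_right_mono) auto
    also have "\<dots> = ennreal (1 / (real ?n)\<^sup>2 * (?C * real ?n))"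
      by (rule ennreal_mult[symmetric]) auto
    also have "1 / (real ?n)\<^sup>2 * (?C * real ?n) = ?C * (1 / (real (Suc k))\<^sup>2)"
      unfolding of_nat_power by (simp add: field_simps power2_eq_square del: of_nat_Suc)
    finally show ?thesis .
  qed
  have "(\<integral>\<^sup>+w. (\<Sum>k. ennreal (?D (Suc k) w)) \<partial>M) = (\<Sum>k. \<integral>\<^sup>+w. ennreal (?D (Suc k) w) \<partial>M)"
    by (intro nn_integral_suminf) measurable
  also have "\<dots> \<le> (\<Sum>k. ennreal (?C * (1 / (real (Suc k))\<^sup>2)))"
    by (intro suminf_le D) auto
  also have "\<dots> < \<infinity>"
  proof -
    have "summable (\<lambda>k. 1 / (real (Suc k))\<^sup>2)"
      using inverse_power_summable[of 2, where 'a=real] by (subst summable_Suc_iff) (simp add: field_simps)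
    then have "summable (\<lambda>k. ?C * (1 / (real (Suc k))\<^sup>2))" by (rule summable_mult)
    then show ?thesis by (subst suminf_ennreal2) (auto simp: less_top[symmetric])
  qed
  finally have "AE w in M. (\<Sum>k. ennreal (?D (Suc k) w)) \<noteq> \<infinity>"
    by (intro nn_integral_PInf_AE) auto
  with mono show ?thesis
  proof eventually_elim
    case (elim w)
    have "summable (\<lambda>k. ?D (Suc k) w)"
      using elim(2) by (intro summable_suminf_not_top) auto
    then have "(\<lambda>k. ?D (Suc k) w) \<longlonglongrightarrow> 0" by (rule summable_LIMSEQ_zero)
    then have "(\<lambda>k. ?D k w) \<longlonglongrightarrow> 0" by (subst (asm) filterlim_sequentially_Suc)
    then have "(\<lambda>k. sqrt (?D k w)) \<longlonglongrightarrow> sqrt 0" by (rule tendsto_real_sqrt)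
    then have l: "(\<lambda>k. (X (k\<^sup>2) w - real (k\<^sup>2) * v) / real (k\<^sup>2)) \<longlonglongrightarrow> 0"
      by (simp only: real_sqrt_abs real_sqrt_zero) (rule tendsto_rabs_zero_cancel)
    have "(\<lambda>k. X (k\<^sup>2) w / real (k\<^sup>2) - v) \<longlonglongrightarrow> 0"
      by (rule Lim_transform_eventually[OF l])
         (use eventually_gt_at_top[of 0] in eventually_elim, simp add: field_simps)
    then have "(\<lambda>k. X (k\<^sup>2) w / real (k\<^sup>2)) \<longlonglongrightarrow> v" by (simp add: LIM_zero_iff)
    then show ?case by (intro tendsto_of_squares_mono elim)
  qed
qed

section \<open>The walk driven by gaps, ages and marks\<close>

text \<open>
  In \<open>look E F c b n\<close>, \<open>E\<close> marks the earlier attempts on the edge in question, \<open>F\<close> those whose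
  outcome is out of date, and \<open>b\<close> is the state drawn if there is nothing to remember.
\<close>

primrec look :: "(nat \<Rightarrow> bool) \<Rightarrow> (nat \<Rightarrow> bool) \<Rightarrow> (nat \<Rightarrow> bool) \<Rightarrow> bool \<Rightarrow> nat \<Rightarrow> bool" where
  "look E F c b 0 = b"
| "look E F c b (Suc j) = (if E j then if F j then b else c j else look E F c b j)"

definition pos :: "(nat \<Rightarrow> int ^ 'd::finite) \<Rightarrow> (nat \<Rightarrow> bool) \<Rightarrow> nat \<Rightarrow> int ^ 'd" where
  "pos z c n = (\<Sum>i<n. if c i then z i else 0)"

definition edge :: "(nat \<Rightarrow> int ^ 'd::finite) \<Rightarrow> (nat \<Rightarrow> bool) \<Rightarrow> nat \<Rightarrow> (int ^ 'd) set" where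
  "edge z c n = {pos z c n, pos z c n + z n}"

text \<open>The first match of the backward scan is the last attempt on the edge of proposal
  \<open>n\<close>, and \<open>sum g {j<..n}\<close> is the time since ring \<open>j\<close>: an age
  of at most this length means a refresh in between.\<close>

definition new_state ::
    "(nat \<Rightarrow> int ^ 'd::finite) \<Rightarrow> (nat \<Rightarrow> real) \<Rightarrow> real \<Rightarrow> bool \<Rightarrow> (nat \<Rightarrow> bool) \<Rightarrow> nat \<Rightarrow> bool" where
  "new_state z g a b c n =
     look (\<lambda>j. edge z c j = edge z c n) (\<lambda>j. a \<le> sum g {j<..n}) c b n"

text \<open>Which edge is attempted at ring \<open>n\<close> depends on all earlier outcomes, so the
  recursion carries the whole outcome function. The value \<open>True\<close> at rings not yet
  reached is a placeholder that is never read.\<close>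

primrec pattern :: "(nat \<Rightarrow> int ^ 'd::finite) \<Rightarrow> (nat \<Rightarrow> real) \<Rightarrow> (nat \<Rightarrow> real) \<Rightarrow> (nat \<Rightarrow> bool) \<Rightarrow>
    nat \<Rightarrow> nat \<Rightarrow> bool" where
  "pattern z g A B 0 = (\<lambda>_. True)"
| "pattern z g A B (Suc n) =
     (pattern z g A B n)(n := new_state z g (A n) (B n) (pattern z g A B n) n)"

definition passes :: "(nat \<Rightarrow> int ^ 'd::finite) \<Rightarrow> (nat \<Rightarrow> real) \<Rightarrow> (nat \<Rightarrow> real) \<Rightarrow> (nat \<Rightarrow> bool) \<Rightarrow>
    nat \<Rightarrow> bool" where
  "passes z g A B n = pattern z g A B (Suc n) n"

lemma look_cong:
  assumes "\<And>j. j < n \<Longrightarrow> E j = E' j" "\<And>j. j < n \<Longrightarrow> F j = F' j" "\<And>j. j < n \<Longrightarrow> c j = c' j"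
  shows "look E F c b n = look E' F' c' b n"
  using assms by (induction n) auto

lemma pos_cong:
  assumes "\<And>j. j < n \<Longrightarrow> z j = z' j" "\<And>j. j < n \<Longrightarrow> c j = c' j"
  shows "pos z c n = pos z' c' n"
  unfolding pos_def using assms by (intro sum.cong) auto

lemma edge_cong:
  assumes "\<And>j. j \<le> n \<Longrightarrow> z j = z' j" "\<And>j. j < n \<Longrightarrow> c j = c' j"
  shows "edge z c n = edge z' c' n"
  unfolding edge_def using assms pos_cong[of n z z' c c'] by simp

lemma new_state_cong:
  assumes "\<And>j. j \<le> n \<Longrightarrow> z j = z' j" "\<And>j. j \<le> n \<Longrightarrow> g j = g' j" "\<And>j. j < n \<Longrightarrow> c j = c' j"
  shows "new_state z g a b c n = new_state z' g' a b c' n"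
proof -
  have e: "edge z c j = edge z' c' j" if "j \<le> n" for j
    using that assms by (intro edge_cong) auto
  have s: "sum g {j<..n} = sum g' {j<..n}" for j
    using assms(2) by (intro sum.cong) auto
  show ?thesis
    unfolding new_state_def by (intro look_cong) (simp_all add: e s assms(3))
qed

lemma pattern_eq: "j < n \<Longrightarrow> pattern z g A B n j = passes z g A B j"
proof (induction n)
  case (Suc n)
  then show ?case by (cases "j = n") (auto simp: passes_def)
qed simp

lemma passes_unfold: "passes z g A B n = new_state z g (A n) (B n) (passes z g A B) n"
proof -
  have "passes z g A B n = new_state z g (A n) (B n) (pattern z g A B n) n"
    by (simp add: passes_def)
  also have "\<dots> = new_state z g (A n) (B n) (passes z g A B) n"
    by (rule new_state_cong) (auto simp: pattern_eq)
  finally show ?thesis .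
qed

lemma passes_cong:
  assumes "\<And>j. j \<le> n \<Longrightarrow> z j = z' j" "\<And>j. j \<le> n \<Longrightarrow> g j = g' j"
    "\<And>j. j \<le> n \<Longrightarrow> A j = A' j" "\<And>j. j \<le> n \<Longrightarrow> B j = B' j"
  shows "passes z g A B n = passes z' g' A' B' n"
  using assms
proof (induction n rule: less_induct)
  case (less n)
  show ?case
    unfolding passes_unfold[of z g A B n] passes_unfold[of z' g' A' B' n] less.prems(3)[OF order_refl]
      less.prems(4)[OF order_refl]
    by (rule new_state_cong) (use less in auto)
qed

lemma look_True: "b \<Longrightarrow> (\<And>j. j < n \<Longrightarrow> c j) \<Longrightarrow> look E F c b n"
  by (induction n) auto

text \<open>Every outcome is either a mark or a copy of an earlier outcome, so a failure descends
  from some mark \<open>False\<close>. This is the source of the factor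
  \<open>1 - p\<close>.\<close>

lemma not_passes_imp: "\<not> passes z g A B n \<Longrightarrow> \<exists>j\<le>n. \<not> B j"
proof (rule ccontr)
  assume *: "\<not> passes z g A B n" "\<not> (\<exists>j\<le>n. \<not> B j)"
  have "passes z g A B m" if "m \<le> n" for m
    using that
  proof (induction m rule: less_induct)
    case (less m)
    then show ?case
      unfolding passes_unfold[of z g A B m] new_state_def using * by (intro look_True) auto
  qed
  with * show False by simp
qed

section \<open>Restarting the outcomes at a later ring\<close>

lemma pos_shift: "pos z c (l + m) = pos z c m + pos (\<lambda>i. z (i + m)) (\<lambda>i. c (i + m)) l"
  by (induction l) (auto simp: pos_def)

lemma edge_shift:
  "edge z c (l + m) = (+) (pos z c m) ` edge (\<lambda>i. z (i + m)) (\<lambda>i. c (i + m)) l"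
  by (simp add: edge_def pos_shift add.assoc)

text \<open>The gap \<open>g m\<close> precedes ring \<open>m\<close>, so an age of at most
  \<open>sum g {m..j}\<close> at ring \<open>j\<close> makes every attempt before ring
  \<open>m\<close> out of date. From ring \<open>m\<close> on the walk behaves like one started
  there, up to a translation, which does not alter which edges coincide.\<close>

lemma passes_shift:
  assumes g: "\<And>i. g i \<ge> 0" and cut: "\<And>j. m \<le> j \<Longrightarrow> j \<le> k + m \<Longrightarrow> A j \<le> sum g {m..j}"
  shows "passes z g A B (k + m) =
    passes (\<lambda>i. z (i + m)) (\<lambda>i. g (i + m)) (\<lambda>i. A (i + m)) (\<lambda>i. B (i + m)) k"
  using cut
proof (induction k rule: less_induct)
  case (less k)
  let ?c = "passes z g A B"
  let ?z = "\<lambda>i. z (i + m)" and ?g = "\<lambda>i. g (i + m)"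
  let ?c' = "passes ?z ?g (\<lambda>i. A (i + m)) (\<lambda>i. B (i + m))"
  have IH: "?c (l + m) = ?c' l" if "l < k" for l
    using that less by auto
  have e: "edge z ?c (l + m) = (+) (pos z ?c m) ` edge ?z ?c' l" if "l \<le> k" for l
    unfolding edge_shift using that IH by (intro arg_cong[where f="image _"] edge_cong) auto
  have E: "edge z ?c (l + m) = edge z ?c (k + m) \<longleftrightarrow> edge ?z ?c' l = edge ?z ?c' k" if "l \<le> k" for l
    using e[OF that] e[OF order_refl] by (simp add: inj_image_eq_iff)
  have S: "sum g {l + m<..k + m} = sum ?g {l<..k}" for l
    using sum.shift_bounds_cl_nat_ivl[of g "Suc l" m k]
    by (simp add: atLeastSucAtMost_greaterThanAtMost[symmetric])
  let ?L = "look (\<lambda>j. edge z ?c j = edge z ?c (k + m)) (\<lambda>j. A (k + m) \<le> sum g {j<..k + m}) ?c (B (k + m))"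
  have forget: "A (k + m) \<le> sum g {j<..k + m}" if "j < m" for j
  proof -
    have "A (k + m) \<le> sum g {m..k + m}" using less.prems[of "k + m"] by simp
    also have "\<dots> \<le> sum g {j<..k + m}" using that g by (intro sum_mono2) auto
    finally show ?thesis .
  qed
  \<comment> \<open>Below \<open>m\<close> a matching edge is out of date and any other edge is
    skipped, so the scan arrives at \<open>m\<close> with the value with which the shifted scan
    begins.\<close>
  have L0: "?L j = B (k + m)" if "j \<le> m" for j
    using that by (induction j) (auto simp: forget)
  have "?L (l + m) = look (\<lambda>j. edge ?z ?c' j = edge ?z ?c' k)
      (\<lambda>j. A (k + m) \<le> sum ?g {j<..k}) ?c' (B (k + m)) l" if "l \<le> k" for l
    using that by (induction l) (simp_all add: L0 E S IH)
  from this[of k] show ?case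
    by (subst (1 2) passes_unfold) (simp add: new_state_def)
qed

text \<open>
  Looking backwards from ring \<open>i\<close>, \<open>w\<close> is the time by which the ages met so far reach beyond the
  current ring. When it drops to \<open>0\<close>, nothing before that ring matters.
\<close>

primrec alive :: "(nat \<Rightarrow> real) \<Rightarrow> (nat \<Rightarrow> real) \<Rightarrow> real \<Rightarrow> nat \<Rightarrow> nat \<Rightarrow> bool" where
  "alive g A w i 0 = True"
| "alive g A w i (Suc m) = (max w (A i) - g i > 0 \<and> alive g A (max w (A i) - g i) (i - 1) m)"

lemma alive_antimono: "alive g A w i m \<Longrightarrow> m' \<le> m \<Longrightarrow> alive g A w i m'"
proof (induction m arbitrary: w i m')
  case (Suc m)
  then show ?case by (cases m') auto
qed simp

text \<open>The reach \<open>max w (A i) - g i\<close> handed on to ring \<open>i - 1\<close>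
  accounts for the old reach and for the new age, so a cut that bounds it bounds both at ring
  \<open>i\<close>. The assumption \<open>m \<le> Suc i\<close> keeps \<open>i - 1\<close> from
  sticking at 0.\<close>

lemma not_alive_cut:
  assumes "\<not> alive g A w i m" "m \<le> Suc i"
  shows "\<exists>n. i < n + m \<and> n \<le> i \<and> w \<le> sum g {n..i} \<and> (\<forall>j\<in>{n..i}. A j \<le> sum g {n..j})"
  using assms
proof (induction m arbitrary: w i)
  case (Suc m)
  let ?w = "max w (A i) - g i"
  show ?case
  proof (cases "?w > 0")
    case False
    then show ?thesis by (intro exI[of _ i]) auto
  next
    case True
    then have na: "\<not> alive g A ?w (i - 1) m" using Suc.prems by simp
    then have m: "m \<noteq> 0" by (cases m) auto
    with Suc.prems obtain i' where i': "i = Suc i'" by (cases i) auto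
    with Suc.IH[OF na] Suc.prems obtain n where n: "i' < n + m" "n \<le> i'" "?w \<le> sum g {n..i'}"
      "\<forall>j\<in>{n..i'}. A j \<le> sum g {n..j}" by auto
    have "sum g {n..i} = sum g {n..i'} + g i" using n i' by simp
    then show ?thesis
      using n i' by (intro exI[of _ n]) (auto simp: le_Suc_eq)
  qed
qed simp

text \<open>Let \<open>m\<close> be the longest reach backwards from \<open>i\<close>. Just behind
  it lies a cut where the outcomes restart, so a mark \<open>False\<close> must occur within
  distance \<open>m\<close>, and at that distance the chain is still alive. A failure is thus
  covered by events that treat reach and mark separately.\<close>

lemma not_passes_witness:
  assumes g: "\<And>i. g i \<ge> 0" and np: "\<not> passes z g A B i"
  shows "\<exists>m\<le>i. alive g A 0 i m \<and> \<not> B (i - m)"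
proof -
  define m where "m = (GREATEST m. alive g A 0 i m \<and> m \<le> Suc i)"
  have m: "alive g A 0 i m \<and> m \<le> Suc i"
    unfolding m_def by (rule GreatestI_nat[of _ 0 "Suc i"]) auto
  have max: "m' \<le> m" if "alive g A 0 i m'" "m' \<le> Suc i" for m'
    unfolding m_def by (rule Greatest_le_nat[of _ m' "Suc i"]) (use that in auto)
  have "\<exists>j\<le>i. i - j \<le> m \<and> \<not> B j"
  \<comment> \<open>If \<open>m = Suc i\<close>, the reach does not end within the past, and all
    marks up to \<open>i\<close> are candidates.\<close>
  proof (cases "m = Suc i")
    case True
    then show ?thesis using not_passes_imp[OF np] by auto
  next
    case False
    then have "\<not> alive g A 0 i (Suc m)" using max[of "Suc m"] m by auto
    then obtain n where n: "i < n + Suc m" "n \<le> i" "\<forall>j\<in>{n..i}. A j \<le> sum g {n..j}"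
      using not_alive_cut[of g A 0 i "Suc m"] m False by auto
    have "passes z g A B (i - n + n) = passes (\<lambda>i. z (i + n)) (\<lambda>i. g (i + n)) (\<lambda>i. A (i + n)) (\<lambda>i. B (i + n)) (i - n)"
      by (rule passes_shift) (use g n in auto)
    with np n have "\<not> passes (\<lambda>i. z (i + n)) (\<lambda>i. g (i + n)) (\<lambda>i. A (i + n)) (\<lambda>i. B (i + n)) (i - n)" by simp
    from not_passes_imp[OF this] obtain j where "j \<le> i - n" "\<not> B (j + n)" by auto
    then show ?thesis using n by (intro exI[of _ "j + n"]) auto
  qed
  then obtain j where j: "j \<le> i" "i - j \<le> m" "\<not> B j" by auto
  then show ?thesis
    using alive_antimono[of g A 0 i m "i - j"] m by (intro exI[of _ "i - j"]) auto
qed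

text \<open>A reach that ends within fewer than \<open>i - j\<close> rings or exactly that many puts
  the cut at some \<open>n > j\<close>, and from there on the two sequences of proposals
  coincide.\<close>

lemma passes_agree_after:
  assumes g: "\<And>i. g i \<ge> 0" and na: "\<not> alive g A 0 i (i - j)"
    and eq: "\<And>l. j < l \<Longrightarrow> z l = z' l"
  shows "passes z g A B i = passes z' g A B i"
proof -
  obtain n where n: "i < n + (i - j)" "n \<le> i" "\<forall>j\<in>{n..i}. A j \<le> sum g {n..j}"
    using not_alive_cut[OF na diff_le_self[THEN le_SucI]] by blast
  have *: "passes y g A B (i - n + n) = passes (\<lambda>i. y (i + n)) (\<lambda>i. g (i + n)) (\<lambda>i. A (i + n)) (\<lambda>i. B (i + n)) (i - n)" for y
    by (rule passes_shift) (use g n in auto)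
  have "(\<lambda>i. z (i + n)) = (\<lambda>i. z' (i + n))" using n eq by auto
  with *[of z] *[of z'] n show ?thesis by simp
qed

text \<open>In contrast to \<open>passes_shift\<close>, the cut need not be at \<open>m\<close>: any
  cut \<open>n \<ge> m\<close> is a cut for the original walk and for the shifted one, and both
  reduce to the walk started at \<open>n\<close>.\<close>

lemma passes_shift_alive:
  assumes g: "\<And>i. g i \<ge> 0" and na: "\<not> alive g A 0 (k + m) (Suc k)"
  shows "passes z g A B (k + m) =
    passes (\<lambda>i. z (i + m)) (\<lambda>i. g (i + m)) (\<lambda>i. A (i + m)) (\<lambda>i. B (i + m)) k"
proof -
  have "Suc k \<le> Suc (k + m)" by simp
  from not_alive_cut[OF na this] obtain n where n0: "k + m < n + Suc k"
    and n1: "n \<le> k + m" "\<forall>j\<in>{n..k + m}. A j \<le> sum g {n..j}" by blast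
  from n0 have "m \<le> n" by simp
  note n = this n1
  have 1: "passes z g A B (k + m - n + n) =
    passes (\<lambda>i. z (i + n)) (\<lambda>i. g (i + n)) (\<lambda>i. A (i + n)) (\<lambda>i. B (i + n)) (k + m - n)"
    by (rule passes_shift) (use g n in auto)
  have 2: "passes (\<lambda>i. z (i + m)) (\<lambda>i. g (i + m)) (\<lambda>i. A (i + m)) (\<lambda>i. B (i + m)) (k + m - n + (n - m)) =
    passes (\<lambda>i. z (i + (n - m) + m)) (\<lambda>i. g (i + (n - m) + m)) (\<lambda>i. A (i + (n - m) + m)) (\<lambda>i. B (i + (n - m) + m)) (k + m - n)"
  proof (rule passes_shift)
    show "g (i + m) \<ge> 0" for i by (rule g)
    fix j assume j: "n - m \<le> j" "j \<le> k + m - n + (n - m)"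
    have "A (j + m) \<le> sum g {n..j + m}" using n j by auto
    also have "sum g {n..j + m} = (\<Sum>i = n - m..j. g (i + m))"
      using sum.shift_bounds_cl_nat_ivl[of g "n - m" m j] n by simp
    finally show "A (j + m) \<le> (\<Sum>i = n - m..j. g (i + m))" .
  qed
  have "k + m - n + n = k + m" "k + m - n + (n - m) = k" "\<And>i. i + (n - m) + m = i + n"
    using n by auto
  then show ?thesis using 1 2 by (simp only:)
qed

text \<open>
  Bounds the number of failed proposals that are affected by the value of the \<open>j\<close>-th step.
\<close>

definition err :: "(nat \<Rightarrow> real) \<Rightarrow> (nat \<Rightarrow> real) \<Rightarrow> (nat \<Rightarrow> bool) \<Rightarrow> nat \<Rightarrow> nat \<Rightarrow> real" where
  "err g A B n j = (\<Sum>i\<in>{j..<n}. \<Sum>m\<le>i. of_bool (alive g A 0 i (max (i - j) m) \<and> \<not> B (i - m)))"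

section \<open>Effect of the proposals on the position\<close>

lemma pos_nth: "pos z c n $ k = (\<Sum>i<n. if c i then z i $ k else 0)"
  unfolding pos_def by (simp add: if_distrib[of "\<lambda>x. x $ k"] cong: if_cong)

text \<open>Rings before \<open>j\<close> are untouched. A later ring contributes only if the two
  outcomes differ, which needs a reach back to \<open>j\<close> and a failure in one of the walks,
  hence a mark \<open>False\<close> within the reach. Both conditions concern the same backward
  chain, which explains \<open>max (i - j) m\<close> in \<open>err\<close>.\<close>

lemma pos_swap:
  fixes z z' :: "nat \<Rightarrow> int ^ 'd::finite"
  assumes g: "\<And>i. g i \<ge> 0" and eq: "\<And>l. l \<noteq> j \<Longrightarrow> z l = z' l" and j: "j < n"
    and b: "\<And>l. \<bar>z l $ k\<bar> \<le> 1" "\<And>l. \<bar>z' l $ k\<bar> \<le> 1"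
  shows "real_of_int (pos z' (passes z' g A B) n $ k) - real_of_int (pos z (passes z g A B) n $ k) \<ge>
    real_of_int (z' j $ k - z j $ k) - 2 * err g A B n j"
proof -
  let ?c = "passes z g A B" and ?c' = "passes z' g A B"
  let ?v = "\<lambda>i. real_of_int (if ?c i then z i $ k else 0)"
  let ?v' = "\<lambda>i. real_of_int (if ?c' i then z' i $ k else 0)"
  let ?e = "\<lambda>i. \<Sum>m\<le>i. of_bool (alive g A 0 i (max (i - j) m) \<and> \<not> B (i - m)) :: real"
  have e0: "?e i \<ge> 0" for i by (intro sum_nonneg) simp
  have e1: "?e i \<ge> 1" if al: "alive g A 0 i (i - j)" and np: "\<not> passes y g A B i" for i and y :: "nat \<Rightarrow> int ^ 'd"
  proof -
    obtain m where m: "m \<le> i" "alive g A 0 i m" "\<not> B (i - m)"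
      using not_passes_witness[OF g np] by auto
    have "1 = (of_bool (alive g A 0 i (max (i - j) m) \<and> \<not> B (i - m)) :: real)"
      using m al by (simp add: max_def)
    also have "\<dots> \<le> ?e i"
      by (rule member_le_sum[where f = "\<lambda>m. of_bool (alive g A 0 i (max (i - j) m) \<and> \<not> B (i - m))"])
        (use m in auto)
    finally show ?thesis .
  qed
  have before: "?v' i - ?v i = 0" if "i < j" for i
  proof -
    have "?c i = ?c' i" by (rule passes_cong) (use that eq in auto)
    then show ?thesis using that eq[of i] by simp
  qed
  have zb: "\<bar>real_of_int (z i $ k)\<bar> \<le> 1" "\<bar>real_of_int (z' i $ k)\<bar> \<le> 1" for i
    using b[of i] by (simp_all flip: of_int_abs)
  \<comment> \<open>The factor 2 is needed at \<open>i = j\<close> when both walks fail: the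
    difference of the two proposals, possibly 2, is then lost. At later rings the loss is at most
    1.\<close>
  have after: "?v' i - ?v i \<ge> (if i = j then real_of_int (z' j $ k - z j $ k) else 0) - 2 * ?e i"
    if "i \<ge> j" for i
  proof (cases "i = j")
    case True
    have "?e i \<ge> 1" if "\<not> ?c i \<or> \<not> ?c' i" using True that e1[of i] by auto
    then show ?thesis using True zb[of j] e0[of i] by (cases "?c i"; cases "?c' i") auto
  next
    case False
    then have z: "z i = z' i" using eq by simp
    show ?thesis
    proof (cases "?c i = ?c' i")
      case True
      then show ?thesis using False z e0[of i] by simp
    next
      case ne: False
      have "alive g A 0 i (i - j)"
      proof (rule ccontr)
        assume "\<not> alive g A 0 i (i - j)"
        from passes_agree_after[OF g this, of z z' B] ne eq show False by auto
      qed
      then have "?e i \<ge> 1" using ne e1[of i z] e1[of i z'] by auto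
      then show ?thesis using ne False z zb[of i] by (cases "?c i") auto
    qed
  qed
  have S: "{..<n} = {..<j} \<union> {j..<n}" using j by auto
  have "real_of_int (z' j $ k - z j $ k) - 2 * err g A B n j =
      (\<Sum>i\<in>{j..<n}. (if i = j then real_of_int (z' j $ k - z j $ k) else 0) - 2 * ?e i)"
    using j by (simp add: err_def sum_subtractf sum_distrib_left)
  also have "\<dots> \<le> (\<Sum>i\<in>{j..<n}. ?v' i - ?v i)"
    by (intro sum_mono after) auto
  also have "\<dots> = (\<Sum>i<n. ?v' i - ?v i)"
    unfolding S by (subst sum.union_disjoint) (auto simp: before)
  also have "\<dots> = real_of_int (pos z' ?c' n $ k) - real_of_int (pos z ?c n $ k)"
    by (simp add: pos_nth sum_subtractf)
  finally show ?thesis .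
qed

text \<open>The replacements lead through hybrid sequences, and the gains telescope. The error of a
  swap is bounded by gaps, ages and marks alone, so it is the same bound whatever the hybrid looks
  like.\<close>

lemma pos_coupling:
  fixes z z' :: "nat \<Rightarrow> int ^ 'd::finite"
  assumes g: "\<And>i. g i \<ge> 0" and b: "\<And>l. \<bar>z l $ k\<bar> \<le> 1" "\<And>l. \<bar>z' l $ k\<bar> \<le> 1"
    and up: "\<And>l. z l \<noteq> z' l \<Longrightarrow> z' l $ k - z l $ k \<ge> 1"
  shows "real_of_int (pos z' (passes z' g A B) n $ k) - real_of_int (pos z (passes z g A B) n $ k) \<ge>
    (\<Sum>j<n. of_bool (z j \<noteq> z' j) * (1 - 2 * err g A B n j))"
proof -
  define h where "h j i = (if i < j then z' i else z i)" for i j :: nat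
  let ?S = "\<lambda>y. real_of_int (pos y (passes y g A B) n $ k)"
  have hb: "\<bar>h j l $ k\<bar> \<le> 1" for j l using b by (auto simp: h_def)
  have step: "?S (h (Suc j)) - ?S (h j) \<ge> of_bool (z j \<noteq> z' j) * (1 - 2 * err g A B n j)" if "j < n" for j
  proof (cases "z j = z' j")
    case True
    then have "h (Suc j) = h j" by (auto simp: h_def fun_eq_iff less_Suc_eq)
    then show ?thesis using True by simp
  next
    case False
    have "real_of_int (h (Suc j) j $ k - h j j $ k) - 2 * err g A B n j \<le> ?S (h (Suc j)) - ?S (h j)"
      by (rule pos_swap[OF g _ that hb hb]) (auto simp: h_def)
    moreover have "real_of_int (h (Suc j) j $ k - h j j $ k) \<ge> 1"
      using up[OF False] by (simp only: h_def) simp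
    ultimately show ?thesis using False by simp
  qed
  have "passes (h n) g A B i = passes z' g A B i" if "i < n" for i
    by (rule passes_cong) (use that in \<open>auto simp: h_def\<close>)
  then have hn: "pos (h n) (passes (h n) g A B) n = pos z' (passes z' g A B) n"
    by (intro pos_cong) (auto simp: h_def)
  have h0: "h 0 = z" by (simp add: h_def fun_eq_iff)
  have "(\<Sum>j<n. of_bool (z j \<noteq> z' j) * (1 - 2 * err g A B n j)) \<le> (\<Sum>j<n. ?S (h (Suc j)) - ?S (h j))"
    by (intro sum_mono step) auto
  also have "\<dots> = ?S (h n) - ?S (h 0)" by (rule sum_lessThan_telescope)
  finally show ?thesis by (simp add: hn h0)
qed

text \<open>Outcomes depend on the proposals only through coincidences of edges, and an injective
  additive map preserves these. It is applied to reflections.\<close>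

lemma passes_additive:
  fixes R :: "int ^ 'd::finite \<Rightarrow> int ^ 'd"
  assumes R: "inj R" "R 0 = 0" "\<And>x y. R (x + y) = R x + R y"
  shows "passes (\<lambda>i. R (z i)) g A B n = passes z g A B n"
    and "pos (\<lambda>i. R (z i)) c n = R (pos z c n)"
proof -
  have pos: "pos (\<lambda>i. R (z i)) c n = R (pos z c n)" for c n
    by (induction n) (auto simp: pos_def R)
  have edge: "edge (\<lambda>i. R (z i)) c n = R ` edge z c n" for c n
    by (simp add: edge_def pos R)
  have new: "new_state (\<lambda>i. R (z i)) g a b c n = new_state z g a b c n" for a b c n
    unfolding new_state_def edge using R(1) by (simp add: inj_image_eq_iff)
  show "passes (\<lambda>i. R (z i)) g A B n = passes z g A B n"
  proof (induction n rule: less_induct)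
    case (less n)
    have "new_state z g (A n) (B n) (passes (\<lambda>i. R (z i)) g A B) n = new_state z g (A n) (B n) (passes z g A B) n"
      by (rule new_state_cong) (use less in auto)
    then show ?case by (subst (1 2) passes_unfold) (simp only: new)
  qed
  show "pos (\<lambda>i. R (z i)) c n = R (pos z c n)" by (rule pos)
qed

section \<open>Measurability of outcomes and reach\<close>

lemma measurable_count_space2:
  fixes f :: "'a \<Rightarrow> 'b::countable" and g :: "'a \<Rightarrow> 'c::countable"
  assumes f: "f \<in> M \<rightarrow>\<^sub>M count_space UNIV" and g: "g \<in> M \<rightarrow>\<^sub>M count_space UNIV"
  shows "(\<lambda>x. h (f x) (g x)) \<in> M \<rightarrow>\<^sub>M count_space UNIV"
proof (rule measurable_compose_countable[OF _ f])
  fix i show "(\<lambda>x. h i (g x)) \<in> M \<rightarrow>\<^sub>M count_space UNIV"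
    by (rule measurable_compose[OF g]) simp
qed

lemma measurable_pos:
  fixes z :: "'a \<Rightarrow> nat \<Rightarrow> int ^ 'd::finite"
  assumes z: "\<And>i. (\<lambda>x. z x i) \<in> M \<rightarrow>\<^sub>M count_space UNIV"
    and c: "\<And>i. i < n \<Longrightarrow> (\<lambda>x. c x i) \<in> M \<rightarrow>\<^sub>M count_space (UNIV :: bool set)"
  shows "(\<lambda>x. pos (z x) (c x) n) \<in> M \<rightarrow>\<^sub>M count_space UNIV"
  using c
proof (induction n)
  case (Suc n)
  have "(\<lambda>x. pos (z x) (c x) n + (if c x n then z x n else 0)) \<in> M \<rightarrow>\<^sub>M count_space UNIV"
    by (rule measurable_count_space2[where h="(+)"], use Suc in simp)
       (rule measurable_count_space2[where h="\<lambda>c z. if c then z else 0"], use Suc z in simp_all)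
  then show ?case by (simp add: pos_def)
qed (simp add: pos_def)

text \<open>The type of sets of lattice points is uncountable, so equality of edges is decided on
  pairs of a position and a step, which form a countable type.\<close>

lemma measurable_edge_eq:
  fixes z :: "'a \<Rightarrow> nat \<Rightarrow> int ^ 'd::finite"
  assumes z: "\<And>i. (\<lambda>x. z x i) \<in> M \<rightarrow>\<^sub>M count_space UNIV"
    and c: "\<And>i. i < n \<Longrightarrow> (\<lambda>x. c x i) \<in> M \<rightarrow>\<^sub>M count_space (UNIV :: bool set)" and j: "j \<le> n"
  shows "Measurable.pred M (\<lambda>x. edge (z x) (c x) j = edge (z x) (c x) n)"
proof -
  have pz: "(\<lambda>x. (pos (z x) (c x) i, z x i)) \<in> M \<rightarrow>\<^sub>M count_space UNIV" if "i \<le> n" for i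
    by (rule measurable_count_space2[where h=Pair]) (use that in \<open>auto intro!: measurable_pos z c\<close>)
  show ?thesis
    unfolding edge_def
    using measurable_count_space2[OF pz[OF j] pz[OF order_refl],
        where h="\<lambda>(p, q) (r, s). {p, p + q} = {r, r + s}"] by simp
qed

lemma measurable_look:
  assumes "\<And>j. j < n \<Longrightarrow> Measurable.pred M (\<lambda>x. E x j)" "\<And>j. j < n \<Longrightarrow> Measurable.pred M (\<lambda>x. F x j)"
    "\<And>j. j < n \<Longrightarrow> Measurable.pred M (\<lambda>x. c x j)" and [measurable]: "Measurable.pred M b"
  shows "Measurable.pred M (\<lambda>x. look (E x) (F x) (c x) (b x) n)"
  using assms(1-3)
proof (induction n)
  case (Suc n)
  have [measurable]: "Measurable.pred M (\<lambda>x. E x n)" "Measurable.pred M (\<lambda>x. F x n)"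
    "Measurable.pred M (\<lambda>x. c x n)" "Measurable.pred M (\<lambda>x. look (E x) (F x) (c x) (b x) n)"
    using Suc by auto
  show ?case by (simp, measurable)
qed simp

lemma measurable_passes:
  fixes z :: "'a \<Rightarrow> nat \<Rightarrow> int ^ 'd::finite"
  assumes z: "\<And>i. (\<lambda>x. z x i) \<in> M \<rightarrow>\<^sub>M count_space UNIV"
    and g [measurable]: "\<And>i. (\<lambda>x. g x i) \<in> borel_measurable M" and A [measurable]: "\<And>i. (\<lambda>x. A x i) \<in> borel_measurable M"
    and B [measurable]: "\<And>i. Measurable.pred M (\<lambda>x. B x i)"
  shows "Measurable.pred M (\<lambda>x. passes (z x) (g x) (A x) (B x) n)"
proof (induction n rule: less_induct)
  case (less n)
  show ?case
    unfolding passes_unfold[of _ _ _ _ n] new_state_def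
  proof (rule measurable_look)
    fix j assume j: "j < n"
    show "Measurable.pred M (\<lambda>x. edge (z x) (passes (z x) (g x) (A x) (B x)) j = edge (z x) (passes (z x) (g x) (A x) (B x)) n)"
      by (rule measurable_edge_eq) (use z less j in auto)
    show "Measurable.pred M (\<lambda>x. A x n \<le> sum (g x) {j<..n})" by measurable
  qed (use less in auto)
qed

lemma measurable_alive:
  assumes [measurable]: "\<And>i. (\<lambda>x. g x i) \<in> borel_measurable M" "\<And>i. (\<lambda>x. A x i) \<in> borel_measurable M"
    and w: "w \<in> borel_measurable M"
  shows "Measurable.pred M (\<lambda>x. alive (g x) (A x) (w x) i m)"
  using w
proof (induction m arbitrary: w i)
  case (Suc m)
  note [measurable] = Suc.prems
  have [measurable]: "Measurable.pred M (\<lambda>x. alive (g x) (A x) (max (w x) (A x i) - g x i) (i - 1) m)"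
    by (rule Suc.IH) measurable
  show ?case unfolding alive.simps by measurable
qed simp

section \<open>Geometric loss of memory\<close>

lemma sets_exponential_gap [measurable_cong, simp]: "sets (exponential_gap r) = sets borel"
  by (simp add: exponential_gap_def)

lemma space_exponential_gap [simp]: "space (exponential_gap r) = UNIV"
  by (simp add: exponential_gap_def)

lemma AE_exponential_gap_pos: "AE x in exponential_gap r. x > 0"
proof -
  have "AE x in lborel. x \<noteq> (0::real)" by (rule AE_lborel_singleton)
  then have "AE x in lborel. 0 < ennreal (exponential_density r x) \<longrightarrow> x > 0"
    by eventually_elim (auto simp: exponential_density_def)
  then show ?thesis unfolding exponential_gap_def by (subst AE_density) auto
qed

lemma distributed_exponential_gap:
  "distributed (exponential_gap r) lborel (\<lambda>x. x) (exponential_density r)"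
proof -
  have "distr (exponential_gap r) lborel (\<lambda>x. x) = exponential_gap r"
    by (rule distr_id2) (simp add: exponential_gap_def)
  then show ?thesis by (auto simp: distributed_def exponential_gap_def)
qed

lemma measure_exponential_gap_greaterThan:
  assumes "r > 0" "t \<ge> 0"
  shows "measure (exponential_gap r) {t<..} = exp (- r * t)"
proof -
  interpret prob_space "exponential_gap r" by (rule prob_space_exponential_gap) fact
  show ?thesis
    using exponential_distributedD_gt[OF distributed_exponential_gap assms(2,1)]
    by (simp add: greaterThan_def mult.commute)
qed

lemma emeasure_exponential_gap_greaterThan:
  assumes "r > 0" "t \<ge> 0"
  shows "emeasure (exponential_gap r) {t<..} = ennreal (exp (- r * t))"
proof -
  interpret prob_space "exponential_gap r" by (rule prob_space_exponential_gap) fact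
  show ?thesis
    by (simp only: emeasure_eq_measure measure_exponential_gap_greaterThan[OF assms])
qed

text \<open>Tilting by \<open>exp (s * x)\<close> turns the density of rate \<open>r\<close> into a
  multiple of the density of rate \<open>r - s\<close>.\<close>

lemma nn_integral_exponential_gap_exp:
  assumes "s < r" "r > 0"
  shows "(\<integral>\<^sup>+x. ennreal (exp (s * x)) \<partial>exponential_gap r) = ennreal (r / (r - s))"
proof -
  have "(\<integral>\<^sup>+x. ennreal (exp (s * x)) \<partial>exponential_gap r) =
      (\<integral>\<^sup>+x. ennreal (exponential_density r x) * ennreal (exp (s * x)) \<partial>lborel)"
    unfolding exponential_gap_def by (rule nn_integral_density) auto
  also have "\<dots> = (\<integral>\<^sup>+x. ennreal (r / (r - s)) * ennreal (exponential_density (r - s) x) \<partial>lborel)"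
  proof (rule nn_integral_cong)
    fix x :: real
    have "exponential_density r x * exp (s * x) = r / (r - s) * exponential_density (r - s) x"
    proof -
      have "exp (- x * r) * exp (s * x) = exp (- x * (r - s))"
        by (simp add: algebra_simps flip: exp_add)
      then show ?thesis using assms by (simp add: exponential_density_def)
    qed
    then show "ennreal (exponential_density r x) * ennreal (exp (s * x)) =
        ennreal (r / (r - s)) * ennreal (exponential_density (r - s) x)"
      using assms by (simp add: ennreal_mult[symmetric] exponential_density_nonneg)
  qed
  also have "\<dots> = ennreal (r / (r - s)) * (\<integral>\<^sup>+x. ennreal (exponential_density (r - s) x) \<partial>lborel)"
    by (rule nn_integral_cmult) auto
  also have "(\<integral>\<^sup>+x. ennreal (exponential_density (r - s) x) \<partial>lborel) = 1"
    using prob_space.emeasure_space_1[OF prob_space_exponential_density[of "r - s"]] assms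
    by (simp add: emeasure_density)
  finally show ?thesis by simp
qed

definition gap_age :: "real \<Rightarrow> (real \<times> real) measure" where
  "gap_age \<mu> = exponential_gap 1 \<Otimes>\<^sub>M exponential_gap \<mu>"

lemma prob_space_gap_age: "\<mu> > 0 \<Longrightarrow> prob_space (gap_age \<mu>)"
  unfolding gap_age_def by (intro prob_space_pair prob_space_exponential_gap) auto

lemma sets_gap_age [measurable_cong]: "sets (gap_age \<mu>) = sets (borel \<Otimes>\<^sub>M borel)"
  unfolding gap_age_def by (rule sets_pair_measure_cong) auto

lemma measurable_gap_age [measurable, simp]:
  "fst \<in> borel_measurable (gap_age \<mu>)" "snd \<in> borel_measurable (gap_age \<mu>)"
  by (simp_all cong: measurable_cong_sets)

text \<open>The exponential of a maximum is at most the sum of the exponentials. At the exponent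
  \<open>\<mu> / 2\<close> the age has a finite exponential moment, namely 2, and the gap
  contributes the factor \<open>1 / (1 + \<mu> / 2)\<close>, which is below 1.\<close>

lemma gap_age_exp_moment:
  assumes "\<mu> > 0"
  shows "(\<integral>\<^sup>+x. ennreal (exp (\<mu> / 2 * (max w (snd x) - fst x))) \<partial>gap_age \<mu>)
    \<le> ennreal (1 / (1 + \<mu> / 2) * (exp (\<mu> / 2 * w) + 2))"
proof -
  interpret G: prob_space "exponential_gap 1" by (rule prob_space_exponential_gap) simp
  interpret A: prob_space "exponential_gap \<mu>" by (rule prob_space_exponential_gap) fact
  have "(\<integral>\<^sup>+x. ennreal (exp (\<mu> / 2 * (max w (snd x) - fst x))) \<partial>gap_age \<mu>)
      \<le> (\<integral>\<^sup>+x. ennreal (exp (- (\<mu> / 2) * fst x)) * (ennreal (exp (\<mu> / 2 * w)) + ennreal (exp (\<mu> / 2 * snd x))) \<partial>gap_age \<mu>)"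
  proof (rule nn_integral_mono)
    fix x :: "real \<times> real"
    have "exp (\<mu> / 2 * max w (snd x)) \<le> exp (\<mu> / 2 * w) + exp (\<mu> / 2 * snd x)"
      by (auto simp: max_def)
    then have "exp (- (\<mu> / 2) * fst x) * exp (\<mu> / 2 * max w (snd x)) \<le>
        exp (- (\<mu> / 2) * fst x) * (exp (\<mu> / 2 * w) + exp (\<mu> / 2 * snd x))"
      by (intro mult_left_mono) auto
    moreover have "exp (\<mu> / 2 * (max w (snd x) - fst x)) = exp (- (\<mu> / 2) * fst x) * exp (\<mu> / 2 * max w (snd x))"
      by (simp add: algebra_simps flip: exp_add)
    ultimately show "ennreal (exp (\<mu> / 2 * (max w (snd x) - fst x))) \<le>
        ennreal (exp (- (\<mu> / 2) * fst x)) * (ennreal (exp (\<mu> / 2 * w)) + ennreal (exp (\<mu> / 2 * snd x)))"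
      by (simp flip: ennreal_mult ennreal_plus)
  qed
  also have "\<dots> = (\<integral>\<^sup>+g. \<integral>\<^sup>+a. ennreal (exp (- (\<mu> / 2) * g)) * (ennreal (exp (\<mu> / 2 * w)) + ennreal (exp (\<mu> / 2 * a))) \<partial>exponential_gap \<mu> \<partial>exponential_gap 1)"
    unfolding gap_age_def by (subst A.nn_integral_fst[symmetric]) auto
  also have "\<dots> = (\<integral>\<^sup>+g. ennreal (exp (- (\<mu> / 2) * g)) \<partial>exponential_gap 1) *
      (ennreal (exp (\<mu> / 2 * w)) + (\<integral>\<^sup>+a. ennreal (exp (\<mu> / 2 * a)) \<partial>exponential_gap \<mu>))"
    using A.emeasure_space_1
    by (simp add: nn_integral_cmult nn_integral_multc nn_integral_add)
  also have "\<dots> = ennreal (1 / (1 + \<mu> / 2)) * (ennreal (exp (\<mu> / 2 * w)) + ennreal 2)"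
    using assms nn_integral_exponential_gap_exp[of "- (\<mu> / 2)" 1]
    by (subst nn_integral_exponential_gap_exp) (auto simp: field_simps)
  also have "ennreal (exp (\<mu> / 2 * w)) + ennreal 2 = ennreal (exp (\<mu> / 2 * w) + 2)"
    by (rule ennreal_plus[symmetric]) auto
  also have "ennreal (1 / (1 + \<mu> / 2)) * \<dots> = ennreal (1 / (1 + \<mu> / 2) * (exp (\<mu> / 2 * w) + 2))"
    using assms by (intro ennreal_mult[symmetric]) (auto intro: add_nonneg_nonneg)
  finally show ?thesis .
qed

text \<open>
  \<open>D + exp (\<mu> / 2 * w)\<close> is a Lyapunov function for the chain \<open>w \<mapsto> max w a - g\<close> killed at \<open>0\<close>: for
  large \<open>w\<close> the exponential decreases, and for small \<open>w\<close> killing makes up for it if \<open>D\<close> is large.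
\<close>

lemma gap_age_drift:
  assumes \<mu>: "\<mu> > 0"
  shows "\<exists>D r. D \<ge> 1 \<and> 0 < r \<and> r < 1 \<and> (\<forall>w\<ge>0.
    (\<integral>\<^sup>+x. of_bool (max w (snd x) - fst x > 0) * ennreal (D + exp (\<mu> / 2 * (max w (snd x) - fst x))) \<partial>gap_age \<mu>)
     \<le> ennreal (r * (D + exp (\<mu> / 2 * w))))"
proof -
  interpret G: prob_space "exponential_gap 1" by (rule prob_space_exponential_gap) simp
  interpret A: prob_space "exponential_gap \<mu>" by (rule prob_space_exponential_gap) fact
  interpret GA: prob_space "gap_age \<mu>" by (rule prob_space_gap_age) fact
  define th where "th = \<mu> / 2"
  have th: "th > 0" using \<mu> by (simp add: th_def)
  define rho where "rho = 1 / (1 + th)"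
  have rho: "0 < rho" "rho < 1" using th by (auto simp: rho_def)
  \<comment> \<open>\<open>K\<close> solves \<open>rho * (K + 2) = K - 1\<close>: from the level
    \<open>K\<close> upwards the exponential loses at least 1 on average.\<close>
  define K where "K = (2 * rho + 1) / (1 - rho)"
  have K: "K > 1" "(1 - rho) * K - 2 * rho = 1" using rho by (auto simp: K_def field_simps)
  define w0 where "w0 = ln K / th"
  have w0: "w0 > 0" "exp (th * w0) = K" using K th by (auto simp: w0_def)
  \<comment> \<open>From any \<open>w \<le> w0\<close>, a gap above \<open>w0\<close> together with
    an age of at most \<open>w0\<close> kills the chain; \<open>dl\<close> is the probability of
    this.\<close>
  define dl where "dl = exp (- w0) * (1 - exp (- \<mu> * w0))"
  have dl: "0 < dl" "dl < 1"
  proof -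
    show "0 < dl" using \<mu> w0 by (simp add: dl_def)
    have "dl \<le> exp (- w0) * 1" unfolding dl_def by (intro mult_left_mono) auto
    also have "\<dots> < 1" using w0 by simp
    finally show "dl < 1" .
  qed
  \<comment> \<open>Killing takes away at least \<open>D * dl = 2 * (K + 2)\<close>. One half pays
    for the exponential term, the other leaves room for the factor \<open>r\<close>.\<close>
  define D where "D = 2 * (K + 2) / dl"
  have Ddl: "D * dl = 2 * (K + 2)" using dl by (simp add: D_def)
  have D: "D \<ge> 1"
  proof (rule ccontr)
    assume "\<not> D \<ge> 1"
    then have "D * dl \<le> 1 * dl" using dl by (intro mult_right_mono) auto
    then show False using Ddl K dl by simp
  qed
  \<comment> \<open>Since the exponential is at least 1, \<open>(1 - r) * (D + exp (th * w))\<close>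
    is at most \<open>exp (th * w) / K\<close>, which is what the drift provides above the level
    \<open>K\<close>.\<close>
  define r where "r = 1 - 1 / (K * (D + 1))"
  have KD: "K * (D + 1) > 1" using K D by (intro less_1_mult) auto
  then have r: "0 < r" "r < 1" by (auto simp: r_def)
  have r': "(1 - r) * (D + 1) = 1 / K" using K D by (simp add: r_def)
  have main: "(\<integral>\<^sup>+x. of_bool (max w (snd x) - fst x > 0) * ennreal (D + exp (th * (max w (snd x) - fst x))) \<partial>gap_age \<mu>)
     \<le> ennreal (r * (D + exp (th * w)))" if w: "w \<ge> 0" for w
  proof -
    let ?W = "\<lambda>x :: real \<times> real. max w (snd x) - fst x"
    let ?P = "measure (gap_age \<mu>) {x \<in> space (gap_age \<mu>). ?W x > 0}"
    let ?e = "exp (th * w)"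
    have e1: "?e \<ge> 1" using w th by simp
    have [measurable]: "Measurable.pred (gap_age \<mu>) (\<lambda>x. ?W x > 0)" by measurable
    have "(\<integral>\<^sup>+x. of_bool (?W x > 0) * ennreal (D + exp (th * ?W x)) \<partial>gap_age \<mu>) \<le>
        (\<integral>\<^sup>+x. ennreal D * indicator {x \<in> space (gap_age \<mu>). ?W x > 0} x + ennreal (exp (th * ?W x)) \<partial>gap_age \<mu>)"
      using D by (intro nn_integral_mono) (auto simp: indicator_def ennreal_plus[symmetric] simp del: ennreal_plus)
    also have "\<dots> = ennreal D * emeasure (gap_age \<mu>) {x \<in> space (gap_age \<mu>). ?W x > 0} +
        (\<integral>\<^sup>+x. ennreal (exp (th * ?W x)) \<partial>gap_age \<mu>)"
      by (subst nn_integral_add) (auto simp: nn_integral_cmult)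
    also have "\<dots> \<le> ennreal D * ennreal ?P + ennreal (rho * (?e + 2))"
      using gap_age_exp_moment[OF \<mu>, of w]
      by (intro add_mono) (simp_all add: GA.emeasure_eq_measure th_def rho_def)
    also have "\<dots> = ennreal (D * ?P + rho * (?e + 2))"
      using D rho by (simp flip: ennreal_mult ennreal_plus add: add_nonneg_nonneg)
    also have "\<dots> \<le> ennreal (r * (D + ?e))"
    proof (rule ennreal_leI)
      show "D * ?P + rho * (?e + 2) \<le> r * (D + ?e)"
      proof (cases "w \<le> w0")
        case True
        have "?e \<le> K" using True th w0(2)[symmetric] by simp
        have sub: "{w0<..} \<times> {..w0} \<subseteq> space (gap_age \<mu>) - {x \<in> space (gap_age \<mu>). ?W x > 0}"
          using True by (auto simp: gap_age_def space_pair_measure)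
        have "dl = measure (gap_age \<mu>) ({w0<..} \<times> {..w0})"
        proof -
          have "measure (exponential_gap \<mu>) {..w0} = 1 - exp (- \<mu> * w0)"
            using A.prob_compl[of "{w0<..}"] measure_exponential_gap_greaterThan[OF \<mu>, of w0] w0
            by (simp add: Compl_eq_Diff_UNIV[symmetric])
          moreover have "measure (exponential_gap 1) {w0<..} = exp (- w0)"
            using measure_exponential_gap_greaterThan[of 1 w0] w0 by simp
          moreover have "emeasure (gap_age \<mu>) ({w0<..} \<times> {..w0}) =
              emeasure (exponential_gap 1) {w0<..} * emeasure (exponential_gap \<mu>) {..w0}"
            unfolding gap_age_def by (rule A.emeasure_pair_measure_Times) auto
          ultimately show ?thesis
            by (simp add: dl_def measure_def enn2real_mult)
        qed
        also have "\<dots> \<le> measure (gap_age \<mu>) (space (gap_age \<mu>) - {x \<in> space (gap_age \<mu>). ?W x > 0})"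
          using sub by (intro GA.finite_measure_mono) auto
        also have "\<dots> = 1 - ?P" by (rule GA.prob_compl) measurable
        finally have "D * ?P \<le> D * (1 - dl)" using D by (intro mult_left_mono) auto
        also have "\<dots> = D - 2 * (K + 2)" using Ddl by (simp add: algebra_simps)
        finally have "D * ?P \<le> D - 2 * (K + 2)" .
        moreover have "rho * (?e + 2) \<le> 1 * (K + 2)"
          using rho \<open>?e \<le> K\<close> by (intro mult_mono) auto
        moreover have "(1 - r) * D \<le> 1"
        proof -
          have "(1 - r) * D \<le> (1 - r) * (D + 1)" using r by (intro mult_left_mono) auto
          also have "\<dots> \<le> 1" using r' K by simp
          finally show ?thesis .
        qed
        moreover have "r * ?e \<ge> 0" using r by simp
        ultimately show ?thesis using K by (simp add: algebra_simps)
      next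
        case False
        then have eK: "?e \<ge> K" using th w0(2)[symmetric] by simp
        have "D * ?P \<le> D" using D GA.prob_le_1 by (simp add: mult_left_le)
        moreover have "(1 - r) * (D + ?e) \<le> (1 - rho) * ?e - 2 * rho"
        proof -
          have "D + ?e \<le> (D + 1) * ?e" using mult_left_mono[OF e1, of D] D by (simp add: algebra_simps)
          then have "(1 - r) * (D + ?e) \<le> (1 - r) * ((D + 1) * ?e)" using r by (intro mult_left_mono) auto
          also have "\<dots> = ((1 - r) * (D + 1)) * ?e" by (simp only: mult.assoc)
          also have "\<dots> = ?e / K" unfolding r' by simp
          also have "\<dots> \<le> (1 - rho) * ?e - 2 * rho"
          proof -
            have "?e / K = ((1 - rho) * K - 2 * rho) * (?e / K)" unfolding K(2) by simp
            also have "\<dots> = (1 - rho) * ?e - 2 * rho * (?e / K)"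
              using K(1) by (simp only: left_diff_distrib) simp
            finally have "?e / K = (1 - rho) * ?e - 2 * rho * (?e / K)" .
            moreover have "2 * rho * 1 \<le> 2 * rho * (?e / K)"
              using rho eK K by (intro mult_left_mono) auto
            ultimately show ?thesis by linarith
          qed
          finally show ?thesis .
        qed
        ultimately show ?thesis by (simp add: algebra_simps)
      qed
    qed
    finally show ?thesis .
  qed
  show ?thesis
    by (intro exI[of _ D] exI[of _ r] conjI D r allI impI) (use main in \<open>simp add: th_def\<close>)
qed

lemma alive_cong:
  assumes "\<And>j. j \<le> i \<Longrightarrow> g j = g' j" "\<And>j. j \<le> i \<Longrightarrow> A j = A' j"
  shows "alive g A w i m = alive g' A' w i m"
  using assms
proof (induction m arbitrary: w i)
  case (Suc m)
  have "alive g A v (i - 1) m = alive g' A' v (i - 1) m" for v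
    by (rule Suc.IH) (use Suc.prems in auto)
  then show ?case using Suc.prems by simp
qed simp

text \<open>Only gaps and ages enter, so \<open>C\<close> and \<open>r\<close> are constants of
  \<mu>; this is the uniformity in the bias and in \<open>p\<close>. For \<open>m > Suc i\<close>
  the chain would read ring 0 repeatedly, hence the restriction on \<open>m\<close>.\<close>

definition alive_bound :: "real \<Rightarrow> real \<Rightarrow> real \<Rightarrow> bool" where
  "alive_bound \<mu> C r \<longleftrightarrow> C > 0 \<and> 0 < r \<and> r < 1 \<and> (\<forall>i m. m \<le> Suc i \<longrightarrow>
    (\<integral>\<^sup>+w. of_bool (alive (\<lambda>i. fst (w i)) (\<lambda>i. snd (w i)) 0 i m) \<partial>iid (gap_age \<mu>)) \<le> ennreal (C * r ^ m))"

text \<open>Each backward step reads a fresh independent pair and, by the drift, costs a factor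
  \<open>r\<close> in the Lyapunov function, which is at least 1. Its value at reach 0 is
  \<open>D + 1\<close>, the constant \<open>C\<close>.\<close>

lemma alive_tail:
  assumes \<mu>: "\<mu> > 0"
  shows "\<exists>C r. alive_bound \<mu> C r"
proof -
  obtain D r where D: "D \<ge> 1" and r: "0 < r" "r < 1" and drift: "\<And>w. w \<ge> 0 \<Longrightarrow>
    (\<integral>\<^sup>+x. of_bool (max w (snd x) - fst x > 0) * ennreal (D + exp (\<mu> / 2 * (max w (snd x) - fst x))) \<partial>gap_age \<mu>)
     \<le> ennreal (r * (D + exp (\<mu> / 2 * w)))"
    using gap_age_drift[OF \<mu>] by auto
  have P1: "prob_space (gap_age \<mu>)" by (rule prob_space_gap_age) fact
  let ?S = "iid (gap_age \<mu>)"
  interpret GA: prob_space "gap_age \<mu>" by fact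
  interpret S: sequence_space "gap_age \<mu>" by (rule sequence_spaceI) fact
  interpret P: pair_sigma_finite ?S "gap_age \<mu>" ..
  let ?V = "\<lambda>v. D + exp (\<mu> / 2 * v)"
  let ?al = "\<lambda>w. alive (\<lambda>i. fst (w i)) (\<lambda>i. snd (w i))"
  have meas: "Measurable.pred M (\<lambda>x. ?al (f x) (h x) i m)"
    if [measurable]: "f \<in> M \<rightarrow>\<^sub>M ?S" "h \<in> borel_measurable M" for M i m and f :: "'b \<Rightarrow> _" and h
    by (rule measurable_alive)
       (auto intro!: measurable_compose[OF measurable_compose[OF that(1) measurable_component_singleton]] that(2))
  have main: "(\<integral>\<^sup>+w. of_bool (?al w v i m) \<partial>?S) \<le> ennreal (r ^ m * ?V v)"
    if "m \<le> Suc i" "v \<ge> 0" for i m v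
    using that
  proof (induction m arbitrary: i v)
    case 0
    have "1 \<le> ennreal (?V v)" using D by (simp flip: ennreal_1 add: add_increasing2)
    then show ?case by (simp add: S.emeasure_space_1)
  next
    case (Suc m)
    let ?W = "\<lambda>x. max v (snd x) - fst x"
    \<comment> \<open>The continuation looks at rings below \<open>i\<close> only, so the resampled
      pair at \<open>i\<close> enters through the new reach alone.\<close>
    have upd: "?al (w(i := x)) v i (Suc m) \<longleftrightarrow> ?W x > 0 \<and> ?al w (?W x) (i - 1) m" for w x
    proof -
      have "?al (w(i := x)) u (i - 1) m = ?al w u (i - 1) m" for u
      proof (cases m)
        case (Suc m')
        then have "i > 0" using Suc.prems by simp
        then show ?thesis by (intro alive_cong) auto
      qed simp
      then show ?thesis by simp
    qed
    have [measurable]: "Measurable.pred (?S \<Otimes>\<^sub>M gap_age \<mu>) (\<lambda>(w, x). ?al w (?W x) (i - 1) m)"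
      unfolding split_beta' by (rule meas) measurable
    have "(\<integral>\<^sup>+w. of_bool (?al w v i (Suc m)) \<partial>?S) =
        (\<integral>\<^sup>+w. \<integral>\<^sup>+x. of_bool (?al (w(i := x)) v i (Suc m)) \<partial>gap_age \<mu> \<partial>?S)"
      by (rule nn_integral_PiM_resample[OF P1]) (measurable, rule meas, measurable)
    also have "\<dots> = (\<integral>\<^sup>+w. \<integral>\<^sup>+x. of_bool (?W x > 0) * of_bool (?al w (?W x) (i - 1) m) \<partial>gap_age \<mu> \<partial>?S)"
      unfolding upd by (intro nn_integral_cong) simp
    also have "\<dots> = (\<integral>\<^sup>+x. \<integral>\<^sup>+w. of_bool (?W x > 0) * of_bool (?al w (?W x) (i - 1) m) \<partial>?S \<partial>gap_age \<mu>)"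
      by (rule P.Fubini'[symmetric]) measurable
    also have "\<dots> \<le> (\<integral>\<^sup>+x. ennreal (r ^ m) * (of_bool (?W x > 0) * ennreal (?V (?W x))) \<partial>gap_age \<mu>)"
    proof (rule nn_integral_mono)
      fix x
      show "(\<integral>\<^sup>+w. of_bool (?W x > 0) * of_bool (?al w (?W x) (i - 1) m) \<partial>?S) \<le>
          ennreal (r ^ m) * (of_bool (?W x > 0) * ennreal (?V (?W x)))"
      proof (cases "?W x > 0")
        case True
        then show ?thesis
          using Suc.IH[of "i - 1" "?W x"] Suc.prems r D by (simp add: ennreal_mult)
      qed simp
    qed
    also have "\<dots> = ennreal (r ^ m) * (\<integral>\<^sup>+x. of_bool (?W x > 0) * ennreal (?V (?W x)) \<partial>gap_age \<mu>)"
      by (rule nn_integral_cmult) measurable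
    also have "\<dots> \<le> ennreal (r ^ m) * ennreal (r * ?V v)"
      by (intro mult_left_mono drift Suc.prems) auto
    also have "\<dots> = ennreal (r ^ Suc m * ?V v)"
      using r D by (simp flip: ennreal_mult add: mult_ac)
    finally show ?case .
  qed
  show ?thesis
    unfolding alive_bound_def
    by (intro exI[of _ "D + 1"] exI[of _ r] conjI r allI impI)
       (use main[of _ _ 0] D in \<open>auto simp: mult.commute\<close>)
qed

section \<open>The state of one edge at successive times\<close>

lemma sum_geometric_le:
  fixes r :: real
  assumes "0 \<le> r" "r < 1"
  shows "(\<Sum>k<n. r ^ k) \<le> 1 / (1 - r)"
  using sum_le_suminf[OF summable_geometric, of r "{..<n}"] assms by (simp add: suminf_geometric)

text \<open>With truncated subtraction the exponent is the distance between \<open>i\<close> and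
  \<open>j\<close>. The two sides of \<open>i\<close> contribute one geometric series each.\<close>

lemma sum_geometric_dist_le:
  fixes r :: real
  assumes r: "0 \<le> r" "r < 1"
  shows "(\<Sum>j<n. r ^ ((i - j) + (j - i))) \<le> 2 / (1 - r)"
proof -
  have "(\<Sum>j<n. r ^ ((i - j) + (j - i))) \<le> (\<Sum>j<n. (if j < Suc i then r ^ (i - j) else 0) + (if i \<le> j then r ^ (j - i) else 0))"
    using r by (intro sum_mono) auto
  also have "\<dots> = (\<Sum>j\<in>{j\<in>{..<n}. j < Suc i}. r ^ (i - j)) + (\<Sum>j\<in>{j\<in>{..<n}. i \<le> j}. r ^ (j - i))"
    by (simp only: sum.distrib sum.inter_filter[OF finite_lessThan])
  also have "(\<Sum>j\<in>{j\<in>{..<n}. j < Suc i}. r ^ (i - j)) \<le> (\<Sum>j<Suc i. r ^ (i - j))"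
    using r by (intro sum_mono2) auto
  also have "(\<Sum>j<Suc i. r ^ (i - j)) = (\<Sum>k<Suc i. r ^ k)"
    using sum.nat_diff_reindex[of "\<lambda>k. r ^ k" "Suc i"] by simp
  also have "{j\<in>{..<n}. i \<le> j} = {i..<n}" by auto
  also have "(\<Sum>j\<in>{i..<n}. r ^ (j - i)) = (\<Sum>k<n - i. r ^ k)"
    by (simp add: sum.atLeastLessThan_shift_0[of _ i n] lessThan_atLeast0)
  finally show ?thesis
    using sum_geometric_le[OF r, of "Suc i"] sum_geometric_le[OF r, of "n - i"] by simp
qed

text \<open>Geometric decay bounds every row sum of the matrix of mixed moments, so the second
  moment of the sum grows linearly in \<open>n\<close>, as \<open>strong_law_mono\<close>
  requires.\<close>

lemma (in prob_space) second_moment_sum_le: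
  fixes D :: "nat \<Rightarrow> 'a \<Rightarrow> real"
  assumes int: "\<And>i j. integrable M (\<lambda>x. D i x * D j x)"
    and r: "0 \<le> r" "r < 1" and c: "c \<ge> 0"
    and cov: "\<And>i j. i \<le> j \<Longrightarrow> \<bar>expectation (\<lambda>x. D i x * D j x)\<bar> \<le> c * r ^ (j - i)"
  shows "(\<integral>\<^sup>+x. ennreal ((\<Sum>i<n. D i x)\<^sup>2) \<partial>M) \<le> ennreal (c * 2 / (1 - r) * real n)"
proof -
  have sq: "(\<Sum>i<n. D i x)\<^sup>2 = (\<Sum>i<n. \<Sum>j<n. D i x * D j x)" for x
    by (simp add: power2_eq_square sum_product)
  have cov': "expectation (\<lambda>x. D i x * D j x) \<le> c * r ^ ((i - j) + (j - i))" for i j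
  proof (cases "i \<le> j")
    case True
    then show ?thesis using cov[of i j] by simp
  next
    case False
    then show ?thesis using cov[of j i] by (simp add: mult.commute)
  qed
  have "(\<integral>\<^sup>+x. ennreal ((\<Sum>i<n. D i x)\<^sup>2) \<partial>M) = ennreal (expectation (\<lambda>x. (\<Sum>i<n. D i x)\<^sup>2))"
    by (rule nn_integral_eq_integral) (simp add: sq int, simp)
  also have "expectation (\<lambda>x. (\<Sum>i<n. D i x)\<^sup>2) = (\<Sum>i<n. \<Sum>j<n. expectation (\<lambda>x. D i x * D j x))"
    by (simp add: sq int)
  also have "\<dots> \<le> (\<Sum>i<n. \<Sum>j<n. c * r ^ ((i - j) + (j - i)))"
    by (intro sum_mono cov')
  also have "\<dots> = (\<Sum>i<n. c * (\<Sum>j<n. r ^ ((i - j) + (j - i))))"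
    by (simp add: sum_distrib_left)
  also have "\<dots> \<le> (\<Sum>i<n. c * (2 / (1 - r)))"
    by (intro sum_mono mult_left_mono sum_geometric_dist_le r c)
  also have "\<dots> = c * 2 / (1 - r) * real n" by simp
  finally show ?thesis by (simp add: ennreal_leI)
qed

section \<open>Exponential gaps and the number of rings\<close>

definition gaps :: "real \<Rightarrow> (nat \<Rightarrow> real) measure" where
  "gaps r = iid (exponential_gap r)"

lemma prob_space_gaps: "r > 0 \<Longrightarrow> prob_space (gaps r)"
  unfolding gaps_def by (intro prob_space_PiM prob_space_exponential_gap)

lemma sets_gaps [measurable_cong]: "sets (gaps r) = sets (iid borel)"
  unfolding gaps_def by (rule sets_PiM_cong) auto

lemma distr_gaps_component: "r > 0 \<Longrightarrow> distr (gaps r) (exponential_gap r) (\<lambda>g. g i) = exponential_gap r"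
  unfolding gaps_def by (rule distr_PiM_component) (auto intro: prob_space_exponential_gap)

lemma AE_gaps_pos: "r > 0 \<Longrightarrow> AE g in gaps r. \<forall>n. g n > 0"
  unfolding AE_all_countable gaps_def
  by (intro allI AE_PiM_component AE_exponential_gap_pos) (auto intro: prob_space_exponential_gap)

text \<open>Independence is decay of correlations with ratio 0, where \<open>0 ^ 0 = 1\<close>
  accounts for the diagonal. The partial sums increase because the gaps are positive.\<close>

lemma gaps_law_of_large_numbers:
  assumes r: "r > 0"
  shows "AE g in gaps r. (\<lambda>n. sum g {..<n} / real n) \<longlonglongrightarrow> 1 / r"
proof -
  interpret E: prob_space "exponential_gap r" by (rule prob_space_exponential_gap) fact
  interpret G: prob_space "gaps r" by (rule prob_space_gaps) fact
  let ?D = "\<lambda>i (g :: nat \<Rightarrow> real). g i - 1 / r"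
  have meas [measurable]: "(\<lambda>g. g i) \<in> borel_measurable (gaps r)" for i by measurable
  have comp: "integrable (gaps r) (\<lambda>g. f (g i)) \<longleftrightarrow> integrable (exponential_gap r) f"
     "G.expectation (\<lambda>g. f (g i)) = E.expectation f" if [measurable]: "f \<in> borel_measurable borel" for f :: "real \<Rightarrow> real" and i
  proof -
    have *: "(\<lambda>g. g i) \<in> gaps r \<rightarrow>\<^sub>M exponential_gap r" by measurable
    have f': "f \<in> borel_measurable (exponential_gap r)" using that by (simp cong: measurable_cong_sets)
    show "integrable (gaps r) (\<lambda>g. f (g i)) \<longleftrightarrow> integrable (exponential_gap r) f"
      using integrable_distr_eq[OF * f'] by (simp add: distr_gaps_component[OF r])
    show "G.expectation (\<lambda>g. f (g i)) = E.expectation f"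
      using integral_distr[OF * f'] by (simp add: distr_gaps_component[OF r])
  qed
  have i1: "integrable (exponential_gap r) (\<lambda>x. x)"
    using E.erlang_ith_moment_integrable[OF r distributed_exponential_gap, of 1] by simp
  have i2: "integrable (exponential_gap r) (\<lambda>x. x\<^sup>2)"
    using E.erlang_ith_moment_integrable[OF r distributed_exponential_gap, of 2] by simp
  have e1: "E.expectation (\<lambda>x. x) = 1 / r"
    by (rule E.exponential_distributed_expectation[OF r distributed_exponential_gap])
  have e2: "E.expectation (\<lambda>x. (x - 1 / r)\<^sup>2) = 1 / r\<^sup>2"
    using E.exponential_distributed_variance[OF r distributed_exponential_gap] by (simp add: e1)
  have i3: "integrable (exponential_gap r) (\<lambda>x. (x - 1 / r)\<^sup>2)"
    unfolding power2_diff using i1 i2 by simp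
  have ind: "G.indep_vars (\<lambda>_. borel) (\<lambda>i g. g i) UNIV"
  proof (subst G.indep_vars_iff_distr_eq_PiM')
    show "distr (gaps r) (iid borel) (\<lambda>x. \<lambda>i\<in>UNIV. x i) = (\<Pi>\<^sub>M i\<in>UNIV. distr (gaps r) borel (\<lambda>g. g i))"
    proof -
      have "distr (gaps r) borel (\<lambda>g. g i) = exponential_gap r" for i
        using distr_gaps_component[OF r, of i] by (simp cong: distr_cong)
      moreover have "distr (gaps r) (iid borel) (\<lambda>x. x) = gaps r"
        by (rule distr_id2) (simp add: sets_gaps)
      ultimately show ?thesis by (simp add: gaps_def restrict_def)
    qed
  qed auto
  have cov: "integrable (gaps r) (\<lambda>g. ?D i g * ?D j g)"
    "\<bar>G.expectation (\<lambda>g. ?D i g * ?D j g)\<bar> \<le> 1 / r\<^sup>2 * 0 ^ (j - i)" if "i \<le> j" for i j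
  proof -
    have "integrable (gaps r) (\<lambda>g. ?D i g * ?D j g) \<and> \<bar>G.expectation (\<lambda>g. ?D i g * ?D j g)\<bar> \<le> 1 / r\<^sup>2 * 0 ^ (j - i)"
    proof (cases "i = j")
      case True
      then show ?thesis using comp[of "\<lambda>x. (x - 1 / r)\<^sup>2" j] e2 i3 by (simp add: power2_eq_square)
    next
      case False
      have ij: "G.indep_vars (\<lambda>_. borel) ?D {i, j}"
        using G.indep_vars_compose2[OF G.indep_vars_subset[OF ind subset_UNIV], of "{i, j}" "\<lambda>_ x. x - 1 / r" "\<lambda>_. borel"]
        by simp
      have int: "integrable (gaps r) (?D i)" for i
      proof (subst comp(1))
        show "integrable (exponential_gap r) (\<lambda>x. x - 1 / r)" using i1 by simp
      qed measurable
      have "G.expectation (?D i) = E.expectation (\<lambda>x. x - 1 / r)"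
        by (rule comp(2)) measurable
      also have "\<dots> = 0" using i1 e1 E.prob_space by simp
      finally have "G.expectation (?D i) = 0" .
      then show ?thesis
        using G.indep_vars_lebesgue_integral[OF _ ij int] G.indep_vars_integrable[OF _ ij int] False by simp
    qed
    then show "integrable (gaps r) (\<lambda>g. ?D i g * ?D j g)"
      "\<bar>G.expectation (\<lambda>g. ?D i g * ?D j g)\<bar> \<le> 1 / r\<^sup>2 * 0 ^ (j - i)" by auto
  qed
  show ?thesis
  proof (rule G.strong_law_mono)
    show "AE g in gaps r. incseq (\<lambda>n. sum g {..<n})"
      using AE_gaps_pos[OF r] by eventually_elim (auto intro!: incseq_SucI less_imp_le)
    fix n
    have "sum g {..<n} - real n * (1 / r) = (\<Sum>i<n. ?D i g)" for g :: "nat \<Rightarrow> real"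
      by (simp add: sum_subtractf)
    then have "(\<integral>\<^sup>+g. ennreal ((sum g {..<n} - real n * (1 / r))\<^sup>2) \<partial>gaps r) = (\<integral>\<^sup>+g. ennreal ((\<Sum>i<n. ?D i g)\<^sup>2) \<partial>gaps r)"
      by simp
    also have "\<dots> \<le> ennreal (1 / r\<^sup>2 * 2 / (1 - 0) * real n)"
    proof (rule G.second_moment_sum_le)
      show "integrable (gaps r) (\<lambda>g. ?D i g * ?D j g)" for i j
        using cov(1)[of i j] cov(1)[of j i] by (cases "i \<le> j") (simp_all add: mult.commute)
    qed (use cov(2) in auto)
    finally show "(\<integral>\<^sup>+g. ennreal ((sum g {..<n} - real n * (1 / r))\<^sup>2) \<partial>gaps r) \<le> ennreal (1 / r\<^sup>2 * 2 / (1 - 0) * real n)" .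
  qed measurable
qed

lemma ring_time_lessThan: "ring_time g n = sum g {..<Suc n}"
  by (simp add: ring_time_def lessThan_Suc_atMost)

text \<open>Guarantees that \<open>rings_until\<close> counts a finite initial segment; for an
  infinite set of rings the cardinality would be 0.\<close>

definition regular_gaps :: "(nat \<Rightarrow> real) \<Rightarrow> bool" where
  "regular_gaps g \<longleftrightarrow> (\<forall>n. g n > 0) \<and> filterlim (ring_time g) at_top at_top"

lemma AE_regular_gaps:
  assumes r: "r > 0"
  shows "AE g in gaps r. regular_gaps g"
  using AE_gaps_pos[OF r] gaps_law_of_large_numbers[OF r]
proof eventually_elim
  case (elim g)
  have "filterlim (\<lambda>n. (sum g {..<n} / real n) * real n) at_top at_top"
    by (rule filterlim_tendsto_pos_mult_at_top[OF elim(2)]) (use r in \<open>auto intro: filterlim_real_sequentially\<close>)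
  then have "filterlim (\<lambda>n. sum g {..<n}) at_top at_top"
    by (rule filterlim_cong[THEN iffD1, rotated -1, OF _ refl refl])
       (use eventually_gt_at_top[of 0] in eventually_elim, simp)
  then have "filterlim (\<lambda>n. sum g {..<Suc n}) at_top at_top"
    by (rule filterlim_compose) (rule filterlim_Suc)
  moreover have "ring_time g = (\<lambda>n. sum g {..<Suc n})" by (rule ext) (rule ring_time_lessThan)
  ultimately show ?case using elim(1) by (simp only: regular_gaps_def simp_thms)
qed

lemma regular_gaps_strict_mono: "regular_gaps g \<Longrightarrow> strict_mono (ring_time g)"
  by (auto simp: regular_gaps_def strict_mono_Suc_iff ring_time_def)

lemma rings_until_set:
  assumes "regular_gaps g"
  shows "{n. ring_time g n \<le> t} = {..<rings_until g t}"
proof -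
  have "\<forall>\<^sub>F n in sequentially. t < ring_time g n"
    using assms by (simp add: regular_gaps_def filterlim_at_top_dense)
  then obtain N where N: "\<And>n. n \<ge> N \<Longrightarrow> t < ring_time g n"
    by (auto simp: eventually_at_top_linorder)
  define K where "K = (LEAST n. t < ring_time g n)"
  have K: "t < ring_time g K" unfolding K_def by (rule LeastI[of _ N]) (use N in auto)
  have "{n. ring_time g n \<le> t} = {..<K}"
  proof (intro equalityI subsetI)
    fix n assume "n \<in> {..<K}"
    then show "n \<in> {n. ring_time g n \<le> t}"
      using not_less_Least[of n "\<lambda>n. t < ring_time g n"] by (auto simp: K_def not_less)
  next
    fix n assume n: "n \<in> {n. ring_time g n \<le> t}"
    have "ring_time g K \<le> ring_time g n" if "K \<le> n"
      using regular_gaps_strict_mono[OF assms] that by (simp add: strict_mono_less_eq)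
    then show "n \<in> {..<K}" using n K by force
  qed
  then show ?thesis by (simp add: rings_until_def)
qed

lemma rings_until_le_iff:
  assumes "regular_gaps g"
  shows "n < rings_until g t \<longleftrightarrow> ring_time g n \<le> t"
  using rings_until_set[OF assms, of t] by blast

text \<open>Separates conditions on the gaps before \<open>k\<close> from one lower bound for gap
  \<open>k\<close>, which can then be integrated out.\<close>

lemma rings_until_eq_iff:
  assumes g: "regular_gaps g" and s: "s \<ge> 0"
  shows "rings_until g s = k \<longleftrightarrow> (\<forall>i<k. ring_time g i \<le> s) \<and> s < sum g {..<k} + g k"
proof -
  have "rings_until g s = k \<longleftrightarrow> (\<forall>i<k. i < rings_until g s) \<and> \<not> k < rings_until g s"
    by (metis less_irrefl linorder_neqE_nat)
  then show ?thesis by (simp add: rings_until_le_iff[OF g] ring_time_lessThan not_le)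
qed

lemma rings_until_mono: "regular_gaps g \<Longrightarrow> s \<le> t \<Longrightarrow> rings_until g s \<le> rings_until g t"
  by (metis rings_until_le_iff order_trans not_less order_refl)

lemma measurable_rings_until [measurable]: 
  assumes [measurable]: "\<And>i. (\<lambda>x. g x i) \<in> borel_measurable M" "t \<in> borel_measurable M"
  shows "(\<lambda>x. rings_until (g x) (t x)) \<in> M \<rightarrow>\<^sub>M count_space UNIV"
  unfolding rings_until_def ring_time_def by measurable

section \<open>Marks and the Markov property of one edge\<close>

abbreviation marks :: "real \<Rightarrow> (nat \<Rightarrow> bool) measure" where
  "marks p \<equiv> iid (measure_pmf (bernoulli_pmf p))"

lemma prob_space_marks: "prob_space (marks p)"
  by (intro prob_space_PiM measure_pmf.prob_space_axioms)

text \<open>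
  The state of an edge at time \<open>t\<close> is the mark with index \<open>rings_until g t\<close>, where mark \<open>0\<close> is the
  initial state and mark \<open>n + 1\<close> is the state drawn at ring \<open>n\<close>.
\<close>

definition marks_agree :: "real \<Rightarrow> nat set \<Rightarrow> (nat \<Rightarrow> bool) \<Rightarrow> (nat \<Rightarrow> nat) \<Rightarrow> ennreal" where
  "marks_agree p J c N = (\<integral>\<^sup>+m. of_bool (\<forall>j\<in>J. m (N j) = c j) \<partial>marks p)"

lemma marks_agree_le_1: "marks_agree p J c N \<le> 1"
proof -
  interpret prob_space "marks p" by (rule prob_space_marks)
  have "marks_agree p J c N \<le> (\<integral>\<^sup>+m. 1 \<partial>marks p)"
    unfolding marks_agree_def by (intro nn_integral_mono) auto
  then show ?thesis by (simp add: emeasure_space_1)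
qed

lemma measurable_mark:
  fixes m :: "'a \<Rightarrow> nat \<Rightarrow> bool"
  assumes m: "m \<in> M \<rightarrow>\<^sub>M marks p" and N: "N \<in> M \<rightarrow>\<^sub>M count_space UNIV"
  shows "Measurable.pred M (\<lambda>x. m x (N x))"
proof (rule measurable_compose_countable[OF _ N])
  fix i
  have "(\<lambda>x. m x i) \<in> M \<rightarrow>\<^sub>M measure_pmf (bernoulli_pmf p)"
    by (rule measurable_compose[OF m measurable_component_singleton]) simp
  then show "Measurable.pred M (\<lambda>x. m x i)" by simp
qed

lemma measurable_marks_agree [measurable (raw)]:
  assumes [measurable]: "\<And>j. j \<in> J \<Longrightarrow> N j \<in> M \<rightarrow>\<^sub>M count_space UNIV" and [simp]: "finite J"
  shows "(\<lambda>x. marks_agree p J c (\<lambda>j. N j x)) \<in> borel_measurable M"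
proof -
  interpret prob_space "marks p" by (rule prob_space_marks)
  note measurable_mark [measurable (raw)]
  show ?thesis unfolding marks_agree_def by measurable
qed

lemma emeasure_bernoulli_single: "emeasure (measure_pmf (bernoulli_pmf p)) {b} = ennreal (pmf (bernoulli_pmf p) b)"
  by (rule emeasure_pmf_single)

text \<open>No other condition reads the mark \<open>N n\<close>, so it can be resampled without
  disturbing them.\<close>

lemma marks_agree_insert:
  assumes J: "finite J" "n \<notin> J" and N: "\<And>j. j \<in> J \<Longrightarrow> N j \<noteq> N n"
  shows "marks_agree p (insert n J) c N = ennreal (pmf (bernoulli_pmf p) (c n)) * marks_agree p J c N"
proof -
  note measurable_mark [measurable (raw)]
  have "marks_agree p (insert n J) c N =
      (\<integral>\<^sup>+m. \<integral>\<^sup>+x. of_bool (\<forall>j\<in>insert n J. (m(N n := x)) (N j) = c j) \<partial>bernoulli_pmf p \<partial>marks p)"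
    unfolding marks_agree_def
    by (rule nn_integral_PiM_resample[OF measure_pmf.prob_space_axioms]) (use J in measurable)
  also have "\<dots> = (\<integral>\<^sup>+m. \<integral>\<^sup>+x. indicator {c n} x * of_bool (\<forall>j\<in>J. m (N j) = c j) \<partial>bernoulli_pmf p \<partial>marks p)"
    using N by (intro nn_integral_cong) (auto simp: indicator_def)
  also have "\<dots> = (\<integral>\<^sup>+m. ennreal (pmf (bernoulli_pmf p) (c n)) * of_bool (\<forall>j\<in>J. m (N j) = c j) \<partial>marks p)"
    by (simp add: nn_integral_multc emeasure_bernoulli_single)
  also have "\<dots> = ennreal (pmf (bernoulli_pmf p) (c n)) * marks_agree p J c N"
    unfolding marks_agree_def by (rule nn_integral_cmult) (use J in measurable)
  finally show ?thesis .
qed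

lemma marks_agree_same:
  assumes "j \<in> J" "N n = N j"
  shows "marks_agree p (insert n J) c N = of_bool (c n = c j) * marks_agree p J c N"
proof (cases "c n = c j")
  case True
  then have "(\<forall>i\<in>insert n J. m (N i) = c i) \<longleftrightarrow> (\<forall>i\<in>J. m (N i) = c i)" for m :: "nat \<Rightarrow> bool"
    using assms by auto
  then show ?thesis using True by (simp add: marks_agree_def)
next
  case False
  then have *: "(\<forall>i\<in>insert n J. m (N i) = c i) \<longleftrightarrow> False" for m :: "nat \<Rightarrow> bool"
    using assms by auto
  show ?thesis using False unfolding marks_agree_def * by simp
qed


text \<open>Split by the number \<open>k\<close> of rings up to time \<open>s\<close>. What is
  observed up to \<open>s\<close> depends on the gaps before \<open>k\<close>, and no ring between
  \<open>s\<close> and \<open>u\<close> means that gap \<open>k\<close> exceeds \<open>u\<close>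
  minus their sum. Integrating out gap \<open>k\<close> gives an exponential from which
  \<open>exp (- r * (u - s))\<close> splits off.\<close>

lemma gaps_memoryless:
  assumes r: "r > 0" and J: "finite J" "\<And>j. j \<in> J \<Longrightarrow> 0 \<le> t j \<and> t j \<le> s" and s: "0 \<le> s" "s \<le> u"
  shows "(\<integral>\<^sup>+g. marks_agree p J c (\<lambda>j. rings_until g (t j)) * of_bool (rings_until g u = rings_until g s) \<partial>gaps r) =
    ennreal (exp (- r * (u - s))) * (\<integral>\<^sup>+g. marks_agree p J c (\<lambda>j. rings_until g (t j)) \<partial>gaps r)"
proof -
  interpret E: prob_space "exponential_gap r" by (rule prob_space_exponential_gap) fact
  interpret G: prob_space "gaps r" by (rule prob_space_gaps) fact
  let ?h = "\<lambda>g. marks_agree p J c (\<lambda>j. rings_until g (t j))"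
  \<comment> \<open>Here rings are counted among the first \<open>k\<close> only. This agrees with
    \<open>rings_until\<close> when \<open>k\<close> rings occur up to \<open>s\<close>, and it does
    not read gap \<open>k\<close>.\<close>
  let ?hk = "\<lambda>k g. marks_agree p J c (\<lambda>j. card {i. i < k \<and> ring_time g i \<le> t j}) * of_bool (\<forall>i<k. ring_time g i \<le> s)"
  have [measurable]: "(\<lambda>g. g i) \<in> borel_measurable (gaps r)" for i by measurable
  have meas_h [measurable]: "?h \<in> borel_measurable (gaps r)" using J(1) by measurable
  have meas_hk [measurable]: "?hk k \<in> borel_measurable (gaps r)" for k
    unfolding ring_time_def using J(1) by measurable
  have on_k: "AE g in gaps r. ?h g * of_bool (rings_until g s = k \<and> rings_until g v = k) = ?hk k g * of_bool (v < sum g {..<k} + g k)"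
    if v: "s \<le> v" for v k
    using AE_regular_gaps[OF r]
  proof eventually_elim
    case (elim g)
    have iff: "rings_until g s = k \<and> rings_until g v = k \<longleftrightarrow> (\<forall>i<k. ring_time g i \<le> s) \<and> v < sum g {..<k} + g k"
      using v s by (auto simp: rings_until_eq_iff[OF elim])
    show ?case
    proof (cases "rings_until g s = k \<and> rings_until g v = k")
      case True
      have "rings_until g (t j) = card {i. i < k \<and> ring_time g i \<le> t j}" if "j \<in> J" for j
      proof -
        have "rings_until g (t j) \<le> k" using rings_until_mono[OF elim, of "t j" s] J that True by auto
        then have "{i. i < k \<and> ring_time g i \<le> t j} = {..<rings_until g (t j)}"
          by (auto simp: rings_until_le_iff[OF elim, symmetric])
        then show ?thesis by simp
      qed
      then have "?h g = marks_agree p J c (\<lambda>j. card {i. i < k \<and> ring_time g i \<le> t j})"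
        unfolding marks_agree_def by simp
      then show ?thesis using True iff by auto
    next
      case False
      then show ?thesis using iff by auto
    qed
  qed
  have int_k: "(\<integral>\<^sup>+g. ?hk k g * of_bool (v < sum g {..<k} + g k) \<partial>gaps r) =
      (\<integral>\<^sup>+g. ?hk k g * ennreal (exp (- r * (v - sum g {..<k}))) \<partial>gaps r)" if v: "s \<le> v" for k v
  proof -
    have "(\<integral>\<^sup>+g. ?hk k g * of_bool (v < sum g {..<k} + g k) \<partial>gaps r) =
        (\<integral>\<^sup>+g. \<integral>\<^sup>+x. ?hk k (g(k := x)) * of_bool (v < sum (g(k := x)) {..<k} + (g(k := x)) k) \<partial>exponential_gap r \<partial>gaps r)"
    proof (rule nn_integral_PiM_resample[OF E.prob_space_axioms, folded gaps_def])
      show "(\<lambda>g. ?hk k g * of_bool (v < sum g {..<k} + g k)) \<in> borel_measurable (gaps r)"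
        by (rule borel_measurable_times_ennreal[OF meas_hk]) measurable
    qed
    also have "\<dots> = (\<integral>\<^sup>+g. \<integral>\<^sup>+x. ?hk k g * indicator {v - sum g {..<k}<..} x \<partial>exponential_gap r \<partial>gaps r)"
    proof (intro nn_integral_cong)
      fix g :: "nat \<Rightarrow> real" and x
      have 1: "ring_time (g(k := x)) i = ring_time g i" if "i < k" for i
        unfolding ring_time_def using that by (intro sum.cong) auto
      have 2: "sum (g(k := x)) {..<k} = sum g {..<k}" by (intro sum.cong) auto
      have "{i. i < k \<and> ring_time (g(k := x)) i \<le> a} = {i. i < k \<and> ring_time g i \<le> a}" for a using 1 by auto
      moreover have "(\<forall>i<k. ring_time (g(k := x)) i \<le> s) \<longleftrightarrow> (\<forall>i<k. ring_time g i \<le> s)" using 1 by auto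
      moreover have "of_bool (v < sum (g(k := x)) {..<k} + (g(k := x)) k) = (indicator {v - sum g {..<k}<..} x :: ennreal)"
        unfolding 2 by (auto simp: indicator_def)
      ultimately show "?hk k (g(k := x)) * of_bool (v < sum (g(k := x)) {..<k} + (g(k := x)) k) =
          ?hk k g * indicator {v - sum g {..<k}<..} x" by (simp only:)
    qed
    also have "\<dots> = (\<integral>\<^sup>+g. ?hk k g * ennreal (exp (- r * (v - sum g {..<k}))) \<partial>gaps r)"
    proof (rule nn_integral_cong)
      fix g :: "nat \<Rightarrow> real"
      have "sum g {..<k} \<le> v" if "\<forall>i<k. ring_time g i \<le> s"
        using that v s by (cases k) (auto simp: ring_time_lessThan less_Suc_eq)
      then have "?hk k g * emeasure (exponential_gap r) {v - sum g {..<k}<..} = ?hk k g * ennreal (exp (- r * (v - sum g {..<k})))"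
        by (cases "\<forall>i<k. ring_time g i \<le> s") (auto simp: emeasure_exponential_gap_greaterThan r)
      then show "(\<integral>\<^sup>+x. ?hk k g * indicator {v - sum g {..<k}<..} x \<partial>exponential_gap r) = ?hk k g * ennreal (exp (- r * (v - sum g {..<k})))"
        by (subst nn_integral_cmult_indicator) auto
    qed
    finally show ?thesis .
  qed
  \<comment> \<open>Used twice: at \<open>v = u\<close> for the left-hand side, and at
    \<open>v = s\<close>, where the indicator is trivial, for the integral on the right.\<close>
  have split_k: "(\<integral>\<^sup>+g. ?h g * of_bool (rings_until g v = rings_until g s) \<partial>gaps r) =
      (\<Sum>k. \<integral>\<^sup>+g. ?hk k g * ennreal (exp (- r * (v - sum g {..<k}))) \<partial>gaps r)" if v: "s \<le> v" for v
  proof -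
    have "?h g * of_bool (rings_until g v = rings_until g s) =
        (\<Sum>k. ?h g * of_bool (rings_until g s = k \<and> rings_until g v = k))" for g
    proof -
      have "(\<Sum>k. ?h g * of_bool (rings_until g s = k \<and> rings_until g v = k)) =
          (\<Sum>k\<in>{rings_until g s}. ?h g * of_bool (rings_until g s = k \<and> rings_until g v = k))"
        by (rule suminf_finite) auto
      then show ?thesis by auto
    qed
    then have "(\<integral>\<^sup>+g. ?h g * of_bool (rings_until g v = rings_until g s) \<partial>gaps r) =
        (\<integral>\<^sup>+g. (\<Sum>k. ?h g * of_bool (rings_until g s = k \<and> rings_until g v = k)) \<partial>gaps r)" by simp
    also have "\<dots> = (\<Sum>k. \<integral>\<^sup>+g. ?h g * of_bool (rings_until g s = k \<and> rings_until g v = k) \<partial>gaps r)"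
      by (rule nn_integral_suminf) measurable
    also have "\<dots> = (\<Sum>k. \<integral>\<^sup>+g. ?hk k g * of_bool (v < sum g {..<k} + g k) \<partial>gaps r)"
      by (intro suminf_cong nn_integral_cong_AE on_k v)
    also have "\<dots> = (\<Sum>k. \<integral>\<^sup>+g. ?hk k g * ennreal (exp (- r * (v - sum g {..<k}))) \<partial>gaps r)"
      by (intro suminf_cong int_k v)
    finally show ?thesis .
  qed
  have "(\<integral>\<^sup>+g. ?h g * of_bool (rings_until g u = rings_until g s) \<partial>gaps r) =
      (\<Sum>k. \<integral>\<^sup>+g. ennreal (exp (- r * (u - s))) * (?hk k g * ennreal (exp (- r * (s - sum g {..<k})))) \<partial>gaps r)"
    unfolding split_k[OF s(2)]
  proof (intro suminf_cong nn_integral_cong)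
    fix k and g :: "nat \<Rightarrow> real"
    have "exp (- r * (u - sum g {..<k})) = exp (- r * (u - s)) * exp (- r * (s - sum g {..<k}))"
      by (simp add: algebra_simps flip: exp_add)
    then show "?hk k g * ennreal (exp (- r * (u - sum g {..<k}))) =
        ennreal (exp (- r * (u - s))) * (?hk k g * ennreal (exp (- r * (s - sum g {..<k}))))"
      by (simp add: ennreal_mult mult_ac)
  qed
  also have "\<dots> = (\<Sum>k. ennreal (exp (- r * (u - s))) * (\<integral>\<^sup>+g. ?hk k g * ennreal (exp (- r * (s - sum g {..<k}))) \<partial>gaps r))"
    by (rule suminf_cong, rule nn_integral_cmult, rule borel_measurable_times_ennreal[OF meas_hk]) measurable
  also have "\<dots> = ennreal (exp (- r * (u - s))) * (\<Sum>k. \<integral>\<^sup>+g. ?hk k g * ennreal (exp (- r * (s - sum g {..<k}))) \<partial>gaps r)"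
    by (rule ennreal_suminf_cmult)
  also have "(\<Sum>k. \<integral>\<^sup>+g. ?hk k g * ennreal (exp (- r * (s - sum g {..<k}))) \<partial>gaps r) = (\<integral>\<^sup>+g. ?h g \<partial>gaps r)"
    using split_k[OF order_refl] by simp
  finally show ?thesis .
qed

text \<open>The finite-dimensional distributions of one edge, as \<open>emeasure_edge_space\<close>
  confirms.\<close>

definition states_agree :: "real \<Rightarrow> real \<Rightarrow> (nat \<Rightarrow> real) \<Rightarrow> (nat \<Rightarrow> bool) \<Rightarrow> nat set \<Rightarrow> ennreal" where
  "states_agree \<mu> p t c J = (\<integral>\<^sup>+g. marks_agree p J c (\<lambda>j. rings_until g (t j)) \<partial>gaps \<mu>)"

text \<open>The transition kernel of one edge over a time \<open>s\<close>, from state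
  \<open>b\<close> to state \<open>b'\<close>.\<close>

definition refresh_prob :: "real \<Rightarrow> real \<Rightarrow> real \<Rightarrow> bool \<Rightarrow> bool \<Rightarrow> real" where
  "refresh_prob \<mu> p s b b' =
     exp (- \<mu> * s) * of_bool (b' = b) + (1 - exp (- \<mu> * s)) * pmf (bernoulli_pmf p) b'"

lemma states_agree_empty: "\<mu> > 0 \<Longrightarrow> states_agree \<mu> p t c {} = 1"
  using prob_space.emeasure_space_1[OF prob_space_gaps, of \<mu>] prob_space.emeasure_space_1[OF prob_space_marks, of p]
  by (simp add: states_agree_def marks_agree_def)

lemma states_agree_single:
  assumes "\<mu> > 0"
  shows "states_agree \<mu> p t c {n} = ennreal (pmf (bernoulli_pmf p) (c n))"
proof -
  have "marks_agree p {n} c N = ennreal (pmf (bernoulli_pmf p) (c n))" for N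
    using marks_agree_insert[of "{}" n N p c] prob_space.emeasure_space_1[OF prob_space_marks, of p]
    by (simp add: marks_agree_def[of p "{}"])
  then show ?thesis
    using prob_space.emeasure_space_1[OF prob_space_gaps[OF assms]] by (simp add: states_agree_def)
qed

text \<open>The Markov property of one edge: \<open>t j0\<close> is the latest of the earlier times.
  Without a ring since then the same mark is read again; otherwise the ring count exceeds all
  earlier ones and the mark is fresh.\<close>

lemma states_agree_insert:
  assumes \<mu>: "\<mu> > 0" and J: "finite J" "j0 \<in> J" "n \<notin> J" "\<And>j. j \<in> J \<Longrightarrow> 0 \<le> t j \<and> t j \<le> t j0" and t: "t j0 \<le> t n"
  shows "states_agree \<mu> p t c (insert n J) =
    ennreal (refresh_prob \<mu> p (t n - t j0) (c j0) (c n)) * states_agree \<mu> p t c J"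
proof -
  interpret G: prob_space "gaps \<mu>" by (rule prob_space_gaps) fact
  let ?h = "\<lambda>J g. marks_agree p J c (\<lambda>j. rings_until g (t j))"
  let ?same = "\<lambda>g. of_bool (rings_until g (t n) = rings_until g (t j0)) :: ennreal"
  let ?diff = "\<lambda>g. of_bool (rings_until g (t n) \<noteq> rings_until g (t j0)) :: ennreal"
  let ?e = "exp (- \<mu> * (t n - t j0))" and ?q = "pmf (bernoulli_pmf p) (c n)"
  let ?S = "states_agree \<mu> p t c J"
  have [measurable]: "(\<lambda>g. g i) \<in> borel_measurable (gaps \<mu>)" for i by measurable
  have [measurable]: "?h J \<in> borel_measurable (gaps \<mu>)" using J(1) by measurable
  have [measurable]: "Measurable.pred (gaps \<mu>) (\<lambda>g. rings_until g (t n) = rings_until g (t j0))"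
    by (rule measurable_count_space2[where h="(=)"]) measurable
  have same: "(\<integral>\<^sup>+g. ?h J g * ?same g \<partial>gaps \<mu>) = ennreal ?e * ?S"
    unfolding states_agree_def by (rule gaps_memoryless) (use assms in auto)
  have "?S = (\<integral>\<^sup>+g. ?h J g * ?same g + ?h J g * ?diff g \<partial>gaps \<mu>)"
    unfolding states_agree_def by (intro nn_integral_cong) auto
  also have "\<dots> = ennreal ?e * ?S + (\<integral>\<^sup>+g. ?h J g * ?diff g \<partial>gaps \<mu>)"
    by (subst nn_integral_add, measurable) (simp add: same)
  finally have sum: "?S = ennreal ?e * ?S + (\<integral>\<^sup>+g. ?h J g * ?diff g \<partial>gaps \<mu>)" .
  have e1: "?e \<le> 1" using \<mu> t by simp
  have "?S \<le> (\<integral>\<^sup>+g. 1 \<partial>gaps \<mu>)"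
    unfolding states_agree_def by (intro nn_integral_mono marks_agree_le_1)
  then have "?S \<le> 1" by (simp add: G.emeasure_space_1)
  \<comment> \<open>Only the event without a ring is computed directly. The integral over its
    complement is found by subtraction, which is carried out in the reals after finiteness has been
    secured.\<close>
  then obtain S where S: "?S = ennreal S" "S \<ge> 0" by (cases ?S) (auto simp: top_unique)
  have "(\<integral>\<^sup>+g. ?h J g * ?diff g \<partial>gaps \<mu>) \<le> ?S"
    unfolding states_agree_def by (intro nn_integral_mono) auto
  then obtain y where y: "(\<integral>\<^sup>+g. ?h J g * ?diff g \<partial>gaps \<mu>) = ennreal y" "y \<ge> 0"
    using S by (cases "\<integral>\<^sup>+g. ?h J g * ?diff g \<partial>gaps \<mu>") (auto simp: top_unique)
  have "ennreal S = ennreal (?e * S + y)"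
    using sum S y by (simp add: ennreal_mult)
  then have yS: "y = (1 - ?e) * S"
    using S y by (subst (asm) ennreal_inj) (auto simp: algebra_simps)
  have ins: "AE g in gaps \<mu>. ?h (insert n J) g = ennreal (of_bool (c n = c j0)) * (?h J g * ?same g) + ennreal ?q * (?h J g * ?diff g)"
    using AE_regular_gaps[OF \<mu>]
  proof eventually_elim
    case (elim g)
    show ?case
    proof (cases "rings_until g (t n) = rings_until g (t j0)")
      case True
      then show ?thesis using marks_agree_same[OF J(2), of "\<lambda>j. rings_until g (t j)" n p c] by simp
    next
      case False
      then have "rings_until g (t j0) < rings_until g (t n)"
        using rings_until_mono[OF elim t] by simp
      then have "rings_until g (t j) \<noteq> rings_until g (t n)" if "j \<in> J" for j
        using rings_until_mono[OF elim, of "t j" "t j0"] J(4) that by fastforce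
      then show ?thesis
        using marks_agree_insert[OF J(1,3), of "\<lambda>j. rings_until g (t j)" p c] False by simp
    qed
  qed
  have "states_agree \<mu> p t c (insert n J) =
      (\<integral>\<^sup>+g. ennreal (of_bool (c n = c j0)) * (?h J g * ?same g) + ennreal ?q * (?h J g * ?diff g) \<partial>gaps \<mu>)"
    unfolding states_agree_def by (rule nn_integral_cong_AE[OF ins])
  also have "\<dots> = ennreal (of_bool (c n = c j0)) * (ennreal ?e * ennreal S) + ennreal ?q * ennreal y"
    by (subst nn_integral_add) (simp_all add: nn_integral_cmult same y S)
  also have "\<dots> = ennreal (of_bool (c n = c j0) * (?e * S) + ?q * y)"
    using S(2) y(2) by (cases "c n = c j0") (simp_all add: ennreal_mult)
  also have "of_bool (c n = c j0) * (?e * S) + ?q * y = refresh_prob \<mu> p (t n - t j0) (c j0) (c n) * S"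
    by (simp add: refresh_prob_def yS algebra_simps)
  also have "ennreal \<dots> = ennreal (refresh_prob \<mu> p (t n - t j0) (c j0) (c n)) * ennreal S"
    using e1 by (intro ennreal_mult S) (auto simp: refresh_prob_def)
  finally show ?thesis by (simp only: S)
qed

lemma measurable_edge_open:
  assumes a: "a \<in> M \<rightarrow>\<^sub>M edge_space \<mu> p" and t [measurable]: "t \<in> borel_measurable M"
  shows "Measurable.pred M (\<lambda>x. edge_open (a x) (t x))"
proof -
  let ?N = "\<lambda>x. rings_until (\<lambda>n. fst (snd (a x) n)) (t x)"
  have "(\<lambda>a. fst (snd a i)) \<in> borel_measurable (edge_space \<mu> p)" for i
    unfolding edge_space_def by measurable
  from measurable_compose[OF a this] have N [measurable]: "?N \<in> M \<rightarrow>\<^sub>M count_space UNIV"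
    by (intro measurable_rings_until) auto
  have "Measurable.pred (edge_space \<mu> p) (\<lambda>a. snd (snd a i))" for i
    unfolding edge_space_def by measurable
  from measurable_compose[OF a this] have mark: "Measurable.pred M (\<lambda>x. snd (snd (a x) i))" for i .
  have [measurable]: "Measurable.pred M (\<lambda>x. snd (snd (a x) (?N x - 1)))"
    by (rule measurable_compose_countable[of "\<lambda>i x. snd (snd (a x) i)"], rule mark) measurable
  have "Measurable.pred (edge_space \<mu> p) (\<lambda>a. fst a)"
    unfolding edge_space_def by measurable
  from measurable_compose[OF a this] have [measurable]: "Measurable.pred M (\<lambda>x. fst (a x))" .
  have "edge_open (a x) (t x) = (if ?N x = 0 then fst (a x) else snd (snd (a x) (?N x - 1)))" for x
    by (simp add: edge_open_def split: nat.split)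
  then show ?thesis by simp
qed

text \<open>The initial state has the law of a drawn state, so putting it in front of the marks
  gives again an independent sequence with the same law. After this shift the index of the mark is
  just the number of rings.\<close>

lemma emeasure_edge_space:
  assumes \<mu>: "\<mu> > 0" and J: "finite J"
  shows "emeasure (edge_space \<mu> p) {a \<in> space (edge_space \<mu> p). \<forall>j\<in>J. edge_open a (t j) = c j} = states_agree \<mu> p t c J"
    and "{a \<in> space (edge_space \<mu> p). \<forall>j\<in>J. edge_open a (t j) = c j} \<in> sets (edge_space \<mu> p)"
proof -
  let ?B = "measure_pmf (bernoulli_pmf p)"
  let ?T = "\<Pi>\<^sub>M n\<in>(UNIV::nat set). exponential_gap \<mu> \<Otimes>\<^sub>M ?B"
  interpret E: prob_space "exponential_gap \<mu>" by (rule prob_space_exponential_gap) fact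
  interpret G: prob_space "gaps \<mu>" by (rule prob_space_gaps) fact
  interpret M: sequence_space ?B by (rule sequence_spaceI) (rule measure_pmf.prob_space_axioms)
  interpret T: prob_space ?T by (intro prob_space_PiM prob_space_pair E.prob_space_axioms measure_pmf.prob_space_axioms)
  interpret BG: pair_sigma_finite ?B "gaps \<mu>" ..
  have meas [measurable]: "Measurable.pred (?B \<Otimes>\<^sub>M ?T) (\<lambda>a. edge_open a u)" for u
    using measurable_edge_open[of "\<lambda>a. a" "edge_space \<mu> p" \<mu> p "\<lambda>_. u"] by (simp add: edge_space_def)
  show sets: "{a \<in> space (edge_space \<mu> p). \<forall>j\<in>J. edge_open a (t j) = c j} \<in> sets (edge_space \<mu> p)"
    unfolding edge_space_def using J by measurable
  note measurable_mark [measurable (raw)]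
  let ?f = "\<lambda>a. of_bool (\<forall>j\<in>J. edge_open a (t j) = c j) :: ennreal"
  let ?F = "\<lambda>g m. of_bool (\<forall>j\<in>J. m (rings_until g (t j)) = c j) :: ennreal"
  have [measurable]: "?f \<in> borel_measurable (?B \<Otimes>\<^sub>M ?T)" using J by measurable
  have open_zip: "edge_open (b, \<lambda>n. (g n, m n)) u = case_nat b m (rings_until g u)" for b g m u
    by (cases "rings_until g u") (simp_all add: edge_open_def)
  have case_meas: "case_nat b m \<in> space (marks p)" for b m by (simp add: space_PiM)
  have [measurable]: "(\<lambda>g. g i) \<in> borel_measurable (gaps \<mu>)" for i by measurable
  have "emeasure (edge_space \<mu> p) {a \<in> space (edge_space \<mu> p). \<forall>j\<in>J. edge_open a (t j) = c j} = (\<integral>\<^sup>+a. ?f a \<partial>edge_space \<mu> p)"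
    by (subst nn_integral_indicator[OF sets, symmetric], rule nn_integral_cong) (simp add: indicator_def)
  also have "\<dots> = (\<integral>\<^sup>+b. \<integral>\<^sup>+w. ?f (b, w) \<partial>?T \<partial>?B)"
    unfolding edge_space_def by (subst T.nn_integral_fst[symmetric]) auto
  also have "\<dots> = (\<integral>\<^sup>+b. \<integral>\<^sup>+g. \<integral>\<^sup>+m. ?F g (case_nat b m) \<partial>marks p \<partial>gaps \<mu> \<partial>?B)"
    by (intro nn_integral_cong, subst nn_integral_PiM_zip[OF E.prob_space_axioms measure_pmf.prob_space_axioms])
       (auto simp: open_zip gaps_def)
  also have "\<dots> = (\<integral>\<^sup>+g. \<integral>\<^sup>+b. \<integral>\<^sup>+m. ?F g (case_nat b m) \<partial>marks p \<partial>?B \<partial>gaps \<mu>)"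
    by (rule BG.Fubini'[symmetric]) (use J in measurable)
  also have "\<dots> = (\<integral>\<^sup>+g. \<integral>\<^sup>+m. ?F g m \<partial>marks p \<partial>gaps \<mu>)"
  proof (rule nn_integral_cong)
    fix g
    have *: "(\<lambda>(s, w). case_nat s w) \<in> ?B \<Otimes>\<^sub>M marks p \<rightarrow>\<^sub>M marks p" by measurable
    have "(\<integral>\<^sup>+m. ?F g m \<partial>marks p) = (\<integral>\<^sup>+x. ?F g (case_nat (fst x) (snd x)) \<partial>(?B \<Otimes>\<^sub>M marks p))"
      by (subst M.PiM_iter[symmetric], subst nn_integral_distr[OF *]) (use J in \<open>auto simp: split_beta'\<close>)
    also have "\<dots> = (\<integral>\<^sup>+b. \<integral>\<^sup>+m. ?F g (case_nat b m) \<partial>marks p \<partial>?B)"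
      using J by (subst M.P.nn_integral_fst[symmetric]) (measurable, simp only: fst_conv snd_conv)
    finally show "(\<integral>\<^sup>+b. \<integral>\<^sup>+m. ?F g (case_nat b m) \<partial>marks p \<partial>?B) = (\<integral>\<^sup>+m. ?F g m \<partial>marks p)" by simp
  qed
  finally show "emeasure (edge_space \<mu> p) {a \<in> space (edge_space \<mu> p). \<forall>j\<in>J. edge_open a (t j) = c j} = states_agree \<mu> p t c J"
    by (simp add: states_agree_def marks_agree_def)
qed

section \<open>Law of the skeleton\<close>

text \<open>The conditional probability of outcome \<open>c n\<close> given the outcomes before
  \<open>n\<close>, found by the same backward scan as in \<open>look\<close>. Edge clocks and ages
  are compared through this quantity.\<close>

primrec open_prob :: "real \<Rightarrow> real \<Rightarrow> (nat \<Rightarrow> int ^ 'd::finite) \<Rightarrow> (nat \<Rightarrow> real) \<Rightarrow> (nat \<Rightarrow> bool) \<Rightarrow>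
    nat \<Rightarrow> nat \<Rightarrow> real" where
  "open_prob \<mu> p z g c n 0 = pmf (bernoulli_pmf p) (c n)"
| "open_prob \<mu> p z g c n (Suc j) =
     (if edge z c j = edge z c n then refresh_prob \<mu> p (sum g {j<..n}) (c j) (c n)
      else open_prob \<mu> p z g c n j)"

lemma ring_time_diff: "j \<le> n \<Longrightarrow> ring_time g n - ring_time g j = sum g {j<..n}"
proof -
  assume "j \<le> n"
  then have "{..n} = {..j} \<union> {j<..n}" by auto
  moreover have "sum g ({..j} \<union> {j<..n}) = sum g {..j} + sum g {j<..n}"
    by (rule sum.union_disjoint) auto
  ultimately show ?thesis unfolding ring_time_def by simp
qed

lemma ring_time_mono:
  assumes "\<And>i. g i \<ge> 0" "j \<le> n"
  shows "0 \<le> ring_time g j" "ring_time g j \<le> ring_time g n"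
  using assms unfolding ring_time_def by (auto intro!: sum_nonneg sum_mono2)

text \<open>Induction along the scan: while no attempt on the edge of \<open>n\<close> has been met,
  the conditions on that edge do not change, and the first one met is the latest, so the Markov
  property applies to it.\<close>

lemma states_agree_look:
  assumes \<mu>: "\<mu> > 0" and g: "\<And>i. g i \<ge> 0" and "j \<le> n"
  shows "states_agree \<mu> p (ring_time g) c (insert n {i. i < j \<and> edge z c i = edge z c n}) =
    ennreal (open_prob \<mu> p z g c n j) * states_agree \<mu> p (ring_time g) c {i. i < j \<and> edge z c i = edge z c n}"
  using assms(3)
proof (induction j)
  case 0
  show ?case using \<mu> by (simp add: states_agree_single states_agree_empty)
next
  case (Suc j)
  let ?I = "\<lambda>j. {i. i < j \<and> edge z c i = edge z c n}"
  show ?case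
  proof (cases "edge z c j = edge z c n")
    case True
    have "states_agree \<mu> p (ring_time g) c (insert n (?I (Suc j))) =
        ennreal (refresh_prob \<mu> p (ring_time g n - ring_time g j) (c j) (c n)) * states_agree \<mu> p (ring_time g) c (?I (Suc j))"
      by (rule states_agree_insert[OF \<mu>]) (use True Suc.prems g in \<open>auto intro: ring_time_mono\<close>)
    then show ?thesis using True Suc.prems by (simp add: ring_time_diff)
  next
    case False
    then have "?I (Suc j) = ?I j" by (auto simp: less_Suc_eq)
    then show ?thesis using Suc False by simp
  qed
qed

lemma lattice_edgesI: "{x, x + axis i 1} \<in> lattice_edges"
  unfolding lattice_edges_def by (rule CollectI, rule exI[of _ x], rule exI[of _ i]) simp

text \<open>For a prescribed pattern \<open>c\<close> the attempted edges are deterministic, so the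
  event is a cylinder over independent edges. Its probability is a product over edges, which is then
  rearranged into a product over rings.\<close>

lemma prob_states:
  assumes \<mu>: "\<mu> > 0" and g: "\<And>i. g i \<ge> 0" and z: "\<And>i. z i \<in> unit_steps"
  shows "emeasure (\<Pi>\<^sub>M e\<in>lattice_edges. edge_space \<mu> p)
      {w \<in> space (\<Pi>\<^sub>M e\<in>lattice_edges. edge_space \<mu> p). \<forall>j<n. edge_open (w (edge z c j)) (ring_time g j) = c j} =
    (\<Prod>m<n. ennreal (open_prob \<mu> p z g c m m))"
    and "{w \<in> space (\<Pi>\<^sub>M e\<in>lattice_edges. edge_space \<mu> p). \<forall>j<n. edge_open (w (edge z c j)) (ring_time g j) = c j}
      \<in> sets (\<Pi>\<^sub>M e\<in>lattice_edges. edge_space \<mu> p)"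
proof -
  have lat: "edge z c j \<in> lattice_edges" for j
  proof -
    have "z j \<in> unit_steps" by (rule z)
    then consider i where "z j = axis i 1" | i where "z j = axis i (- 1)"
      by (auto simp: unit_steps_def)
    then show ?thesis
    proof cases
      case 1
      then show ?thesis by (simp only: edge_def lattice_edgesI)
    next
      case 2
      have "pos z c j + axis i (- 1) + axis i 1 = pos z c j" by (simp add: vec_eq_iff axis_def)
      then have "edge z c j = {pos z c j + axis i (- 1), (pos z c j + axis i (- 1)) + axis i 1}"
        using 2 by (simp only: edge_def insert_commute)
      then show ?thesis by (simp only: lattice_edgesI)
    qed
  qed
  define F where "F = edge z c ` {..<n}"
  define S where "S e = {a \<in> space (edge_space \<mu> p). \<forall>j\<in>{j. j < n \<and> edge z c j = e}. edge_open a (ring_time g j) = c j}" for e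
  let ?PE = "\<Pi>\<^sub>M e\<in>lattice_edges. edge_space \<mu> p"
  have F: "F \<subseteq> lattice_edges" "finite F" using lat by (auto simp: F_def)
  have eq: "{w \<in> space ?PE. \<forall>j<n. edge_open (w (edge z c j)) (ring_time g j) = c j} =
      prod_emb lattice_edges (\<lambda>_. edge_space \<mu> p) F (\<Pi>\<^sub>E e\<in>F. S e)"
    (is "?L = ?R")
  proof (rule set_eqI)
    fix w
    have "w \<in> ?R \<longleftrightarrow> w \<in> space ?PE \<and> (\<forall>e\<in>F. w e \<in> S e)"
      by (auto simp: prod_emb_def space_PiM Pi_iff)
    also have "\<dots> \<longleftrightarrow> w \<in> space ?PE \<and> (\<forall>j<n. w (edge z c j) \<in> S (edge z c j))"
      by (auto simp: F_def)
    also have "\<dots> \<longleftrightarrow> w \<in> ?L"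
    proof -
      have "w (edge z c j) \<in> space (edge_space \<mu> p)" if "w \<in> space ?PE" for j
        using that lat[of j] by (simp add: space_PiM PiE_iff)
      moreover have "(\<forall>j<n. \<forall>i\<in>{i. i < n \<and> edge z c i = edge z c j}. edge_open (w (edge z c j)) (ring_time g i) = c i) \<longleftrightarrow>
          (\<forall>j<n. edge_open (w (edge z c j)) (ring_time g j) = c j)" (is "?A \<longleftrightarrow> ?B")
      proof
        assume ?A
        then show ?B by blast
      next
        assume ?B
        then show ?A by (metis (mono_tags, lifting) mem_Collect_eq)
      qed
      ultimately show ?thesis unfolding S_def by (simp only: mem_Collect_eq) blast
    qed
    finally show "w \<in> ?L \<longleftrightarrow> w \<in> ?R" by (rule sym)
  qed
  have S: "S e \<in> sets (edge_space \<mu> p)" "emeasure (edge_space \<mu> p) (S e) = states_agree \<mu> p (ring_time g) c {j. j < n \<and> edge z c j = e}" for e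
    unfolding S_def by (rule emeasure_edge_space[OF \<mu>], simp)+
  show "{w \<in> space ?PE. \<forall>j<n. edge_open (w (edge z c j)) (ring_time g j) = c j} \<in> sets ?PE"
    unfolding eq using F S by (intro sets_PiM_I) auto
  \<comment> \<open>Admitting ring \<open>m\<close> adds one observation to the edge attempted there
    and changes no other factor.\<close>
  have main: "(\<Prod>e\<in>F. states_agree \<mu> p (ring_time g) c {j. j < m \<and> edge z c j = e}) = (\<Prod>m<m. ennreal (open_prob \<mu> p z g c m m))"
    if "m \<le> n" for m
    using that
  proof (induction m)
    case 0
    then show ?case using \<mu> by (simp add: states_agree_empty)
  next
    case (Suc m)
    let ?sa = "\<lambda>m e. states_agree \<mu> p (ring_time g) c {j. j < m \<and> edge z c j = e}"
    have mem: "edge z c m \<in> F" using Suc.prems by (auto simp: F_def)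
    have "?sa (Suc m) e = ?sa m e" if "e \<noteq> edge z c m" for e
      using that by (intro arg_cong[where f="states_agree \<mu> p (ring_time g) c"]) (auto simp: less_Suc_eq)
    then have rest: "(\<Prod>e\<in>F - {edge z c m}. ?sa (Suc m) e) = (\<Prod>e\<in>F - {edge z c m}. ?sa m e)"
      by (intro prod.cong) auto
    have "{j. j < Suc m \<and> edge z c j = edge z c m} = insert m {j. j < m \<and> edge z c j = edge z c m}"
      by auto
    then have one: "?sa (Suc m) (edge z c m) = ennreal (open_prob \<mu> p z g c m m) * ?sa m (edge z c m)"
      using states_agree_look[OF \<mu> g, where j=m and n=m] by simp
    show ?case
      using Suc by (simp add: prod.remove[OF F(2) mem] rest one mult_ac)
  qed
  show "emeasure ?PE {w \<in> space ?PE. \<forall>j<n. edge_open (w (edge z c j)) (ring_time g j) = c j} =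
      (\<Prod>m<n. ennreal (open_prob \<mu> p z g c m m))"
    unfolding eq using F S main[OF order_refl] prob_space_edge_space[OF \<mu>]
    by (subst emeasure_PiM_emb) auto
qed

definition mark_age :: "real \<Rightarrow> real \<Rightarrow> (bool \<times> real) measure" where
  "mark_age \<mu> p = measure_pmf (bernoulli_pmf p) \<Otimes>\<^sub>M exponential_gap \<mu>"

lemma prob_space_mark_age: "\<mu> > 0 \<Longrightarrow> prob_space (mark_age \<mu> p)"
  unfolding mark_age_def by (intro prob_space_pair prob_space_exponential_gap measure_pmf.prob_space_axioms)

lemma sets_mark_age [measurable_cong]: "sets (mark_age \<mu> p) = sets (count_space UNIV \<Otimes>\<^sub>M borel)"
  unfolding mark_age_def by (rule sets_pair_measure_cong) auto

text \<open>An age exceeds the time \<open>s\<close> since the last attempt with probability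
  \<open>exp (- \<mu> * s)\<close>, exactly as the clock of the edge stays silent for a time
  \<open>s\<close>. So the ages reproduce the conditional probabilities.\<close>

lemma prob_look:
  assumes \<mu>: "\<mu> > 0" and g: "\<And>i. g i \<ge> 0"
  shows "emeasure (mark_age \<mu> p) {x \<in> space (mark_age \<mu> p). look (\<lambda>j. edge z c j = edge z c n) (\<lambda>j. snd x \<le> sum g {j<..n}) c (fst x) j = c n} =
    ennreal (open_prob \<mu> p z g c n j)"
proof (induction j)
  let ?B = "measure_pmf (bernoulli_pmf p)" and ?E = "exponential_gap \<mu>"
  interpret E: prob_space ?E by (rule prob_space_exponential_gap) fact
  {
    case 0
    have "{x \<in> space (mark_age \<mu> p). fst x = c n} = {c n} \<times> UNIV"
      by (auto simp: mark_age_def space_pair_measure)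
    then show ?case
      using E.emeasure_space_1 unfolding mark_age_def
      by (simp add: E.emeasure_pair_measure_Times emeasure_bernoulli_single)
  next
    case (Suc j)
    show ?case
    proof (cases "edge z c j = edge z c n")
      case False
      then show ?thesis using Suc by simp
    next
      case True
      let ?d = "sum g {j<..n}"
      have d: "?d \<ge> 0" using g by (intro sum_nonneg) auto
      have "{x \<in> space (mark_age \<mu> p). (if snd x \<le> ?d then fst x else c j) = c n} =
          {c n} \<times> {..?d} \<union> UNIV \<times> (if c j = c n then {?d<..} else {})"
        by (auto simp: mark_age_def space_pair_measure)
      moreover have "emeasure (mark_age \<mu> p) ({c n} \<times> {..?d} \<union> UNIV \<times> (if c j = c n then {?d<..} else {})) =
          emeasure (mark_age \<mu> p) ({c n} \<times> {..?d}) + emeasure (mark_age \<mu> p) (UNIV \<times> (if c j = c n then {?d<..} else {}))"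
        unfolding mark_age_def by (intro plus_emeasure[symmetric]) auto
      moreover have "emeasure ?E {..?d} = ennreal (1 - exp (- \<mu> * ?d))"
        using E.prob_compl[of "{?d<..}"] measure_exponential_gap_greaterThan[OF \<mu> d]
        by (simp add: E.emeasure_eq_measure Compl_eq_Diff_UNIV[symmetric])
      moreover have "exp (- \<mu> * ?d) \<le> 1" using \<mu> d by simp
      ultimately show ?thesis
        using True emeasure_exponential_gap_greaterThan[OF \<mu> d]
        by (auto simp: mark_age_def E.emeasure_pair_measure_Times emeasure_bernoulli_single refresh_prob_def
          ennreal_mult[symmetric] ennreal_plus[symmetric] mult_ac add_ac simp del: ennreal_plus)
    qed
  }
qed

lemma prob_passes:
  assumes \<mu>: "\<mu> > 0" and g: "\<And>i. g i \<ge> 0"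
  shows "emeasure (iid (mark_age \<mu> p))
      {w \<in> space (iid (mark_age \<mu> p)). \<forall>j<n. passes z g (\<lambda>i. snd (w i)) (\<lambda>i. fst (w i)) j = c j} =
    (\<Prod>m<n. ennreal (open_prob \<mu> p z g c m m))"
    and "{w \<in> space (iid (mark_age \<mu> p)). \<forall>j<n. passes z g (\<lambda>i. snd (w i)) (\<lambda>i. fst (w i)) j = c j}
      \<in> sets (iid (mark_age \<mu> p))"
proof -
  let ?PA = "iid (mark_age \<mu> p)"
  define S where "S m = {x \<in> space (mark_age \<mu> p). new_state z g (snd x) (fst x) c m = c m}" for m
  \<comment> \<open>As long as the outcomes follow \<open>c\<close>, the next one can be computed
    from \<open>c\<close>. The event thus becomes a family of separate conditions on the pairs of
    mark and age, which are independent.\<close>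
  have agree: "(\<forall>j<n. passes z g A B j = c j) \<longleftrightarrow> (\<forall>j<n. new_state z g (A j) (B j) c j = c j)" for A B
  proof (induction n)
    case (Suc n)
    have "passes z g A B n = new_state z g (A n) (B n) c n" if "\<forall>j<n. passes z g A B j = c j"
      unfolding passes_unfold[of z g A B n] by (rule new_state_cong) (use that in auto)
    note new = this
    show ?case
    proof (cases "\<forall>j<n. passes z g A B j = c j")
      case True
      show ?thesis by (simp only: All_less_Suc Suc.IH[symmetric] new[OF True])
    next
      case False
      then show ?thesis by (simp only: All_less_Suc Suc.IH[symmetric]) blast
    qed
  qed simp
  have sp: "space (mark_age \<mu> p) = UNIV" by (simp add: mark_age_def space_pair_measure)
  have eq: "{w \<in> space ?PA. \<forall>j<n. passes z g (\<lambda>i. snd (w i)) (\<lambda>i. fst (w i)) j = c j} =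
      prod_emb UNIV (\<lambda>_. mark_age \<mu> p) {..<n} (\<Pi>\<^sub>E m\<in>{..<n}. S m)"
    unfolding agree by (rule set_eqI) (simp add: prod_emb_def space_PiM S_def sp Pi_iff Ball_def)
  have "Measurable.pred (mark_age \<mu> p) (\<lambda>x. look (\<lambda>j. edge z c j = edge z c m) (\<lambda>j. snd x \<le> sum g {j<..m}) c (fst x) m)" for m
    by (rule measurable_look) measurable
  then have S: "S m \<in> sets (mark_age \<mu> p)" for m
    unfolding S_def new_state_def by measurable
  show "{w \<in> space ?PA. \<forall>j<n. passes z g (\<lambda>i. snd (w i)) (\<lambda>i. fst (w i)) j = c j} \<in> sets ?PA"
    unfolding eq using S by (intro sets_PiM_I) auto
  have "emeasure (mark_age \<mu> p) (S m) = ennreal (open_prob \<mu> p z g c m m)" for m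
    unfolding S_def new_state_def by (rule prob_look[OF \<mu> g])
  then show "emeasure ?PA {w \<in> space ?PA. \<forall>j<n. passes z g (\<lambda>i. snd (w i)) (\<lambda>i. fst (w i)) j = c j} =
      (\<Prod>m<n. ennreal (open_prob \<mu> p z g c m m))"
    unfolding eq using S prob_space_mark_age[OF \<mu>] by (subst emeasure_PiM_emb) auto
qed

text \<open>A quantity determined by \<open>n\<close> outcomes has an integral determined by the
  probabilities of the finitely many patterns. \<open>Q\<close> gives the true outcomes, and
  \<open>P\<close> the same event written with the edges of the prescribed pattern.\<close>

lemma nn_integral_sum_patterns:
  fixes f :: "'b \<Rightarrow> ennreal" and Q :: "'a \<Rightarrow> nat \<Rightarrow> bool"
  assumes sets: "\<And>S. S \<subseteq> {..<n} \<Longrightarrow> {w \<in> space M. \<forall>j<n. P w S j} \<in> sets M"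
    and P: "\<And>w S. w \<in> space M \<Longrightarrow> S \<subseteq> {..<n} \<Longrightarrow> (\<forall>j<n. P w S j) \<longleftrightarrow> (\<forall>j<n. Q w j = (j \<in> S))"
    and F: "\<And>w S. w \<in> space M \<Longrightarrow> S \<subseteq> {..<n} \<Longrightarrow> \<forall>j<n. Q w j = (j \<in> S) \<Longrightarrow> F w = f' S"
  shows "(\<integral>\<^sup>+w. f (F w) \<partial>M) = (\<Sum>S\<in>Pow {..<n}. f (f' S) * emeasure M {w \<in> space M. \<forall>j<n. P w S j})"
proof -
  have "(\<integral>\<^sup>+w. f (F w) \<partial>M) = (\<integral>\<^sup>+w. (\<Sum>S\<in>Pow {..<n}. f (f' S) * indicator {w \<in> space M. \<forall>j<n. P w S j} w) \<partial>M)"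
  proof (rule nn_integral_cong)
    fix w assume w: "w \<in> space M"
    let ?S = "{j. j < n \<and> Q w j}"
    have "(\<Sum>S\<in>Pow {..<n}. f (f' S) * indicator {w \<in> space M. \<forall>j<n. P w S j} w) =
        (\<Sum>S\<in>Pow {..<n}. if S = ?S then f (f' S) else 0)"
    proof (rule sum.cong)
      fix S assume "S \<in> Pow {..<n}"
      then have S: "S \<subseteq> {..<n}" by simp
      have "(\<forall>j<n. Q w j = (j \<in> S)) \<longleftrightarrow> S = ?S" using S by auto
      then show "f (f' S) * indicator {w \<in> space M. \<forall>j<n. P w S j} w = (if S = ?S then f (f' S) else 0)"
        using w P[OF w S] by (simp add: indicator_def)
    qed simp
    also have "\<dots> = f (f' ?S)" by (subst sum.delta) auto
    also have "f' ?S = F w" by (rule F[symmetric]) (use w in auto)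
    finally show "f (F w) = (\<Sum>S\<in>Pow {..<n}. f (f' S) * indicator {w \<in> space M. \<forall>j<n. P w S j} w)" by simp
  qed
  also have "\<dots> = (\<Sum>S\<in>Pow {..<n}. \<integral>\<^sup>+w. f (f' S) * indicator {w \<in> space M. \<forall>j<n. P w S j} w \<partial>M)"
    by (rule nn_integral_sum, rule borel_measurable_times_ennreal[OF borel_measurable_const],
        rule borel_measurable_indicator, rule sets) simp
  also have "\<dots> = (\<Sum>S\<in>Pow {..<n}. f (f' S) * emeasure M {w \<in> space M. \<forall>j<n. P w S j})"
    by (rule sum.cong[OF refl], rule nn_integral_cmult_indicator, rule sets) simp
  finally show ?thesis .
qed

lemma skeleton_eq_pos:
  "skeleton w n = pos (\<lambda>i. snd (snd w i)) (\<lambda>i. eta w (ring_time (walker_gaps w) i) {skeleton w i, skeleton w i + snd (snd w i)}) n"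
  by (induction n) (simp_all add: pos_def Let_def)

text \<open>While the outcomes follow \<open>c\<close>, the walker stands where \<open>c\<close>
  predicts, so it queries the predicted edge.\<close>

lemma skeleton_pattern:
  fixes w :: "'d::finite sample"
  defines "z \<equiv> (\<lambda>i. snd (snd w i))"
  shows "(\<forall>j<n. edge_open (fst w (edge z c j)) (ring_time (walker_gaps w) j) = c j) \<longleftrightarrow>
    (\<forall>j<n. eta w (ring_time (walker_gaps w) j) {skeleton w j, skeleton w j + snd (snd w j)} = c j)"
proof (induction n)
  case (Suc n)
  have "edge z c n = {skeleton w n, skeleton w n + snd (snd w n)}"
    if "\<forall>j<n. eta w (ring_time (walker_gaps w) j) {skeleton w j, skeleton w j + snd (snd w j)} = c j"
  proof -
    have "skeleton w n = pos z c n"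
      by (subst skeleton_eq_pos, unfold z_def, rule pos_cong) (use that in auto)
    then show ?thesis by (simp add: edge_def z_def)
  qed
  note edge = this
  show ?case
  proof (cases "\<forall>j<n. eta w (ring_time (walker_gaps w) j) {skeleton w j, skeleton w j + snd (snd w j)} = c j")
    case True
    show ?thesis by (simp only: All_less_Suc Suc.IH edge[OF True] eta_def)
  next
    case False
    then show ?thesis by (simp only: All_less_Suc Suc.IH simp_thms)
  qed
qed simp

text \<open>With clock and proposals fixed, every pattern has the same probability under the edge
  clocks and under ages and marks, namely the product of the \<open>open_prob\<close>.\<close>

lemma nn_integral_skeleton_quenched:
  assumes \<mu>: "\<mu> > 0" and g: "\<And>i. fst (v i) \<ge> 0" and z: "\<And>i. snd (v i) \<in> unit_steps"
  shows "(\<integral>\<^sup>+a. f (skeleton (a, v) n) \<partial>(\<Pi>\<^sub>M e\<in>lattice_edges. edge_space \<mu> p)) =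
    (\<integral>\<^sup>+w. f (pos (\<lambda>i. snd (v i)) (passes (\<lambda>i. snd (v i)) (\<lambda>i. fst (v i)) (\<lambda>i. snd (w i)) (\<lambda>i. fst (w i))) n)
      \<partial>iid (mark_age \<mu> p))"
proof -
  let ?z = "\<lambda>i. snd (v i)" and ?g = "\<lambda>i. fst (v i)"
  let ?PE = "\<Pi>\<^sub>M e\<in>lattice_edges. edge_space \<mu> p" and ?PA = "iid (mark_age \<mu> p)"
  have wg: "walker_gaps (a, v) = ?g" for a :: "(int ^ 'a) set \<Rightarrow> edge_sample" by (simp add: walker_gaps_def fun_eq_iff)
  have "(\<integral>\<^sup>+a. f (skeleton (a, v) n) \<partial>?PE) = (\<Sum>S\<in>Pow {..<n}. f (pos ?z (\<lambda>j. j \<in> S) n) *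
      emeasure ?PE {a \<in> space ?PE. \<forall>j<n. edge_open (a (edge ?z (\<lambda>j. j \<in> S) j)) (ring_time ?g j) = (j \<in> S)})"
  proof (rule nn_integral_sum_patterns[where F="\<lambda>a. skeleton (a, v) n" and f'="\<lambda>S. pos ?z (\<lambda>j. j \<in> S) n"
      and Q="\<lambda>a j. eta (a, v) (ring_time ?g j) {skeleton (a, v) j, skeleton (a, v) j + snd (v j)}"
      and P="\<lambda>a S j. edge_open (a (edge ?z (\<lambda>j. j \<in> S) j)) (ring_time ?g j) = (j \<in> S)"])
    fix a S
    show "(\<forall>j<n. edge_open (a (edge ?z (\<lambda>j. j \<in> S) j)) (ring_time ?g j) = (j \<in> S)) \<longleftrightarrow>
        (\<forall>j<n. eta (a, v) (ring_time ?g j) {skeleton (a, v) j, skeleton (a, v) j + snd (v j)} = (j \<in> S))"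
      using skeleton_pattern[of n "(a, v)" "\<lambda>j. j \<in> S"] by (simp add: wg)
    assume *: "\<forall>j<n. eta (a, v) (ring_time ?g j) {skeleton (a, v) j, skeleton (a, v) j + snd (v j)} = (j \<in> S)"
    show "skeleton (a, v) n = pos ?z (\<lambda>j. j \<in> S) n"
      by (subst skeleton_eq_pos, rule pos_cong) (use * in \<open>auto simp: wg\<close>)
  qed (rule prob_states[OF \<mu> g z])
  also have "\<dots> = (\<Sum>S\<in>Pow {..<n}. f (pos ?z (\<lambda>j. j \<in> S) n) *
      emeasure ?PA {w \<in> space ?PA. \<forall>j<n. passes ?z ?g (\<lambda>i. snd (w i)) (\<lambda>i. fst (w i)) j = (j \<in> S)})"
    by (simp only: prob_states(1)[of _ ?g ?z, OF \<mu> g z] prob_passes(1)[of _ ?g, OF \<mu> g])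
  also have "\<dots> = (\<integral>\<^sup>+w. f (pos ?z (passes ?z ?g (\<lambda>i. snd (w i)) (\<lambda>i. fst (w i))) n) \<partial>?PA)"
    by (rule nn_integral_sum_patterns[symmetric, where Q="\<lambda>w. passes ?z ?g (\<lambda>i. snd (w i)) (\<lambda>i. fst (w i))"],
        rule prob_passes(2)[of _ ?g, OF \<mu> g], rule refl, rule pos_cong) simp_all
  finally show ?thesis .
qed

text \<open>The step type is left open so that one driver can carry a coupled pair of proposals,
  from which \<open>map_steps\<close> extracts either walk.\<close>

type_synonym 's driver = "nat \<Rightarrow> (real \<times> 's) \<times> (bool \<times> real)"

definition driver_space :: "real \<Rightarrow> real \<Rightarrow> 's pmf \<Rightarrow> 's driver measure" where
  "driver_space \<mu> p s = iid ((exponential_gap 1 \<Otimes>\<^sub>M measure_pmf s) \<Otimes>\<^sub>M mark_age \<mu> p)"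

abbreviation gap_of :: "'s driver \<Rightarrow> nat \<Rightarrow> real" where "gap_of w i \<equiv> fst (fst (w i))"
abbreviation step_of :: "'s driver \<Rightarrow> nat \<Rightarrow> 's" where "step_of w i \<equiv> snd (fst (w i))"
abbreviation mark_of :: "'s driver \<Rightarrow> nat \<Rightarrow> bool" where "mark_of w i \<equiv> fst (snd (w i))"
abbreviation age_of :: "'s driver \<Rightarrow> nat \<Rightarrow> real" where "age_of w i \<equiv> snd (snd (w i))"

lemma prob_space_driver1: "\<mu> > 0 \<Longrightarrow> prob_space ((exponential_gap 1 \<Otimes>\<^sub>M measure_pmf s) \<Otimes>\<^sub>M mark_age \<mu> p)"
  by (intro prob_space_pair prob_space_exponential_gap measure_pmf.prob_space_axioms prob_space_mark_age) auto

lemma prob_space_driver_space: "\<mu> > 0 \<Longrightarrow> prob_space (driver_space \<mu> p s)"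
  unfolding driver_space_def by (intro prob_space_PiM prob_space_driver1)

lemma measurable_driver [measurable]:
  "(\<lambda>w. gap_of w i) \<in> borel_measurable (driver_space \<mu> p s)"
  "(\<lambda>w. step_of w i) \<in> driver_space \<mu> p s \<rightarrow>\<^sub>M count_space UNIV"
  "(\<lambda>w. mark_of w i) \<in> driver_space \<mu> p s \<rightarrow>\<^sub>M count_space UNIV"
  "(\<lambda>w. age_of w i) \<in> borel_measurable (driver_space \<mu> p s)"
  unfolding driver_space_def by measurable

definition pos_of :: "(int ^ 'd::finite) driver \<Rightarrow> nat \<Rightarrow> int ^ 'd" where
  "pos_of w n = pos (step_of w) (passes (step_of w) (gap_of w) (age_of w) (mark_of w)) n"

definition passes_of :: "(int ^ 'd::finite) driver \<Rightarrow> nat \<Rightarrow> bool" where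
  "passes_of w = passes (step_of w) (gap_of w) (age_of w) (mark_of w)"

lemma measurable_passes_of [measurable]: "Measurable.pred (driver_space \<mu> p s) (\<lambda>w. passes_of w n)"
  unfolding passes_of_def by (rule measurable_passes) measurable

lemma measurable_pos_of [measurable]: "(\<lambda>w. pos_of w n) \<in> driver_space \<mu> p s \<rightarrow>\<^sub>M count_space UNIV"
  using measurable_passes_of unfolding pos_of_def passes_of_def by (intro measurable_pos) auto

lemma set_step_pmf: "set_pmf (step_pmf k l) \<subseteq> unit_steps"
  by (auto simp: set_pmf_iff pmf_step_pmf step_prob_def unit_steps_def split: if_splits)

lemma AE_walker_space:
  fixes k :: "'d::finite"
  shows "AE v in walker_space k l. \<forall>i. fst (v i) > 0 \<and> snd (v i) \<in> unit_steps"
proof -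
  interpret E: prob_space "exponential_gap 1" by (rule prob_space_exponential_gap) simp
  let ?M = "exponential_gap 1 \<Otimes>\<^sub>M measure_pmf (step_pmf k l)"
  interpret P: pair_sigma_finite "exponential_gap 1" "measure_pmf (step_pmf k l)" ..
  have "AE x in ?M. fst x > 0 \<and> snd x \<in> unit_steps"
  proof (rule P.AE_pair_measure)
    have [measurable]: "Measurable.pred ?M (\<lambda>x. snd x \<in> unit_steps)"
      by (rule measurable_compose[OF measurable_snd]) simp
    show "{x \<in> space ?M. fst x > 0 \<and> snd x \<in> unit_steps} \<in> sets ?M" by measurable
    show "AE x in exponential_gap 1. AE y in step_pmf k l. fst (x, y) > 0 \<and> snd (x, y) \<in> unit_steps"
      using AE_exponential_gap_pos[of 1] set_step_pmf[of k l]
      by (auto simp: AE_measure_pmf_iff)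
  qed
  then have "AE v in walker_space k l. fst (v i) > 0 \<and> snd (v i) \<in> unit_steps" for i
    unfolding walker_space_def by (intro AE_PiM_component) (auto intro: prob_space_pair E.prob_space_axioms measure_pmf.prob_space_axioms)
  then show ?thesis unfolding AE_all_countable by blast
qed

lemma measurable_walker [measurable]:
  "(\<lambda>v. fst (v i)) \<in> borel_measurable (walker_space k l)"
  "(\<lambda>v. snd (v i)) \<in> walker_space k l \<rightarrow>\<^sub>M count_space UNIV"
  unfolding walker_space_def by measurable

lemma measurable_skeleton: "(\<lambda>w. skeleton w n) \<in> sample_space (k :: 'd::finite) \<mu> p l \<rightarrow>\<^sub>M count_space UNIV"
proof (induction n)
  case (Suc n)
  let ?M = "sample_space k \<mu> p l"
  have sw: "snd \<in> ?M \<rightarrow>\<^sub>M walker_space k l" unfolding sample_space_def by measurable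
  have z: "(\<lambda>w. snd (snd w n)) \<in> ?M \<rightarrow>\<^sub>M count_space UNIV"
    by (rule measurable_compose[OF sw]) measurable
  have g: "(\<lambda>w. fst (snd w i)) \<in> borel_measurable ?M" for i
    by (rule measurable_compose[OF sw]) measurable
  have T [measurable]: "(\<lambda>w. ring_time (walker_gaps w) n) \<in> borel_measurable ?M"
    unfolding ring_time_def walker_gaps_def using g by measurable
  have eta: "Measurable.pred ?M (\<lambda>w. eta w (ring_time (walker_gaps w) n) e)" for e
  proof (cases "e \<in> lattice_edges")
    case True
    then have "(\<lambda>w. fst w e) \<in> ?M \<rightarrow>\<^sub>M edge_space \<mu> p"
      unfolding sample_space_def by measurable
    then show ?thesis unfolding eta_def by (rule measurable_edge_open) measurable
  next
    case False
    \<comment> \<open>Outside \<open>lattice_edges\<close> the environment is constantly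
      \<open>undefined\<close>, and a constant edge sample seen at a measurable time is still
      measurable.\<close>
    then have eq: "fst w e = undefined" if "w \<in> space ?M" for w
      using that by (auto simp: sample_space_def space_pair_measure space_PiM PiE_def extensional_def)
    have "(\<lambda>_. undefined) \<in> ?M \<rightarrow>\<^sub>M edge_space \<mu> p"
      by (rule measurable_const) (simp add: edge_space_def space_pair_measure space_PiM)
    then have "Measurable.pred ?M (\<lambda>w. edge_open undefined (ring_time (walker_gaps w) n))"
      by (rule measurable_edge_open) measurable
    then show ?thesis unfolding eta_def by (subst measurable_cong[OF arg_cong[where f="\<lambda>a. edge_open a _"]]) (auto simp: eq)
  qed
  \<comment> \<open>The queried edge is random, but position and step take countably many values,
    and for each of them the edge is fixed.\<close>
  have "(\<lambda>w. (skeleton w n, snd (snd w n))) \<in> ?M \<rightarrow>\<^sub>M count_space UNIV"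
    by (rule measurable_count_space2[where h=Pair]) (use Suc z in auto)
  then have "(\<lambda>w. (\<lambda>q w. if eta w (ring_time (walker_gaps w) n) {fst q, fst q + snd q} then fst q + snd q else fst q)
      (skeleton w n, snd (snd w n)) w) \<in> ?M \<rightarrow>\<^sub>M count_space UNIV"
  proof (rule measurable_compose_countable[rotated])
    fix q :: "(int ^ 'd) \<times> (int ^ 'd)"
    note [measurable] = eta
    show "(\<lambda>w. if eta w (ring_time (walker_gaps w) n) {fst q, fst q + snd q} then fst q + snd q else fst q) \<in> ?M \<rightarrow>\<^sub>M count_space UNIV"
      by measurable
  qed
  then show ?case unfolding skeleton.simps Let_def fst_conv snd_conv .
qed simp

text \<open>Averages the identity for fixed clock and proposals. It concerns one \<open>n\<close> at
  a time and makes no claim on joint laws; moments of the position pass from the driver to the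
  skeleton in this way.\<close>

lemma nn_integral_skeleton:
  fixes k :: "'d::finite" and f :: "int ^ 'd \<Rightarrow> ennreal"
  assumes \<mu>: "\<mu> > 0"
  shows "(\<integral>\<^sup>+w. f (skeleton w n) \<partial>sample_space k \<mu> p l) = (\<integral>\<^sup>+w. f (pos_of w n) \<partial>driver_space \<mu> p (step_pmf k l))"
proof -
  let ?PE = "\<Pi>\<^sub>M e\<in>lattice_edges. edge_space \<mu> p :: edge_sample measure" and ?W = "walker_space k l"
  let ?PA = "iid (mark_age \<mu> p)"
  interpret PE: prob_space ?PE by (intro prob_space_PiM prob_space_edge_space \<mu>)
  have W1: "prob_space (exponential_gap 1 \<Otimes>\<^sub>M measure_pmf (step_pmf k l))"
    by (intro prob_space_pair prob_space_exponential_gap measure_pmf.prob_space_axioms) simp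
  interpret W: prob_space ?W unfolding walker_space_def by (intro prob_space_PiM W1)
  interpret PW: pair_sigma_finite ?PE ?W ..
  have m: "(\<lambda>w. f (skeleton w n)) \<in> borel_measurable (?PE \<Otimes>\<^sub>M ?W)"
    using measurable_compose[OF measurable_skeleton, of f borel n k \<mu> p l] by (simp add: sample_space_def)
  have "(\<integral>\<^sup>+w. f (skeleton w n) \<partial>sample_space k \<mu> p l) = (\<integral>\<^sup>+v. \<integral>\<^sup>+a. f (skeleton (a, v) n) \<partial>?PE \<partial>?W)"
    unfolding sample_space_def by (rule PW.nn_integral_snd[OF m, symmetric])
  also have "\<dots> = (\<integral>\<^sup>+v. \<integral>\<^sup>+w. f (pos (\<lambda>i. snd (v i)) (passes (\<lambda>i. snd (v i)) (\<lambda>i. fst (v i)) (\<lambda>i. snd (w i)) (\<lambda>i. fst (w i))) n) \<partial>?PA \<partial>?W)"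
  proof (rule nn_integral_cong_AE, use AE_walker_space[of k l] in eventually_elim)
    case (elim v)
    show ?case
      by (rule nn_integral_skeleton_quenched[OF \<mu>]) (use elim in \<open>simp_all add: less_imp_le\<close>)
  qed
  also have "\<dots> = (\<integral>\<^sup>+w. f (pos_of w n) \<partial>driver_space \<mu> p (step_pmf k l))"
    unfolding driver_space_def walker_space_def
    by (subst nn_integral_PiM_zip[OF W1 prob_space_mark_age[OF \<mu>]])
       (use measurable_compose[OF measurable_pos_of, of f borel] in \<open>auto simp: driver_space_def pos_of_def\<close>)
  finally show ?thesis .
qed

section \<open>Decay of correlations\<close>

definition alive_of :: "'s driver \<Rightarrow> nat \<Rightarrow> nat \<Rightarrow> bool" where
  "alive_of w i m = alive (gap_of w) (age_of w) 0 i m"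

lemma measurable_alive_of [measurable]: "Measurable.pred (driver_space \<mu> p s) (\<lambda>w. alive_of w i m)"
  unfolding alive_of_def by (rule measurable_alive) measurable

lemma measurable_mark_age [measurable, simp]:
  "fst \<in> mark_age \<mu> p \<rightarrow>\<^sub>M count_space UNIV" "snd \<in> borel_measurable (mark_age \<mu> p)"
  unfolding mark_age_def by measurable

text \<open>The reach is a function of gaps and ages, so it is independent of all steps and marks.
  Unzipping the driver into its four sequences makes the integral factor, whatever the ring
  indices.\<close>

lemma nn_integral_alive_indep:
  fixes s :: "'s pmf"
  assumes \<mu>: "\<mu> > 0"
  shows "(\<integral>\<^sup>+w. of_bool (Z (step_of w j)) * (of_bool (Q (mark_of w i)) * of_bool (alive_of w k m)) \<partial>driver_space \<mu> p s) =
    emeasure (measure_pmf s) {x. Z x} * (emeasure (measure_pmf (bernoulli_pmf p)) {b. Q b} *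
      (\<integral>\<^sup>+w. of_bool (alive (\<lambda>i. fst (w i)) (\<lambda>i. snd (w i)) 0 k m) \<partial>iid (gap_age \<mu>)))"
proof -
  let ?S = "measure_pmf s" and ?B = "measure_pmf (bernoulli_pmf p)"
  let ?GS = "iid (exponential_gap 1 \<Otimes>\<^sub>M ?S)" and ?MA = "iid (mark_age \<mu> p)"
  let ?G = "gaps 1" and ?A = "gaps \<mu>" and ?Bs = "marks p" and ?Ss = "iid ?S"
  have E1: "prob_space (exponential_gap 1)" by (rule prob_space_exponential_gap) simp
  have EM: "prob_space (exponential_gap \<mu>)" by (rule prob_space_exponential_gap) fact
  have S: "prob_space ?S" and B: "prob_space ?B" by (rule measure_pmf.prob_space_axioms)+
  have GS1: "prob_space (exponential_gap 1 \<Otimes>\<^sub>M ?S)" by (rule prob_space_pair[OF E1 S])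
  have MA1: "prob_space (mark_age \<mu> p)" by (rule prob_space_mark_age) fact
  interpret A: prob_space ?A by (rule prob_space_gaps) fact
  interpret Bs: prob_space ?Bs by (rule prob_space_marks)
  interpret Ss: prob_space ?Ss by (intro prob_space_PiM S)
  let ?al = "\<lambda>g a. of_bool (alive g a 0 k m) :: ennreal"
  have gcomp [measurable]: "(\<lambda>g. g i) \<in> borel_measurable (gaps r)" for i r by measurable
  have al: "(\<lambda>x. of_bool (alive (g x) (a x) 0 k m) :: ennreal) \<in> borel_measurable M"
    if "\<And>i. (\<lambda>x. g x i) \<in> borel_measurable M" "\<And>i. (\<lambda>x. a x i) \<in> borel_measurable M" for M :: "'x measure" and g a
  proof -
    have [measurable]: "Measurable.pred M (\<lambda>x. alive (g x) (a x) 0 k m)"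
      by (rule measurable_alive) (use that in auto)
    show ?thesis by measurable
  qed
  have al_A: "?al g \<in> borel_measurable ?A" for g by (rule al) measurable
  have al_GA: "(\<lambda>x. ?al (fst x) (snd x)) \<in> borel_measurable (?G \<Otimes>\<^sub>M ?A)" by (rule al) measurable
  define a where "a g = (\<integral>\<^sup>+x. ?al g x \<partial>?A)" for g
  have a_meas [measurable]: "a \<in> borel_measurable ?G"
    unfolding a_def using al_GA by (intro A.borel_measurable_nn_integral) (simp add: split_beta')
  let ?q = "emeasure ?S {x. Z x}" and ?h = "emeasure ?B {b. Q b}"
  have comp_int: "(\<integral>\<^sup>+x. of_bool (R (x i)) \<partial>iid (measure_pmf t)) = emeasure (measure_pmf t) {x. R x}" for t :: "'y pmf" and R and i :: nat
  proof -
    have "(\<integral>\<^sup>+x. of_bool (R (x i)) \<partial>iid (measure_pmf t)) =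
        (\<integral>\<^sup>+y. of_bool (R y) \<partial>distr (iid (measure_pmf t)) (measure_pmf t) (\<lambda>x. x i))"
      by (subst nn_integral_distr) auto
    also have "distr (iid (measure_pmf t)) (measure_pmf t) (\<lambda>x. x i) = measure_pmf t"
      by (rule distr_PiM_component) (auto intro: measure_pmf.prob_space_axioms)
    also have "(\<integral>\<^sup>+y. of_bool (R y) \<partial>measure_pmf t) = (\<integral>\<^sup>+y. indicator {x. R x} y \<partial>measure_pmf t)"
      by (intro nn_integral_cong) (simp add: indicator_def)
    also have "\<dots> = emeasure (measure_pmf t) {x. R x}" by simp
    finally show ?thesis .
  qed
  have inner: "(\<integral>\<^sup>+v. of_bool (Q (fst (v i))) * ?al g (\<lambda>i. snd (v i)) \<partial>?MA) = ?h * a g" for g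
  proof -
    have m1: "(\<lambda>v. ?al g (\<lambda>i. snd (v i))) \<in> borel_measurable ?MA"
      by (rule al) (auto intro!: measurable_compose[OF measurable_component_singleton])
    have m2: "(\<lambda>v. of_bool (Q (fst (v i))) :: ennreal) \<in> borel_measurable ?MA"
      unfolding mark_age_def by measurable
    have "(\<integral>\<^sup>+v. of_bool (Q (fst (v i))) * ?al g (\<lambda>i. snd (v i)) \<partial>?MA) =
        (\<integral>\<^sup>+b. \<integral>\<^sup>+x. of_bool (Q (b i)) * ?al g x \<partial>?A \<partial>?Bs)"
      using nn_integral_PiM_zip[OF B EM, folded mark_age_def, OF borel_measurable_times_ennreal[OF m2 m1]]
      by (simp add: gaps_def)
    also have "\<dots> = (\<integral>\<^sup>+b. of_bool (Q (b i)) * a g \<partial>?Bs)"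
      unfolding a_def by (intro nn_integral_cong nn_integral_cmult al_A)
    also have "\<dots> = (\<integral>\<^sup>+b. of_bool (Q (b i)) \<partial>?Bs) * a g"
      by (rule nn_integral_multc) measurable
    finally show ?thesis by (simp only: comp_int)
  qed
  have "(\<integral>\<^sup>+w. of_bool (Z (step_of w j)) * (of_bool (Q (mark_of w i)) * of_bool (alive_of w k m)) \<partial>driver_space \<mu> p s) =
      (\<integral>\<^sup>+u. \<integral>\<^sup>+v. of_bool (Z (snd (u j))) * (of_bool (Q (fst (v i))) * ?al (\<lambda>i. fst (u i)) (\<lambda>i. snd (v i))) \<partial>?MA \<partial>?GS)"
  proof -
    have [measurable]: "Measurable.pred (driver_space \<mu> p s) (\<lambda>w. Z (step_of w j))"
      by (rule measurable_compose[OF measurable_driver(2)]) simp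
    have [measurable]: "Measurable.pred (driver_space \<mu> p s) (\<lambda>w. Q (mark_of w i))"
      by (rule measurable_compose[OF measurable_driver(3)]) simp
    have "(\<lambda>w. of_bool (Z (step_of w j)) * (of_bool (Q (mark_of w i)) * of_bool (alive_of w k m)) :: ennreal) \<in> borel_measurable (driver_space \<mu> p s)"
      by measurable
    from nn_integral_PiM_zip[OF GS1 MA1, folded driver_space_def, OF this] show ?thesis
      by (simp add: alive_of_def)
  qed
  also have "\<dots> = (\<integral>\<^sup>+u. of_bool (Z (snd (u j))) * (?h * a (\<lambda>i. fst (u i))) \<partial>?GS)"
  proof (rule nn_integral_cong)
    fix u :: "nat \<Rightarrow> real \<times> 's"
    have m1: "(\<lambda>v. ?al (\<lambda>i. fst (u i)) (\<lambda>i. snd (v i))) \<in> borel_measurable ?MA"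
      by (rule al) (auto intro!: measurable_compose[OF measurable_component_singleton])
    have m2: "(\<lambda>v. of_bool (Q (fst (v i))) :: ennreal) \<in> borel_measurable ?MA"
      unfolding mark_age_def by measurable
    show "(\<integral>\<^sup>+v. of_bool (Z (snd (u j))) * (of_bool (Q (fst (v i))) * ?al (\<lambda>i. fst (u i)) (\<lambda>i. snd (v i))) \<partial>?MA) =
        of_bool (Z (snd (u j))) * (?h * a (\<lambda>i. fst (u i)))"
      by (subst nn_integral_cmult[OF borel_measurable_times_ennreal[OF m2 m1]]) (simp only: inner)
  qed
  also have "\<dots> = (\<integral>\<^sup>+g. \<integral>\<^sup>+z. of_bool (Z (z j)) * (?h * a g) \<partial>?Ss \<partial>?G)"
  proof -
    have fm: "(\<lambda>u i. fst (u i)) \<in> ?GS \<rightarrow>\<^sub>M ?G"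
      unfolding gaps_def by (rule measurable_PiM_single') (auto simp: space_PiM space_pair_measure)
    have "(\<lambda>u. of_bool (Z (snd (u j))) * (?h * a (\<lambda>i. fst (u i)))) \<in> borel_measurable ?GS"
    proof (intro borel_measurable_times_ennreal borel_measurable_const)
      show "(\<lambda>u. of_bool (Z (snd (u j))) :: ennreal) \<in> borel_measurable ?GS"
        by (rule measurable_compose[of "\<lambda>u. u j" _ "exponential_gap 1 \<Otimes>\<^sub>M ?S"], simp,
            rule measurable_compose[of snd _ ?S]) simp_all
      show "(\<lambda>u. a (\<lambda>i. fst (u i))) \<in> borel_measurable ?GS"
        by (rule measurable_compose[OF fm a_meas])
    qed
    from nn_integral_PiM_zip[OF E1 S, OF this] show ?thesis by (simp add: gaps_def)
  qed
  also have "\<dots> = (\<integral>\<^sup>+g. ?q * (?h * a g) \<partial>?G)"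
  proof (rule nn_integral_cong)
    fix g
    have "(\<lambda>z. of_bool (Z (z j)) :: ennreal) \<in> borel_measurable ?Ss"
      by (rule measurable_compose[of "\<lambda>z. z j" _ ?S]) simp_all
    from nn_integral_multc[OF this]
    show "(\<integral>\<^sup>+z. of_bool (Z (z j)) * (?h * a g) \<partial>?Ss) = ?q * (?h * a g)"
      by (simp only: comp_int)
  qed
  also have "\<dots> = ?q * (?h * (\<integral>\<^sup>+g. a g \<partial>?G))"
    by (simp add: nn_integral_cmult)
  also have "(\<integral>\<^sup>+g. a g \<partial>?G) = (\<integral>\<^sup>+w. ?al (\<lambda>i. fst (w i)) (\<lambda>i. snd (w i)) \<partial>iid (gap_age \<mu>))"
  proof -
    have "(\<lambda>w. ?al (\<lambda>i. fst (w i)) (\<lambda>i. snd (w i))) \<in> borel_measurable (iid (gap_age \<mu>))"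
      by (rule al) measurable
    from nn_integral_PiM_zip[OF E1 EM, folded gap_age_def, OF this] show ?thesis
      by (simp add: gaps_def a_def)
  qed
  finally show ?thesis .
qed

lemma AE_driver_space:
  assumes \<mu>: "\<mu> > 0"
  shows "AE w in driver_space \<mu> p s. \<forall>i. gap_of w i \<ge> 0 \<and> step_of w i \<in> set_pmf s"
proof -
  interpret E: prob_space "exponential_gap 1" by (rule prob_space_exponential_gap) simp
  interpret MA: prob_space "mark_age \<mu> p" by (rule prob_space_mark_age) fact
  interpret GS: prob_space "exponential_gap 1 \<Otimes>\<^sub>M measure_pmf s"
    by (intro prob_space_pair E.prob_space_axioms measure_pmf.prob_space_axioms)
  interpret P: pair_sigma_finite "exponential_gap 1" "measure_pmf s" ..
  let ?M = "(exponential_gap 1 \<Otimes>\<^sub>M measure_pmf s)"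
  have "AE x in ?M. fst x \<ge> 0 \<and> snd x \<in> set_pmf s"
  proof (rule P.AE_pair_measure)
    have [measurable]: "Measurable.pred ?M (\<lambda>x. snd x \<in> set_pmf s)"
      by (rule measurable_compose[OF measurable_snd]) simp
    show "{x \<in> space ?M. fst x \<ge> 0 \<and> snd x \<in> set_pmf s} \<in> sets ?M" by measurable
    show "AE x in exponential_gap 1. AE y in s. fst (x, y) \<ge> 0 \<and> snd (x, y) \<in> set_pmf s"
      using AE_exponential_gap_pos[of 1] by (auto simp: AE_measure_pmf_iff)
  qed
  then have "AE x in distr (?M \<Otimes>\<^sub>M mark_age \<mu> p) ?M fst. fst x \<ge> 0 \<and> snd x \<in> set_pmf s"
    by (simp only: MA.distr_pair_fst)
  then have "AE x in ?M \<Otimes>\<^sub>M mark_age \<mu> p. fst (fst x) \<ge> 0 \<and> snd (fst x) \<in> set_pmf s"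
    by (rule AE_distrD[rotated]) measurable
  then have "AE w in driver_space \<mu> p s. fst (fst (w i)) \<ge> 0 \<and> snd (fst (w i)) \<in> set_pmf s" for i
    unfolding driver_space_def
    by (intro AE_PiM_component) (auto intro: prob_space_driver1 \<mu>)
  then show ?thesis unfolding AE_all_countable by blast
qed

definition map_steps :: "('s \<Rightarrow> 't) \<Rightarrow> 's driver \<Rightarrow> 't driver" where
  "map_steps f w = (\<lambda>i. ((gap_of w i, f (step_of w i)), (mark_of w i, age_of w i)))"

lemma distr_map_steps:
  assumes \<mu>: "\<mu> > 0"
  shows "distr (driver_space \<mu> p s) (driver_space \<mu> p (map_pmf f s)) (map_steps f) = driver_space \<mu> p (map_pmf f s)"
    and "map_steps f \<in> driver_space \<mu> p s \<rightarrow>\<^sub>M driver_space \<mu> p (map_pmf f s)"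
proof -
  let ?E = "exponential_gap 1" and ?MA = "mark_age \<mu> p"
  let ?M = "(?E \<Otimes>\<^sub>M measure_pmf s) \<Otimes>\<^sub>M ?MA" and ?N = "(?E \<Otimes>\<^sub>M measure_pmf (map_pmf f s)) \<Otimes>\<^sub>M ?MA"
  let ?f = "\<lambda>x. ((fst (fst x), f (snd (fst x))), snd x)"
  interpret E: prob_space ?E by (rule prob_space_exponential_gap) simp
  interpret MA: prob_space ?MA by (rule prob_space_mark_age) fact
  interpret GS: prob_space "?E \<Otimes>\<^sub>M measure_pmf (map_pmf f s)"
    by (intro prob_space_pair E.prob_space_axioms measure_pmf.prob_space_axioms)
  have fm [measurable]: "f \<in> measure_pmf s \<rightarrow>\<^sub>M measure_pmf (map_pmf f s)" by simp
  have f: "?f \<in> ?M \<rightarrow>\<^sub>M ?N" by measurable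
  have sf: "distr (measure_pmf s) (measure_pmf (map_pmf f s)) f = measure_pmf (map_pmf f s)"
    unfolding map_pmf_rep_eq by (rule distr_cong) auto
  have 1: "?E \<Otimes>\<^sub>M measure_pmf (map_pmf f s) = distr (?E \<Otimes>\<^sub>M measure_pmf s) (?E \<Otimes>\<^sub>M measure_pmf (map_pmf f s)) (\<lambda>(x, y). (x, f y))"
    using pair_measure_distr[of "\<lambda>x. x" ?E ?E f "measure_pmf s" "measure_pmf (map_pmf f s)"]
    by (simp add: sf distr_id prob_space_imp_sigma_finite[OF measure_pmf.prob_space_axioms])
  have 2: "distr ?M ?N ?f = ?N"
    using pair_measure_distr[of "\<lambda>(x, y). (x, f y)" "?E \<Otimes>\<^sub>M measure_pmf s" "?E \<Otimes>\<^sub>M measure_pmf (map_pmf f s)" "\<lambda>x. x" ?MA ?MA]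
    using 1[unfolded split_beta', symmetric] by (simp add: distr_id MA.sigma_finite_measure_axioms split_beta')
  have eq: "map_steps f = (\<lambda>w i. ?f (w i))" by (simp add: map_steps_def fun_eq_iff)
  show "distr (driver_space \<mu> p s) (driver_space \<mu> p (map_pmf f s)) (map_steps f) = driver_space \<mu> p (map_pmf f s)"
    unfolding driver_space_def eq by (rule distr_PiM_map[OF prob_space_driver1[OF \<mu>] f 2])
  show "map_steps f \<in> driver_space \<mu> p s \<rightarrow>\<^sub>M driver_space \<mu> p (map_pmf f s)"
    unfolding driver_space_def eq
  proof (rule measurable_PiM_single')
    show "(\<lambda>w. ?f (w i)) \<in> iid ?M \<rightarrow>\<^sub>M ?N" for i :: nat
      by (rule measurable_compose[OF _ f]) simp
  qed (auto simp: space_PiM space_pair_measure PiE_iff mark_age_def)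
qed

definition move :: "'d::finite \<Rightarrow> nat \<Rightarrow> (int ^ 'd) driver \<Rightarrow> real" where
  "move c i w = (if passes_of w i then real_of_int (step_of w i $ c) else 0)"

lemma sum_move: "(\<Sum>i<n. move c i w) = real_of_int (pos_of w n $ c)"
  by (simp add: move_def pos_of_def passes_of_def pos_nth of_int_sum if_distrib cong: if_cong)

lemma measurable_move [measurable]: "move c i \<in> borel_measurable (driver_space \<mu> p s)"
proof -
  have [measurable]: "(\<lambda>w. real_of_int (step_of w i $ c)) \<in> borel_measurable (driver_space \<mu> p s)"
    by (rule measurable_compose[OF measurable_driver(2)]) simp
  show ?thesis unfolding move_def by measurable
qed

lemma unit_steps_nth: "z \<in> unit_steps \<Longrightarrow> \<bar>z $ c\<bar> \<le> 1"
  by (auto simp: unit_steps_def axis_def)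

lemma abs_move_le: "step_of w i \<in> unit_steps \<Longrightarrow> \<bar>move c i w\<bar> \<le> 1"
  using unit_steps_nth[of "step_of w i" c] by (auto simp: move_def simp flip: of_int_abs)

lemma move_comb_seq: "i < m \<Longrightarrow> move c i (comb_seq m w w') = move c i w"
proof -
  assume i: "i < m"
  have "passes_of (comb_seq m w w') i = passes_of w i"
    unfolding passes_of_def by (rule passes_cong) (use i in \<open>auto simp: comb_seq_less\<close>)
  then show ?thesis using i by (simp add: move_def comb_seq_less)
qed

text \<open>The first \<open>m\<close> entries of one sequence followed by an independent sequence
  have the law of the driver; \<open>F\<close> sees only the former and \<open>G\<close> only the
  latter. The bound 2 fits centred increments.\<close>

lemma integral_driver_split:
  fixes F G :: "'s driver \<Rightarrow> real"
  assumes \<mu>: "\<mu> > 0" and F: "F \<in> borel_measurable (driver_space \<mu> p s)" "G \<in> borel_measurable (driver_space \<mu> p s)"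
    and bound: "AE w in driver_space \<mu> p s. \<bar>F w\<bar> \<le> 2" "AE w in driver_space \<mu> p s. \<bar>G w\<bar> \<le> 2"
    and local: "\<And>w w'. F (comb_seq m w w') = F w"
  shows "integrable (driver_space \<mu> p s) (\<lambda>w. F w * G (\<lambda>i. w (i + m)))"
    and "(\<integral>w. F w * G (\<lambda>i. w (i + m)) \<partial>driver_space \<mu> p s) = (\<integral>w. F w \<partial>driver_space \<mu> p s) * (\<integral>w. G w \<partial>driver_space \<mu> p s)"
proof -
  let ?D = "driver_space \<mu> p s"
  interpret S: sequence_space "(exponential_gap 1 \<Otimes>\<^sub>M measure_pmf s) \<Otimes>\<^sub>M mark_age \<mu> p"
    by (rule sequence_spaceI) (rule prob_space_driver1[OF \<mu>])
  interpret D: prob_space ?D by (rule prob_space_driver_space) fact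
  interpret DD: pair_sigma_finite ?D ?D ..
  note [measurable] = F
  have iF: "integrable ?D F" and iG: "integrable ?D G"
    by (rule D.integrable_const_bound[where B=2], use bound in simp, measurable)+
  have comb: "(\<lambda>(w, w'). comb_seq m w w') \<in> ?D \<Otimes>\<^sub>M ?D \<rightarrow>\<^sub>M ?D"
    unfolding driver_space_def by (rule measurable_comb_seq)
  have shift: "(\<lambda>w i. w (i + m)) \<in> ?D \<rightarrow>\<^sub>M ?D"
    unfolding driver_space_def by (rule measurable_PiM_single') (auto simp: space_PiM PiE_iff)
  have meas: "(\<lambda>w. F w * G (\<lambda>i. w (i + m))) \<in> borel_measurable ?D"
    using measurable_compose[OF shift F(2)] by measurable
  have dist: "distr (?D \<Otimes>\<^sub>M ?D) ?D (\<lambda>(w, w'). comb_seq m w w') = ?D"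
    unfolding driver_space_def by (rule S.PiM_comb_seq)
  have eq: "(\<lambda>x. (\<lambda>w. F w * G (\<lambda>i. w (i + m))) ((\<lambda>(w, w'). comb_seq m w w') x)) = (\<lambda>x. F (fst x) * G (snd x))"
    by (auto simp: local comb_seq_add)
  have int: "integrable (?D \<Otimes>\<^sub>M ?D) (\<lambda>x. F (fst x) * G (snd x))"
  proof (rule DD.Fubini_integrable)
    show "integrable ?D (\<lambda>x. \<integral>y. norm (F (fst (x, y)) * G (snd (x, y))) \<partial>?D)"
      using iF by (simp add: abs_mult)
    show "AE x in ?D. integrable ?D (\<lambda>y. F (fst (x, y)) * G (snd (x, y)))" using iG by simp
  qed measurable
  show "integrable ?D (\<lambda>w. F w * G (\<lambda>i. w (i + m)))"
    using integrable_distr_eq[OF comb meas] int by (simp only: dist eq)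
  have "(\<integral>w. F w * G (\<lambda>i. w (i + m)) \<partial>?D) = (\<integral>x. F (fst x) * G (snd x) \<partial>(?D \<Otimes>\<^sub>M ?D))"
    using integral_distr[OF comb meas] by (simp only: dist eq)
  also have "\<dots> = (\<integral>x. \<integral>y. F x * G y \<partial>?D \<partial>?D)"
    using DD.integral_fst'[OF int] by simp
  also have "\<dots> = (\<integral>w. F w \<partial>?D) * (\<integral>w. G w \<partial>?D)" by simp
  finally show "(\<integral>w. F w * G (\<lambda>i. w (i + m)) \<partial>?D) = (\<integral>w. F w \<partial>?D) * (\<integral>w. G w \<partial>?D)" .
qed

lemma move_shift:
  assumes g: "\<And>i. gap_of w i \<ge> 0" and na: "\<not> alive_of w (k + m) (Suc k)"
  shows "move c (k + m) w = move c k (\<lambda>i. w (i + m))"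
  using passes_shift_alive[OF g, where k=k and m=m and A="age_of w" and z="step_of w" and B="mark_of w"] na
  by (simp add: move_def passes_of_def alive_of_def)

lemma prob_alive_le:
  assumes \<mu>: "\<mu> > 0" and b: "alive_bound \<mu> C r" and m: "m \<le> Suc i"
  shows "(\<integral>w. of_bool (alive_of w i m) \<partial>driver_space \<mu> p s) \<le> C * r ^ m"
proof -
  interpret D: prob_space "driver_space \<mu> p s" by (rule prob_space_driver_space) fact
  have "ennreal (\<integral>w. of_bool (alive_of w i m) \<partial>driver_space \<mu> p s) = (\<integral>\<^sup>+w. ennreal (of_bool (alive_of w i m)) \<partial>driver_space \<mu> p s)"
    by (rule nn_integral_eq_integral[symmetric]) (auto intro!: D.integrable_const_bound[where B=1])
  also have "\<dots> = (\<integral>\<^sup>+w. of_bool (alive_of w i m) \<partial>driver_space \<mu> p s)"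
    by (intro nn_integral_cong) simp
  also have "\<dots> \<le> ennreal (C * r ^ m)"
    using nn_integral_alive_indep[OF \<mu>, where Z="\<lambda>_. True" and j=0 and Q="\<lambda>_. True" and i=0 and k=i and m=m and p=p and s=s] b m
    by (simp add: alive_bound_def)
  finally show ?thesis using b by (simp add: alive_bound_def)
qed

lemma distr_pair_snd:
  assumes M: "prob_space M" and N: "prob_space N"
  shows "distr (M \<Otimes>\<^sub>M N) N snd = N"
proof (rule measure_eqI)
  interpret M: prob_space M by fact
  interpret N: prob_space N by fact
  fix A assume "A \<in> sets (distr (M \<Otimes>\<^sub>M N) N snd)"
  then have A: "A \<in> sets N" by simp
  then have "snd -` A \<inter> space (M \<Otimes>\<^sub>M N) = space M \<times> A"
    using sets.sets_into_space[OF A] by (auto simp: space_pair_measure)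
  then show "emeasure (distr (M \<Otimes>\<^sub>M N) N snd) A = emeasure N A"
    using A by (simp add: emeasure_distr N.emeasure_pair_measure_Times M.emeasure_space_1)
qed simp

abbreviation mean_pos :: "'d::finite \<Rightarrow> real \<Rightarrow> real \<Rightarrow> (int ^ 'd) pmf \<Rightarrow> nat \<Rightarrow> real" where
  "mean_pos c \<mu> p s n \<equiv> (\<integral>w. real_of_int (pos_of w n $ c) \<partial>driver_space \<mu> p s)"

lemma AE_abs_move_le:
  assumes "\<mu> > 0" "set_pmf s \<subseteq> unit_steps"
  shows "AE w in driver_space \<mu> p s. \<bar>move c i w\<bar> \<le> 1"
  using AE_driver_space[OF assms(1), where p=p and s=s]
  by eventually_elim (use assms(2) in \<open>auto intro!: abs_move_le\<close>)

lemma abs_move_diff_le: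
  assumes "set_pmf s \<subseteq> unit_steps" "\<forall>i. gap_of w i \<ge> 0 \<and> step_of w i \<in> set_pmf s"
  shows "\<bar>move c (k + m) w - move c k (\<lambda>i. w (i + m))\<bar> \<le> 2 * of_bool (alive_of w (k + m) (Suc k))"
proof (cases "alive_of w (k + m) (Suc k)")
  case True
  have "\<bar>move c (k + m) w\<bar> \<le> 1" "\<bar>move c k (\<lambda>i. w (i + m))\<bar> \<le> 1"
    using assms by (auto intro!: abs_move_le)
  then show ?thesis using True by simp
next
  case False
  then show ?thesis using move_shift[of w k m c] assms(2) by simp
qed

text \<open>The increments are neither stationary nor independent. But an increment agrees with that
  of the walk restarted \<open>k + 1\<close> rings earlier unless the reach is that long, which has
  probability at most \<open>C * r ^ Suc k\<close>. This makes the mean increments converge and the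
  correlations decay.\<close>

lemma pos_second_moment:
  fixes s :: "(int ^ 'd::finite) pmf"
  assumes \<mu>: "\<mu> > 0" and s: "set_pmf s \<subseteq> unit_steps"
  shows "\<exists>v C'. (\<forall>n. (\<integral>\<^sup>+w. ennreal ((real_of_int (pos_of w n $ c) - real n * v)\<^sup>2) \<partial>driver_space \<mu> p s) \<le> ennreal (C' * real n)) \<and>
    (\<lambda>i. \<integral>w. move c i w \<partial>driver_space \<mu> p s) \<longlonglongrightarrow> v"
proof -
  let ?D = "driver_space \<mu> p s"
  interpret D: prob_space ?D by (rule prob_space_driver_space) fact
  obtain C r where b: "alive_bound \<mu> C r" using alive_tail[OF \<mu>] by blast
  then have C: "C > 0" and r: "0 < r" "r < 1" by (auto simp: alive_bound_def)
  let ?y = "\<lambda>i. \<integral>w. move c i w \<partial>?D"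
  let ?sh = "\<lambda>m w i. w (i + m :: nat)"
  note m1 = AE_abs_move_le[OF \<mu> s, where p=p and c=c]
  have m2: "AE w in ?D. \<bar>move c i w\<bar> \<le> 2" for i
    using m1[of i] by eventually_elim simp
  have one: "AE w in ?D. \<bar>1 :: real\<bar> \<le> 2" by simp
  have int_move: "integrable ?D (move c i)" for i
    by (rule D.integrable_const_bound[where B=1]) (use m1 in auto)
  have int_shift: "integrable ?D (\<lambda>w. move c k (?sh m w))" "(\<integral>w. move c k (?sh m w) \<partial>?D) = ?y k" for k m
    using integral_driver_split[OF \<mu>, where F="\<lambda>_. 1" and G="move c k" and m=m and p=p and s=s, OF _ measurable_move one m2]
      D.prob_space by auto
  have shift_meas [measurable]: "(\<lambda>w. move c k (?sh m w)) \<in> borel_measurable ?D" for k m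
    using int_shift(1) by (rule borel_measurable_integrable)
  have diff: "AE w in ?D. \<bar>move c (k + m) w - move c k (?sh m w)\<bar> \<le> 2 * of_bool (alive_of w (k + m) (Suc k))" for k m
    using AE_driver_space[OF \<mu>, where p=p and s=s] by eventually_elim (rule abs_move_diff_le[OF s])
  have al_int: "integrable ?D (\<lambda>w. of_bool (alive_of w i m) :: real)" for i m
    by (rule D.integrable_const_bound[where B=1]) auto
  \<comment> \<open>The walk restarted at ring \<open>m\<close> has the same law as the walk itself,
    so \<open>k + m\<close> and \<open>k\<close> are compared on one driver.\<close>
  have ydiff: "\<bar>?y (k + m) - ?y k\<bar> \<le> 2 * C * r ^ Suc k" for k m
  proof -
    have "?y (k + m) - ?y k = (\<integral>w. move c (k + m) w - move c k (?sh m w) \<partial>?D)"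
      using int_move int_shift by simp
    also have "\<bar>\<dots>\<bar> \<le> (\<integral>w. \<bar>move c (k + m) w - move c k (?sh m w)\<bar> \<partial>?D)"
      by (rule integral_abs_bound)
    also have "\<dots> \<le> (\<integral>w. 2 * of_bool (alive_of w (k + m) (Suc k)) \<partial>?D)"
      by (rule integral_mono_AE) (use diff int_move int_shift al_int in auto)
    also have "\<dots> \<le> 2 * (C * r ^ Suc k)"
      using prob_alive_le[OF \<mu> b, where m="Suc k" and i="k + m" and p=p and s=s] by simp
    finally show ?thesis by simp
  qed
  have "Cauchy ?y"
  proof (rule metric_CauchyI)
    fix e :: real assume e: "e > 0"
    have "(\<lambda>k. 2 * C * r ^ Suc k) \<longlonglongrightarrow> 2 * C * 0"
      using r by (intro tendsto_intros LIMSEQ_Suc LIMSEQ_power_zero) auto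
    then have "\<forall>\<^sub>F k in sequentially. 2 * C * r ^ Suc k < e / 2"
      using e by (intro order_tendstoD(2)) auto
    then obtain k where k: "2 * C * r ^ Suc k < e / 2" by (auto simp: eventually_at_top_linorder)
    have "dist (?y m) (?y n) < e" if "m \<ge> k" "n \<ge> k" for m n
    proof -
      have "\<bar>?y m - ?y k\<bar> < e / 2" "\<bar>?y n - ?y k\<bar> < e / 2"
        using ydiff[of k "m - k"] ydiff[of k "n - k"] k that by simp_all
      then show ?thesis unfolding dist_real_def by linarith
    qed
    then show "\<exists>M. \<forall>m\<ge>M. \<forall>n\<ge>M. dist (?y m) (?y n) < e" by blast
  qed
  then obtain v where v: "?y \<longlonglongrightarrow> v" by (auto simp: Cauchy_convergent_iff convergent_def)
  have yv: "\<bar>?y k - v\<bar> \<le> 2 * C * r ^ Suc k" for k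
  proof -
    have "(\<lambda>m. \<bar>?y (k + m) - ?y k\<bar>) \<longlonglongrightarrow> \<bar>v - ?y k\<bar>"
      using LIMSEQ_ignore_initial_segment[OF v, of k] by (intro tendsto_intros) (simp add: add.commute)
    then have "\<bar>v - ?y k\<bar> \<le> 2 * C * r ^ Suc k"
      by (rule LIMSEQ_le_const2) (use ydiff in auto)
    then show ?thesis by simp
  qed
  have y1: "\<bar>?y k\<bar> \<le> 1" for k
  proof -
    have "\<bar>?y k\<bar> \<le> (\<integral>w. \<bar>move c k w\<bar> \<partial>?D)" by (rule integral_abs_bound)
    also have "\<dots> \<le> (\<integral>w. 1 \<partial>?D)"
      by (rule integral_mono_AE) (use m1[of k] int_move in auto)
    finally show ?thesis using D.prob_space by simp
  qed
  have v1: "\<bar>v\<bar> \<le> 1"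
    using tendsto_rabs[OF v] by (rule LIMSEQ_le_const2) (use y1 in auto)
  let ?E = "\<lambda>i w. move c i w - v"
  have E2: "AE w in ?D. \<bar>?E i w\<bar> \<le> 2" for i
    using m1[of i] by eventually_elim (use v1 in linarith)
  have E4: "AE w in ?D. \<bar>?E i w * ?E j w\<bar> \<le> 4" for i j
    using E2[of i] E2[of j]
  proof eventually_elim
    case (elim w)
    have "\<bar>?E i w\<bar> * \<bar>?E j w\<bar> \<le> 2 * 2" using elim by (intro mult_mono) auto
    then show ?case by (simp add: abs_mult)
  qed
  have intE: "integrable ?D (\<lambda>w. ?E i w * ?E j w)" for i j
    by (rule D.integrable_const_bound[where B=4]) (use E4 in auto)
  \<comment> \<open>The 4 covers the diagonal. Off it, \<open>4 * C\<close> comes from the mean of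
    the restarted increment, which is not exactly \<open>v\<close>, and \<open>4 * C\<close> from
    replacing the increment by the restarted one.\<close>
  have cov: "\<bar>\<integral>w. ?E i w * ?E j w \<partial>?D\<bar> \<le> (8 * C + 4) * r ^ (j - i)" if "i \<le> j" for i j
  proof (cases "i = j")
    case True
    have "\<bar>\<integral>w. ?E i w * ?E j w \<partial>?D\<bar> \<le> (\<integral>w. \<bar>?E i w * ?E j w\<bar> \<partial>?D)" by (rule integral_abs_bound)
    also have "\<dots> \<le> (\<integral>w. 4 \<partial>?D)"
      by (rule integral_mono_AE) (use E4 intE in auto)
    finally show ?thesis using True C D.prob_space by simp
  next
    case False
    \<comment> \<open>The increment \<open>i\<close> reads the entries up to \<open>i\<close>, so
      the walk is restarted at ring \<open>Suc i\<close>, where it is independent of that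
      increment.\<close>
    define k where "k = j - Suc i"
    have j: "j = k + Suc i" using that False by (simp add: k_def)
    let ?G = "\<lambda>w. ?E k (?sh (Suc i) w)"
    have local: "?E i (comb_seq (Suc i) w w') = ?E i w" for w w' by (simp add: move_comb_seq)
    have Em: "?E i \<in> borel_measurable ?D" for i by measurable
    have split: "integrable ?D (\<lambda>w. ?E i w * ?G w)"
      "(\<integral>w. ?E i w * ?G w \<partial>?D) = (\<integral>w. ?E i w \<partial>?D) * (\<integral>w. ?E k w \<partial>?D)"
      using integral_driver_split[OF \<mu> Em Em E2 E2 local] by auto
    have EE: "(\<integral>w. ?E i w \<partial>?D) = ?y i - v" for i using int_move D.prob_space by simp
    have main: "\<bar>\<integral>w. ?E i w * ?G w \<partial>?D\<bar> \<le> 2 * (2 * C * r ^ Suc k)"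
      unfolding split(2) EE abs_mult
    proof (rule mult_mono)
      show "\<bar>?y i - v\<bar> \<le> 2" using y1[of i] v1 by linarith
    qed (use yv[of k] in auto)
    have intd: "integrable ?D (\<lambda>w. ?E i w * ?E j w - ?E i w * ?G w)" using intE split(1) by simp
    have "\<bar>\<integral>w. ?E i w * ?E j w - ?E i w * ?G w \<partial>?D\<bar> \<le> (\<integral>w. \<bar>?E i w * ?E j w - ?E i w * ?G w\<bar> \<partial>?D)"
      by (rule integral_abs_bound)
    also have "\<dots> \<le> (\<integral>w. 4 * of_bool (alive_of w (k + Suc i) (Suc k)) \<partial>?D)"
    proof (rule integral_mono_AE)
      show "AE w in ?D. \<bar>?E i w * ?E j w - ?E i w * ?G w\<bar> \<le> 4 * of_bool (alive_of w (k + Suc i) (Suc k))"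
        using E2[of i] diff[of k "Suc i"]
      proof eventually_elim
        case (elim w)
        have "\<bar>?E i w * ?E j w - ?E i w * ?G w\<bar> = \<bar>?E i w\<bar> * \<bar>move c (k + Suc i) w - move c k (?sh (Suc i) w)\<bar>"
          unfolding j by (simp add: abs_mult[symmetric] algebra_simps)
        also have "\<dots> \<le> 2 * (2 * of_bool (alive_of w (k + Suc i) (Suc k)))"
          using elim by (intro mult_mono) auto
        finally show ?case by simp
      qed
    qed (use intd al_int in auto)
    also have "\<dots> \<le> 4 * (C * r ^ Suc k)"
      using prob_alive_le[OF \<mu> b, where m="Suc k" and i="k + Suc i" and p=p and s=s] by simp
    finally have rest: "\<bar>\<integral>w. ?E i w * ?E j w - ?E i w * ?G w \<partial>?D\<bar> \<le> 4 * (C * r ^ Suc k)" .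
    have "(\<integral>w. ?E i w * ?E j w \<partial>?D) = (\<integral>w. ?E i w * ?G w \<partial>?D) + (\<integral>w. ?E i w * ?E j w - ?E i w * ?G w \<partial>?D)"
      using intE split(1) by simp
    then have "\<bar>\<integral>w. ?E i w * ?E j w \<partial>?D\<bar> \<le> 2 * (2 * C * r ^ Suc k) + 4 * (C * r ^ Suc k)"
      using main rest by linarith
    also have "\<dots> \<le> (8 * C + 4) * r ^ Suc k" using r by (simp add: algebra_simps)
    also have "Suc k = j - i" using j by simp
    finally show ?thesis .
  qed
  have "(\<integral>\<^sup>+w. ennreal ((real_of_int (pos_of w n $ c) - real n * v)\<^sup>2) \<partial>?D) \<le> ennreal ((8 * C + 4) * 2 / (1 - r) * real n)" for n
  proof -
    have "real_of_int (pos_of w n $ c) - real n * v = (\<Sum>i<n. ?E i w)" for w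
      by (simp add: sum_subtractf sum_move)
    then show ?thesis
      using D.second_moment_sum_le[of ?E r "8 * C + 4" n] intE cov r C by simp
  qed
  then show ?thesis using v by blast
qed

text \<open>The square of a mean is at most the mean of the square, so the mean position is within
  order \<open>sqrt n\<close> of \<open>n * v\<close>.\<close>

lemma expectation_limit:
  fixes s :: "(int ^ 'd::finite) pmf"
  assumes \<mu>: "\<mu> > 0" and s: "set_pmf s \<subseteq> unit_steps"
    and bound: "\<And>n. (\<integral>\<^sup>+w. ennreal ((real_of_int (pos_of w n $ c) - real n * v)\<^sup>2) \<partial>driver_space \<mu> p s) \<le> ennreal (C * real n)"
  shows "(\<lambda>n. mean_pos c \<mu> p s n / real n) \<longlonglongrightarrow> v"
    and "integrable (driver_space \<mu> p s) (\<lambda>w. real_of_int (pos_of w n $ c))"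
proof -
  let ?D = "driver_space \<mu> p s"
  interpret D: prob_space ?D by (rule prob_space_driver_space) fact
  let ?X = "\<lambda>n w. real_of_int (pos_of w n $ c)"
  have AE_sum: "AE w in ?D. \<bar>?X n w\<bar> \<le> real n" for n
  proof -
    have "AE w in ?D. \<forall>i. \<bar>move c i w\<bar> \<le> 1"
      unfolding AE_all_countable using AE_abs_move_le[OF \<mu> s, where p=p and c=c] by auto
    then show ?thesis
    proof eventually_elim
      case (elim w)
      have "\<bar>?X n w\<bar> \<le> (\<Sum>i<n. \<bar>move c i w\<bar>)" unfolding sum_move[symmetric] by (rule sum_abs)
      also have "\<dots> \<le> (\<Sum>i<n. 1)" using elim by (intro sum_mono) auto
      finally show ?case by simp
    qed
  qed
  have X_meas [measurable]: "?X n \<in> borel_measurable ?D" for n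
    unfolding sum_move[symmetric] by measurable
  show iX: "integrable ?D (?X n)" for n
    by (rule D.integrable_const_bound[where B="real n"]) (use AE_sum in auto)
  have iX2: "integrable ?D (\<lambda>w. (?X n w - real n * v)\<^sup>2)" for n
  proof (rule D.integrable_const_bound[where B="(real n + real n * \<bar>v\<bar>)\<^sup>2"])
    show "AE w in ?D. norm ((?X n w - real n * v)\<^sup>2) \<le> (real n + real n * \<bar>v\<bar>)\<^sup>2"
      using AE_sum[of n]
    proof eventually_elim
      case (elim w)
      have "\<bar>?X n w - real n * v\<bar> \<le> \<bar>?X n w\<bar> + \<bar>real n * v\<bar>" by (rule abs_triangle_ineq4)
      then have "\<bar>?X n w - real n * v\<bar> \<le> real n + real n * \<bar>v\<bar>" using elim by (simp add: abs_mult)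
      then have "\<bar>?X n w - real n * v\<bar>\<^sup>2 \<le> (real n + real n * \<bar>v\<bar>)\<^sup>2" by (rule power_mono) simp
      then show ?case by simp
    qed
  qed measurable
  have "\<bar>D.expectation (?X n) / real n - v\<bar> \<le> sqrt (max C 0) / sqrt (real n)" if "n > 0" for n
  proof -
    let ?Z = "\<lambda>w. ?X n w - real n * v"
    have iZ: "integrable ?D ?Z" using iX by simp
    have "ennreal (D.expectation (\<lambda>w. (?Z w)\<^sup>2)) \<le> ennreal (C * real n)"
      using bound[of n] by (subst nn_integral_eq_integral[symmetric, OF iX2]) auto
    also have "\<dots> \<le> ennreal (max C 0 * real n)" by (intro ennreal_leI mult_right_mono) auto
    finally have "D.expectation (\<lambda>w. (?Z w)\<^sup>2) \<le> max C 0 * real n"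
      by (subst (asm) ennreal_le_iff) auto
    moreover have "(D.expectation ?Z)\<^sup>2 \<le> D.expectation (\<lambda>w. (?Z w)\<^sup>2)"
      using D.variance_positive[of ?Z] D.variance_eq[OF iZ iX2] by simp
    ultimately have "(D.expectation ?Z)\<^sup>2 \<le> max C 0 * real n" by linarith
    then have "\<bar>D.expectation ?Z\<bar> \<le> sqrt (max C 0 * real n)" by (rule real_le_rsqrt[of "\<bar>_\<bar>", simplified])
    moreover have "D.expectation ?Z = D.expectation (?X n) - real n * v"
      using iX D.prob_space by simp
    ultimately have "\<bar>D.expectation (?X n) - real n * v\<bar> / real n \<le> sqrt (max C 0 * real n) / real n"
      by (simp add: divide_right_mono)
    also have "sqrt (max C 0 * real n) / real n = sqrt (max C 0) / sqrt (real n)"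
      using that by (simp add: real_sqrt_mult field_simps)
    also have "\<bar>D.expectation (?X n) - real n * v\<bar> / real n = \<bar>D.expectation (?X n) / real n - v\<bar>"
      using that by (simp add: abs_if field_simps)
    finally show ?thesis .
  qed
  then have "\<forall>\<^sub>F n in sequentially. norm (D.expectation (?X n) / real n - v) \<le> sqrt (max C 0) / sqrt (real n)"
    by (intro eventually_mono[OF eventually_gt_at_top[of 0]]) simp
  moreover have "(\<lambda>n. sqrt (max C 0) / sqrt (real n)) \<longlonglongrightarrow> 0"
    by (rule real_tendsto_divide_at_top[OF tendsto_const filterlim_compose[OF sqrt_at_top filterlim_real_sequentially]])
  ultimately have "(\<lambda>n. D.expectation (?X n) / real n - v) \<longlonglongrightarrow> 0"
    by (rule Lim_null_comparison)
  then show "(\<lambda>n. D.expectation (?X n) / real n) \<longlonglongrightarrow> v" by (simp add: LIM_zero_iff)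
qed

section \<open>Vanishing of the transverse drift\<close>

definition reflect :: "'d::finite \<Rightarrow> int ^ 'd \<Rightarrow> int ^ 'd" where
  "reflect c x = (\<chi> i. if i = c then - x $ i else x $ i)"

lemma reflect_reflect: "reflect c (reflect c x) = x"
  by (simp add: reflect_def vec_eq_iff)

lemma inj_reflect: "inj (reflect c)"
  by (metis injI reflect_reflect)

lemma reflect_axis: "reflect c (axis i a) = (if i = c then axis i (- a) else axis i a)"
  by (auto simp: reflect_def axis_def vec_eq_iff)

lemma reflect_unit_steps: "reflect c z \<in> unit_steps \<longleftrightarrow> z \<in> unit_steps"
proof -
  have "reflect c z \<in> unit_steps" if "z \<in> unit_steps" for z
    using that unfolding unit_steps_def by (force simp: reflect_axis)
  then show ?thesis by (metis reflect_reflect)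
qed

lemma map_reflect_step_pmf:
  assumes "c \<noteq> k"
  shows "map_pmf (reflect c) (step_pmf k l) = step_pmf k l"
proof (rule pmf_eqI)
  fix x
  have ax: "reflect c x = axis k a \<longleftrightarrow> x = axis k a" for a
    using assms by (metis reflect_axis reflect_reflect)
  have "pmf (map_pmf (reflect c) (step_pmf k l)) x = pmf (map_pmf (reflect c) (step_pmf k l)) (reflect c (reflect c x))"
    by (simp add: reflect_reflect)
  also have "\<dots> = pmf (step_pmf k l) (reflect c x)" by (rule pmf_map_inj'[OF inj_reflect])
  also have "\<dots> = pmf (step_pmf k l) x"
    by (simp add: pmf_step_pmf step_prob_def ax reflect_unit_steps)
  finally show "pmf (map_pmf (reflect c) (step_pmf k l)) x = pmf (step_pmf k l) x" .
qed

lemma passes_of_map_reflect: "passes_of (map_steps (reflect c) w) n = passes_of w n"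
  using passes_additive(1)[of "reflect c" "step_of w" "gap_of w" "age_of w" "mark_of w" n, OF inj_reflect]
  by (simp add: passes_of_def map_steps_def reflect_def vec_eq_iff)

text \<open>Reflecting a transverse coordinate preserves the law of the steps and the outcomes.\<close>

lemma expectation_move_transverse:
  assumes \<mu>: "\<mu> > 0" and c: "c \<noteq> k"
  shows "(\<integral>w. move c i w \<partial>driver_space \<mu> p (step_pmf k l)) = 0"
proof -
  let ?D = "driver_space \<mu> p (step_pmf k l)"
  note D = distr_map_steps[OF \<mu>, where p=p and s="step_pmf k l" and f="reflect c", unfolded map_reflect_step_pmf[OF c]]
  have neg: "move c i (map_steps (reflect c) w) = - move c i w" for w
    unfolding move_def passes_of_map_reflect by (simp add: map_steps_def reflect_def)
  have "(\<integral>w. move c i w \<partial>?D) = (\<integral>w. move c i w \<partial>distr ?D ?D (map_steps (reflect c)))"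
    by (simp only: D(1))
  also have "\<dots> = (\<integral>w. move c i (map_steps (reflect c) w) \<partial>?D)"
    by (rule integral_distr[OF D(2) measurable_move])
  also have "\<dots> = - (\<integral>w. move c i w \<partial>?D)" by (simp only: neg) simp
  finally show ?thesis by simp
qed

section \<open>Transfer to the walk in continuous time\<close>

lemma distr_sample_walker:
  fixes k :: "'d::finite"
  assumes "\<mu> > 0"
  shows "distr (sample_space k \<mu> p l) (walker_space k l) snd = walker_space k l"
  unfolding sample_space_def walker_space_def
  by (intro distr_pair_snd prob_space_PiM prob_space_edge_space prob_space_pair prob_space_exponential_gap
      measure_pmf.prob_space_axioms assms) simp

text \<open>A coordinate changes by at most 1 per ring, so adding \<open>n\<close> makes it
  nondecreasing and shifts the limit by 1; then \<open>strong_law_mono\<close> applies.\<close>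

lemma skeleton_law_of_large_numbers:
  fixes k :: "'d::finite"
  assumes \<mu>: "\<mu> > 0"
    and bound: "\<And>n. (\<integral>\<^sup>+w. ennreal ((real_of_int (pos_of w n $ c) - real n * v)\<^sup>2) \<partial>driver_space \<mu> p (step_pmf k l)) \<le> ennreal (C * real n)"
  shows "AE w in sample_space k \<mu> p l. (\<lambda>n. real_of_int (skeleton w n $ c) / real n) \<longlonglongrightarrow> v"
proof -
  let ?M = "sample_space k \<mu> p l"
  interpret prob_space ?M by (rule prob_space_sample_space) fact
  have unit: "AE w in ?M. \<forall>i. snd (snd w i) \<in> unit_steps"
  proof -
    have "AE v in distr ?M (walker_space k l) snd. \<forall>i. fst (v i) > 0 \<and> snd (v i) \<in> unit_steps"
      unfolding distr_sample_walker[OF \<mu>] by (rule AE_walker_space)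
    then have "AE w in ?M. \<forall>i. fst (snd w i) > 0 \<and> snd (snd w i) \<in> unit_steps"
      by (rule AE_distrD[rotated]) (simp add: sample_space_def)
    then show ?thesis by eventually_elim auto
  qed
  have sk_meas [measurable]: "(\<lambda>w. real_of_int (skeleton w n $ c)) \<in> borel_measurable ?M" for n
    by (rule measurable_compose[OF measurable_skeleton]) simp
  have "AE w in ?M. (\<lambda>n. (real_of_int (skeleton w n $ c) + real n) / real n) \<longlonglongrightarrow> v + 1"
  proof (rule strong_law_mono)
    show "AE w in ?M. incseq (\<lambda>n. real_of_int (skeleton w n $ c) + real n)"
      using unit
    proof eventually_elim
      case (elim w)
      show ?case
      proof (rule incseq_SucI)
        fix n
        have "real_of_int \<bar>snd (snd w n) $ c\<bar> \<le> 1" using unit_steps_nth[of "snd (snd w n)" c] elim by simp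
        then show "real_of_int (skeleton w n $ c) + real n \<le> real_of_int (skeleton w (Suc n) $ c) + real (Suc n)"
          by (auto simp: Let_def)
      qed
    qed
    fix n
    have "(\<integral>\<^sup>+w. ennreal ((real_of_int (skeleton w n $ c) + real n - real n * (v + 1))\<^sup>2) \<partial>?M) =
        (\<integral>\<^sup>+w. (\<lambda>x. ennreal ((real_of_int (x $ c) - real n * v)\<^sup>2)) (skeleton w n) \<partial>?M)"
      by (simp add: algebra_simps)
    also have "\<dots> = (\<integral>\<^sup>+w. ennreal ((real_of_int (pos_of w n $ c) - real n * v)\<^sup>2) \<partial>driver_space \<mu> p (step_pmf k l))"
      by (rule nn_integral_skeleton[OF \<mu>])
    also have "\<dots> \<le> ennreal (C * real n)" by (rule bound)
    finally show "(\<integral>\<^sup>+w. ennreal ((real_of_int (skeleton w n $ c) + real n - real n * (v + 1))\<^sup>2) \<partial>?M) \<le> ennreal (C * real n)" .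
  qed measurable
  then show ?thesis
  proof eventually_elim
    case (elim w)
    have "(\<lambda>n. (real_of_int (skeleton w n $ c) + real n) / real n - 1) \<longlonglongrightarrow> v + 1 - 1"
      by (intro tendsto_intros elim)
    then have "(\<lambda>n. (real_of_int (skeleton w n $ c) + real n) / real n - 1) \<longlonglongrightarrow> v" by simp
    then show ?case
      by (rule Lim_transform_eventually)
         (use eventually_gt_at_top[of 0] in eventually_elim, simp add: field_simps)
  qed
qed

lemma AE_walker_gaps:
  assumes \<mu>: "\<mu> > 0"
  shows "AE w in sample_space k \<mu> p l. regular_gaps (walker_gaps w) \<and> (\<lambda>n. sum (walker_gaps w) {..<n} / real n) \<longlonglongrightarrow> 1"
proof -
  let ?E = "exponential_gap 1" and ?S = "measure_pmf (step_pmf k l)"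
  have E: "prob_space ?E" by (rule prob_space_exponential_gap) simp
  have ES: "prob_space (?E \<Otimes>\<^sub>M ?S)" by (intro prob_space_pair E measure_pmf.prob_space_axioms)
  have fst: "distr (?E \<Otimes>\<^sub>M ?S) ?E fst = ?E"
    by (rule prob_space.distr_pair_fst[OF measure_pmf.prob_space_axioms])
  have d: "distr (walker_space k l) (gaps 1) (\<lambda>v i. fst (v i)) = gaps 1"
    unfolding gaps_def walker_space_def by (rule distr_PiM_map[OF ES _ fst]) simp
  have m: "(\<lambda>v i. fst (v i)) \<in> walker_space k l \<rightarrow>\<^sub>M gaps 1"
    unfolding gaps_def walker_space_def by (rule measurable_PiM_single') (auto simp: space_PiM space_pair_measure)
  have "AE g in gaps 1. regular_gaps g \<and> (\<lambda>n. sum g {..<n} / real n) \<longlonglongrightarrow> 1"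
    using AE_regular_gaps[of 1] gaps_law_of_large_numbers[of 1] by simp
  then have "AE v in walker_space k l. regular_gaps (\<lambda>i. fst (v i)) \<and> (\<lambda>n. sum (\<lambda>i. fst (v i)) {..<n} / real n) \<longlonglongrightarrow> 1"
    by (subst (asm) d[symmetric]) (rule AE_distrD[OF m])
  then have "AE v in distr (sample_space k \<mu> p l) (walker_space k l) snd. regular_gaps (\<lambda>i. fst (v i)) \<and> (\<lambda>n. sum (\<lambda>i. fst (v i)) {..<n} / real n) \<longlonglongrightarrow> 1"
    by (simp only: distr_sample_walker[OF \<mu>])
  then have "AE w in sample_space k \<mu> p l. regular_gaps (\<lambda>i. fst (snd w i)) \<and> (\<lambda>n. sum (\<lambda>i. fst (snd w i)) {..<n} / real n) \<longlonglongrightarrow> 1"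
    by (rule AE_distrD[rotated]) (simp add: sample_space_def)
  then show ?thesis by (simp add: walker_gaps_def[abs_def])
qed

text \<open>Renewal argument: time \<open>t\<close> lies between the sums of the first
  \<open>N\<close> and \<open>N + 1\<close> gaps, where \<open>N\<close> is the number of rings up
  to \<open>t\<close>.\<close>

lemma rings_until_asymptotics:
  assumes g: "regular_gaps g" and lim: "(\<lambda>n. sum g {..<n} / real n) \<longlonglongrightarrow> 1"
  shows "filterlim (rings_until g) at_top at_top" "((\<lambda>t. real (rings_until g t) / t) \<longlongrightarrow> 1) at_top"
proof -
  let ?N = "rings_until g"
  show N: "filterlim ?N at_top at_top"
    unfolding filterlim_at_top
  proof
    fix Z
    show "\<forall>\<^sub>F t in at_top. Z \<le> ?N t"
      using eventually_ge_at_top[of "ring_time g Z"]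
      by eventually_elim (use rings_until_le_iff[OF g, of Z] in \<open>auto intro: less_imp_le\<close>)
  qed
  have le: "sum g {..<?N t} \<le> t" if "?N t > 0" for t
    using rings_until_le_iff[OF g, of "?N t - 1" t] that by (simp add: ring_time_lessThan)
  have gt: "t < sum g {..<Suc (?N t)}" for t
    using rings_until_le_iff[OF g, of "?N t" t] by (simp add: ring_time_lessThan)
  have l1: "((\<lambda>t. sum g {..<?N t} / real (?N t)) \<longlongrightarrow> 1) at_top"
    by (rule filterlim_compose[OF lim N])
  have l2: "((\<lambda>t. sum g {..<Suc (?N t)} / real (Suc (?N t))) \<longlongrightarrow> 1) at_top"
    by (rule filterlim_compose[OF lim filterlim_compose[OF filterlim_Suc N]])
  have l3: "((\<lambda>t. real (Suc (?N t)) / real (?N t)) \<longlongrightarrow> 1) at_top"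
    by (rule filterlim_compose[OF LIMSEQ_Suc_n_over_n N])
  have l4: "((\<lambda>t. sum g {..<Suc (?N t)} / real (Suc (?N t)) * (real (Suc (?N t)) / real (?N t))) \<longlongrightarrow> 1 * 1) at_top"
    by (intro tendsto_mult l2 l3)
  have "((\<lambda>t. t / real (?N t)) \<longlongrightarrow> 1) at_top"
  proof (rule tendsto_sandwich[OF _ _ l1 l4[unfolded mult_1_left]])
    have ev: "\<forall>\<^sub>F t in at_top. ?N t > 0"
      using N[unfolded filterlim_at_top, rule_format, of 1] by eventually_elim simp
    show "\<forall>\<^sub>F t in at_top. sum g {..<?N t} / real (?N t) \<le> t / real (?N t)"
      using ev by eventually_elim (auto intro!: divide_right_mono le)
    show "\<forall>\<^sub>F t in at_top. t / real (?N t) \<le> sum g {..<Suc (?N t)} / real (Suc (?N t)) * (real (Suc (?N t)) / real (?N t))"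
      using ev
    proof eventually_elim
      case (elim t)
      have "t / real (?N t) \<le> sum g {..<Suc (?N t)} / real (?N t)"
        by (intro divide_right_mono less_imp_le[OF gt]) simp
      then show ?case by (simp del: of_nat_Suc sum.lessThan_Suc)
    qed
  qed
  from tendsto_inverse[OF this] show "((\<lambda>t. real (?N t) / t) \<longlongrightarrow> 1) at_top" by simp
qed

text \<open>Rings occur at rate 1, so the change of time does not alter the limit. Identifying the
  speed with a limit of means allows speeds to be compared in expectation.\<close>

lemma has_speed_limit:
  fixes k :: "'d::finite"
  assumes \<mu>: "\<mu> > 0"
  shows "\<exists>v. has_speed k \<mu> p l v \<and>
    (\<lambda>n. mean_pos k \<mu> p (step_pmf k l) n / real n) \<longlonglongrightarrow> v"
proof -
  let ?D = "driver_space \<mu> p (step_pmf k l)" and ?M = "sample_space k \<mu> p l"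
  have "\<exists>v C. (\<forall>n. (\<integral>\<^sup>+w. ennreal ((real_of_int (pos_of w n $ c) - real n * v)\<^sup>2) \<partial>?D) \<le> ennreal (C * real n)) \<and>
    (\<lambda>i. \<integral>w. move c i w \<partial>?D) \<longlonglongrightarrow> v" for c
    by (rule pos_second_moment[OF \<mu> set_step_pmf])
  then obtain v C where bound: "\<And>c n. (\<integral>\<^sup>+w. ennreal ((real_of_int (pos_of w n $ c) - real n * v c)\<^sup>2) \<partial>?D) \<le> ennreal (C c * real n)"
    and lim: "\<And>c. (\<lambda>i. \<integral>w. move c i w \<partial>?D) \<longlonglongrightarrow> v c" by metis
  have v0: "v c = 0" if "c \<noteq> k" for c
    using lim[of c] LIMSEQ_unique[of "\<lambda>_. 0" 0 "v c"] by (simp add: expectation_move_transverse[OF \<mu> that])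
  have "AE w in ?M. \<forall>c\<in>UNIV. (\<lambda>n. real_of_int (skeleton w n $ c) / real n) \<longlonglongrightarrow> v c"
    by (intro AE_finite_allI skeleton_law_of_large_numbers[OF \<mu> bound]) simp
  then have "AE w in ?M. ((\<lambda>t. (\<chi> i. real_of_int (walk w t $ i) / t) :: real ^ 'd) \<longlongrightarrow> axis k (v k)) at_top"
    using AE_walker_gaps[OF \<mu>, of k p l]
  proof eventually_elim
    case (elim w)
    let ?N = "rings_until (walker_gaps w)"
    have N: "filterlim ?N at_top at_top" "((\<lambda>t. real (?N t) / t) \<longlongrightarrow> 1) at_top"
      using rings_until_asymptotics[of "walker_gaps w"] elim(2) by auto
    show ?case
    proof (rule vec_tendstoI)
      fix c
      have "((\<lambda>t. real_of_int (skeleton w (?N t) $ c) / real (?N t) * (real (?N t) / t)) \<longlongrightarrow> v c * 1) at_top"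
        by (intro tendsto_mult N(2) filterlim_compose[OF _ N(1)]) (use elim(1) in auto)
      moreover have "\<forall>\<^sub>F t in at_top. real_of_int (skeleton w (?N t) $ c) / real (?N t) * (real (?N t) / t) = real_of_int (walk w t $ c) / t"
        using N(1)[unfolded filterlim_at_top, rule_format, of 1] by eventually_elim (simp add: walk_def)
      ultimately have "((\<lambda>t. real_of_int (walk w t $ c) / t) \<longlongrightarrow> v c) at_top"
        by (simp add: Lim_transform_eventually)
      moreover have "axis k (v k) $ c = v c" using v0 by (auto simp: axis_def)
      ultimately show "((\<lambda>t. (\<chi> i. real_of_int (walk w t $ i) / t) $ c) \<longlongrightarrow> axis k (v k) $ c) at_top"
        by simp
    qed
  qed
  then have "has_speed k \<mu> p l (v k)" by (simp add: has_speed_def)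
  then show ?thesis
    using expectation_limit(1)[OF \<mu> set_step_pmf bound, of k] by blast
qed

section \<open>Monotonicity in the bias\<close>

text \<open>A maximum is at least the arithmetic mean, so \<open>r ^ max d m\<close> is at most
  \<open>sqrt r ^ d * sqrt r ^ m\<close>, and the double sum is dominated by a product of two
  geometric series.\<close>

lemma sum_power_max_le:
  fixes r :: real
  assumes r: "0 < r" "r < 1"
  shows "(\<Sum>i\<in>{j..<n}. \<Sum>m\<le>i. r ^ max (i - j) m) \<le> 1 / (1 - sqrt r) ^ 2"
proof -
  define s where "s = sqrt r"
  have s: "0 \<le> s" "s < 1" "r = s ^ 2" using r by (auto simp: s_def)
  have "r ^ max d m \<le> s ^ d * s ^ m" for d m :: nat
  proof -
    have "r ^ max d m = s ^ (2 * max d m)" by (simp add: s(3) power_mult)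
    also have "\<dots> \<le> s ^ (d + m)" using s by (intro power_decreasing) auto
    finally show ?thesis by (simp add: power_add)
  qed
  then have "(\<Sum>i\<in>{j..<n}. \<Sum>m\<le>i. r ^ max (i - j) m) \<le> (\<Sum>i\<in>{j..<n}. \<Sum>m\<le>i. s ^ (i - j) * s ^ m)"
    by (intro sum_mono)
  also have "\<dots> = (\<Sum>i\<in>{j..<n}. s ^ (i - j) * (\<Sum>m<Suc i. s ^ m))"
    by (simp add: sum_distrib_left lessThan_Suc_atMost)
  also have "\<dots> \<le> (\<Sum>i\<in>{j..<n}. s ^ (i - j) * (1 / (1 - s)))"
    using s by (intro sum_mono mult_left_mono sum_geometric_le) auto
  also have "\<dots> = (\<Sum>i\<in>{j..<n}. s ^ (i - j)) * (1 / (1 - s))"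
    by (rule sum_distrib_right[symmetric])
  also have "(\<Sum>i\<in>{j..<n}. s ^ (i - j)) = (\<Sum>i<n - j. s ^ i)"
    by (simp add: sum.atLeastLessThan_shift_0[of _ j n] lessThan_atLeast0)
  also have "\<dots> * (1 / (1 - s)) \<le> 1 / (1 - s) * (1 / (1 - s))"
    using s by (intro mult_right_mono sum_geometric_le) auto
  finally show ?thesis by (simp add: s_def power2_eq_square)
qed

text \<open>Each term of \<open>err\<close> pairs a reach with a mark \<open>False\<close>. Both are
  independent of whether the proposals differ at \<open>j\<close>, so every term carries the factors
  \<open>q\<close> and \<open>1 - p\<close>.\<close>

lemma expectation_err_le:
  fixes s :: "('a \<times> 'a) pmf"
  assumes \<mu>: "\<mu> > 0" and b: "alive_bound \<mu> C r" and p: "0 \<le> p" "p \<le> 1"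
  defines "q \<equiv> measure_pmf.prob s {x. fst x \<noteq> snd x}"
  shows "integrable (driver_space \<mu> p s) (\<lambda>w. of_bool (fst (step_of w j) \<noteq> snd (step_of w j)) * err (gap_of w) (age_of w) (mark_of w) n j)"
    and "(\<integral>w. of_bool (fst (step_of w j) \<noteq> snd (step_of w j)) * err (gap_of w) (age_of w) (mark_of w) n j \<partial>driver_space \<mu> p s)
      \<le> q * ((1 - p) * (C / (1 - sqrt r) ^ 2))"
proof -
  let ?D = "driver_space \<mu> p s"
  interpret D: prob_space ?D by (rule prob_space_driver_space) fact
  have C: "C > 0" and r: "0 < r" "r < 1" using b by (auto simp: alive_bound_def)
  let ?Z = "\<lambda>x :: 'a \<times> 'a. fst x \<noteq> snd x"
  let ?f = "\<lambda>i m w. of_bool (?Z (step_of w j) \<and> \<not> mark_of w (i - m) \<and> alive_of w i (max (i - j) m)) :: real"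
  have [measurable]: "Measurable.pred ?D (\<lambda>w. ?Z (step_of w j))"
    by (rule measurable_compose[OF measurable_driver(2)]) simp
  have intf: "integrable ?D (?f i m)" for i m
    by (rule D.integrable_const_bound[where B=1]) auto
  have Ef: "(\<integral>w. ?f i m w \<partial>?D) \<le> q * ((1 - p) * (C * r ^ max (i - j) m))" if "m \<le> i" for i m
  proof -
    have "ennreal (\<integral>w. ?f i m w \<partial>?D) = (\<integral>\<^sup>+w. ennreal (?f i m w) \<partial>?D)"
      by (rule nn_integral_eq_integral[symmetric, OF intf]) simp
    also have "\<dots> = (\<integral>\<^sup>+w. of_bool (?Z (step_of w j)) * (of_bool (\<not> mark_of w (i - m)) * of_bool (alive_of w i (max (i - j) m))) \<partial>?D)"
      by (intro nn_integral_cong) simp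
    also have "\<dots> = emeasure (measure_pmf s) {x. ?Z x} * (emeasure (measure_pmf (bernoulli_pmf p)) {b. \<not> b} *
      (\<integral>\<^sup>+w. of_bool (alive (\<lambda>i. fst (w i)) (\<lambda>i. snd (w i)) 0 i (max (i - j) m)) \<partial>iid (gap_age \<mu>)))"
      by (rule nn_integral_alive_indep[OF \<mu>])
    also have "{b. \<not> b} = {False}" by auto
    also have "emeasure (measure_pmf (bernoulli_pmf p)) {False} = ennreal (1 - p)"
      using p by (simp add: emeasure_pmf_single)
    also have "emeasure (measure_pmf s) {x. ?Z x} = ennreal q"
      by (simp add: q_def measure_pmf.emeasure_eq_measure)
    also have "ennreal q * (ennreal (1 - p) *
      (\<integral>\<^sup>+w. of_bool (alive (\<lambda>i. fst (w i)) (\<lambda>i. snd (w i)) 0 i (max (i - j) m)) \<partial>iid (gap_age \<mu>)))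
      \<le> ennreal q * (ennreal (1 - p) * ennreal (C * r ^ max (i - j) m))"
      using b that by (intro mult_left_mono) (auto simp: alive_bound_def)
    also have "\<dots> = ennreal (q * ((1 - p) * (C * r ^ max (i - j) m)))"
      using p C r by (simp add: ennreal_mult[symmetric] q_def)
    finally show ?thesis
      using p C r by (subst (asm) ennreal_le_iff) (auto simp: q_def)
  qed
  have eq: "of_bool (?Z (step_of w j)) * err (gap_of w) (age_of w) (mark_of w) n j = (\<Sum>i\<in>{j..<n}. \<Sum>m\<le>i. ?f i m w)" for w
    unfolding err_def sum_distrib_left alive_of_def by (intro sum.cong) auto
  show "integrable ?D (\<lambda>w. of_bool (?Z (step_of w j)) * err (gap_of w) (age_of w) (mark_of w) n j)"
    unfolding eq by (intro Bochner_Integration.integrable_sum intf)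
  have "(\<integral>w. of_bool (?Z (step_of w j)) * err (gap_of w) (age_of w) (mark_of w) n j \<partial>?D) = (\<Sum>i\<in>{j..<n}. \<Sum>m\<le>i. \<integral>w. ?f i m w \<partial>?D)"
    unfolding eq
    by (simp only: Bochner_Integration.integral_sum[OF Bochner_Integration.integrable_sum[OF intf]]
        Bochner_Integration.integral_sum[OF intf])
  also have "\<dots> \<le> (\<Sum>i\<in>{j..<n}. \<Sum>m\<le>i. q * ((1 - p) * (C * r ^ max (i - j) m)))"
    by (intro sum_mono Ef) auto
  also have "\<dots> = q * ((1 - p) * (C * (\<Sum>i\<in>{j..<n}. \<Sum>m\<le>i. r ^ max (i - j) m)))"
    by (simp add: sum_distrib_left)
  also have "\<dots> \<le> q * ((1 - p) * (C * (1 / (1 - sqrt r) ^ 2)))"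
    using p C by (intro mult_left_mono sum_power_max_le r) (auto simp: q_def)
  finally show "(\<integral>w. of_bool (?Z (step_of w j)) * err (gap_of w) (age_of w) (mark_of w) n j \<partial>?D) \<le> q * ((1 - p) * (C / (1 - sqrt r) ^ 2))"
    by simp
qed

lemma pos_of_map_steps:
  "pos_of (map_steps f w) n = pos (\<lambda>i. f (step_of w i)) (passes (\<lambda>i. f (step_of w i)) (gap_of w) (age_of w) (mark_of w)) n"
  by (simp add: pos_of_def map_steps_def)

lemma integral_pos_of_map:
  assumes \<mu>: "\<mu> > 0" and i: "integrable (driver_space \<mu> p (map_pmf f s)) (\<lambda>w. real_of_int (pos_of w n $ k))"
  shows "integrable (driver_space \<mu> p s) (\<lambda>w. real_of_int (pos_of (map_steps f w) n $ k))"
    and "(\<integral>w. real_of_int (pos_of (map_steps f w) n $ k) \<partial>driver_space \<mu> p s) = mean_pos k \<mu> p (map_pmf f s) n"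
proof -
  note D = distr_map_steps[OF \<mu>, where p=p and s=s and f=f]
  have m: "(\<lambda>w. real_of_int (pos_of w n $ k)) \<in> borel_measurable (driver_space \<mu> p (map_pmf f s))"
    using i by (rule borel_measurable_integrable)
  show "integrable (driver_space \<mu> p s) (\<lambda>w. real_of_int (pos_of (map_steps f w) n $ k))"
    using integrable_distr_eq[OF D(2) m] i by (simp only: D(1))
  show "(\<integral>w. real_of_int (pos_of (map_steps f w) n $ k) \<partial>driver_space \<mu> p s) = mean_pos k \<mu> p (map_pmf f s) n"
    using integral_distr[OF D(2) m] by (simp only: D(1))
qed

text \<open>Each ring has expected gain \<open>q\<close> and an expected error bounded by a multiple
  of \<open>q * (1 - p)\<close>, so \<open>q\<close> factors out of the balance.\<close>

lemma expectation_pos_coupling: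
  fixes s :: "((int ^ 'd::finite) \<times> (int ^ 'd)) pmf"
  assumes \<mu>: "\<mu> > 0" and b: "alive_bound \<mu> C r" and p: "0 \<le> p" "p \<le> 1"
    and s: "set_pmf s \<subseteq> unit_steps \<times> unit_steps"
    and up: "\<And>x. x \<in> set_pmf s \<Longrightarrow> fst x \<noteq> snd x \<Longrightarrow> snd x $ k - fst x $ k \<ge> 1"
    and int: "\<And>n. integrable (driver_space \<mu> p (map_pmf fst s)) (\<lambda>w. real_of_int (pos_of w n $ k))"
      "\<And>n. integrable (driver_space \<mu> p (map_pmf snd s)) (\<lambda>w. real_of_int (pos_of w n $ k))"
  defines "q \<equiv> measure_pmf.prob s {x. fst x \<noteq> snd x}"
  shows "mean_pos k \<mu> p (map_pmf snd s) n -
      mean_pos k \<mu> p (map_pmf fst s) n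
    \<ge> real n * (q * (1 - 2 * ((1 - p) * (C / (1 - sqrt r) ^ 2))))"
proof -
  let ?D = "driver_space \<mu> p s"
  interpret D: prob_space ?D by (rule prob_space_driver_space) fact
  let ?Z = "\<lambda>x :: (int ^ 'd) \<times> (int ^ 'd). fst x \<noteq> snd x"
  let ?ne = "\<lambda>j w. of_bool (?Z (step_of w j)) :: real"
  let ?err = "\<lambda>j w. ?ne j w * err (gap_of w) (age_of w) (mark_of w) n j"
  let ?X = "\<lambda>w. real_of_int (pos_of (map_steps snd w) n $ k) - real_of_int (pos_of (map_steps fst w) n $ k)"
  note e = expectation_err_le[OF \<mu> b p, of s, folded q_def]
  have [measurable]: "Measurable.pred ?D (\<lambda>w. ?Z (step_of w j))" for j
    by (rule measurable_compose[OF measurable_driver(2)]) simp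
  have ine: "integrable ?D (?ne j)" for j
    by (rule D.integrable_const_bound[where B=1]) auto
  have Ene: "(\<integral>w. ?ne j w \<partial>?D) = q" for j
  proof -
    have "distr ?D (measure_pmf s) (\<lambda>w. step_of w j) = measure_pmf s"
    proof -
      interpret E: prob_space "exponential_gap 1" by (rule prob_space_exponential_gap) simp
      interpret MA: prob_space "mark_age \<mu> p" by (rule prob_space_mark_age) fact
      let ?GS = "exponential_gap 1 \<Otimes>\<^sub>M measure_pmf s"
      have "distr ?D (measure_pmf s) (\<lambda>w. step_of w j) = distr (distr (distr ?D (?GS \<Otimes>\<^sub>M mark_age \<mu> p) (\<lambda>w. w j)) ?GS fst) (measure_pmf s) snd"
        unfolding driver_space_def by (subst distr_distr, simp_all, subst distr_distr) (simp_all add: comp_def)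
      also have "distr ?D (?GS \<Otimes>\<^sub>M mark_age \<mu> p) (\<lambda>w. w j) = ?GS \<Otimes>\<^sub>M mark_age \<mu> p"
        unfolding driver_space_def by (rule distr_PiM_component) (auto intro: prob_space_driver1 \<mu>)
      also have "distr \<dots> ?GS fst = ?GS" by (rule MA.distr_pair_fst)
      also have "distr ?GS (measure_pmf s) snd = measure_pmf s"
        by (rule distr_pair_snd[OF E.prob_space_axioms measure_pmf.prob_space_axioms])
      finally show ?thesis .
    qed
    then have "(\<integral>w. ?ne j w \<partial>?D) = (\<integral>x. of_bool (?Z x) \<partial>measure_pmf s)"
      using integral_distr[of "\<lambda>w. step_of w j" ?D "measure_pmf s" "\<lambda>x. of_bool (?Z x) :: real"] by simp
    also have "\<dots> = (\<integral>x. indicator {x. ?Z x} x \<partial>measure_pmf s)"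
      by (intro Bochner_Integration.integral_cong) (auto simp: indicator_def)
    also have "\<dots> = q" by (simp add: q_def)
    finally show ?thesis .
  qed
  have iX: "integrable ?D ?X"
    using integral_pos_of_map(1)[OF \<mu> int(1)] integral_pos_of_map(1)[OF \<mu> int(2)] by simp
  have "real n * (q * (1 - 2 * ((1 - p) * (C / (1 - sqrt r) ^ 2)))) = (\<Sum>j<n. q - 2 * (q * ((1 - p) * (C / (1 - sqrt r) ^ 2))))"
    by (simp add: algebra_simps)
  also have "\<dots> \<le> (\<Sum>j<n. (\<integral>w. ?ne j w \<partial>?D) - 2 * (\<integral>w. ?err j w \<partial>?D))"
    unfolding Ene by (intro sum_mono diff_left_mono mult_left_mono e(2)) simp
  also have "\<dots> = (\<integral>w. (\<Sum>j<n. ?ne j w - 2 * ?err j w) \<partial>?D)"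
    using ine e(1)[of _ n] by (simp add: Bochner_Integration.integral_sum)
  also have "\<dots> \<le> (\<integral>w. ?X w \<partial>?D)"
  proof (rule integral_mono_AE[OF _ iX])
    show "integrable ?D (\<lambda>w. \<Sum>j<n. ?ne j w - 2 * ?err j w)"
      using ine e(1)[of _ n] by simp
    show "AE w in ?D. (\<Sum>j<n. ?ne j w - 2 * ?err j w) \<le> ?X w"
      using AE_driver_space[OF \<mu>, where p=p and s=s]
    proof eventually_elim
      case (elim w)
      have "(\<Sum>j<n. of_bool (fst (step_of w j) \<noteq> snd (step_of w j)) * (1 - 2 * err (gap_of w) (age_of w) (mark_of w) n j)) \<le> ?X w"
        unfolding pos_of_map_steps
      proof (rule pos_coupling)
        show "gap_of w i \<ge> 0" for i using elim by simp
        have u: "step_of w l \<in> unit_steps \<times> unit_steps" for l using elim s by blast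
        show "\<bar>fst (step_of w l) $ k\<bar> \<le> 1" "\<bar>snd (step_of w l) $ k\<bar> \<le> 1" for l
          using u[of l] by (auto intro!: unit_steps_nth simp: mem_Times_iff)
        show "fst (step_of w l) \<noteq> snd (step_of w l) \<Longrightarrow> snd (step_of w l) $ k - fst (step_of w l) $ k \<ge> 1" for l
          using up elim by blast
      qed
      then show ?case by (simp add: algebra_simps)
    qed
  qed
  also have "\<dots> = mean_pos k \<mu> p (map_pmf snd s) n -
      mean_pos k \<mu> p (map_pmf fst s) n"
    using integral_pos_of_map[OF \<mu> int(1)] integral_pos_of_map[OF \<mu> int(2)] by simp
  finally show ?thesis .
qed

section \<open>Coupling of the proposals\<close>

lemma Z_bias_strict_mono:
  assumes "0 < l" "l < l'"
  shows "Z_bias TYPE('d::finite) l < Z_bias TYPE('d) l'"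
proof -
  \<comment> \<open>The difference of the normalisers factors like a difference of hyperbolic
    cosines.\<close>
  have "(exp l' - exp l) * (1 - exp (- l) * exp (- l')) > 0"
  proof (rule mult_pos_pos)
    have "exp (- l) * exp (- l') < 1" using assms by (simp flip: exp_add)
    then show "1 - exp (- l) * exp (- l') > 0" by simp
  qed (use assms in simp)
  also have "(exp l' - exp l) * (1 - exp (- l) * exp (- l')) = exp l' + exp (- l') - exp l - exp (- l)"
    by (simp add: algebra_simps exp_minus field_simps)
  finally show ?thesis by (simp add: Z_bias_def)
qed

text \<open>For positive biases the normaliser grows with the bias, so every step except the
  favoured one becomes less likely. The strict decrease against the bias ensures later that the
  coupled proposals differ with positive probability.\<close>

lemma step_prob_mono:
  fixes k :: "'d::finite"
  assumes l: "0 < l" "l < l'"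
  shows "z \<noteq> axis k 1 \<Longrightarrow> step_prob k l' z \<le> step_prob k l z" "step_prob k l' (axis k (- 1)) < step_prob k l (axis k (- 1))"
proof -
  let ?Z = "Z_bias TYPE('d)"
  have Z: "0 < ?Z l" "?Z l < ?Z l'" using Z_bias_pos Z_bias_strict_mono[OF l] by auto
  have e: "exp (- l') / ?Z l' < exp (- l) / ?Z l"
    using Z l by (intro frac_less) auto
  have ne: "axis k (- 1 :: int) \<noteq> axis k 1" by (simp add: axis_eq_axis)
  show "step_prob k l' (axis k (- 1)) < step_prob k l (axis k (- 1))"
    using e ne by (simp add: step_prob_def)
  have "1 / ?Z l' \<le> 1 / ?Z l" using Z by (intro divide_left_mono) auto
  then show "step_prob k l' z \<le> step_prob k l z" if "z \<noteq> axis k 1"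
    using e that by (auto simp: step_prob_def)
qed

text \<open>Other proposals must lose mass and only the favoured one gains, so it is enough to turn
  each other proposal \<open>z\<close> into the favoured one with the probability that removes its
  surplus.\<close>

lemma step_coupling:
  fixes k :: "'d::finite"
  assumes l: "0 < l" "l < l'"
  shows "\<exists>s. map_pmf fst s = step_pmf k l \<and> map_pmf snd s = step_pmf k l' \<and>
    (\<forall>x\<in>set_pmf s. fst x \<noteq> snd x \<longrightarrow> snd x = axis k 1)"
proof -
  let ?e = "axis k 1 :: int ^ 'd"
  let ?P = "step_prob k l" and ?P' = "step_prob k l'"
  \<comment> \<open>A favoured proposal is always kept. Where \<open>?P z\<close> is 0 the quotient
    is 0 and \<open>rho z\<close> is 1, but such \<open>z\<close> are never proposed.\<close>
  define rho where "rho z = (if z = ?e then 0 else 1 - ?P' z / ?P z)" for z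
  have rho: "0 \<le> rho z" "rho z \<le> 1" for z
    using step_prob_mono(1)[OF l, of z k] step_prob_nonneg[of k l z] step_prob_nonneg[of k l' z]
    by (auto simp: rho_def divide_le_eq_1)
  define s where "s = bind_pmf (step_pmf k l) (\<lambda>z. bind_pmf (bernoulli_pmf (rho z)) (\<lambda>b. return_pmf (z, if b then ?e else z)))"
  have e: "?e \<in> unit_steps" by (auto simp: unit_steps_def)
  have zero: "?P z = 0" "?P' z = 0" if "z \<notin> unit_steps" for z
    using that by (auto simp: step_prob_def unit_steps_def)
  have fst: "map_pmf fst s = step_pmf k l"
    by (simp add: s_def map_bind_pmf bind_return_pmf')
  have snd: "map_pmf snd s = step_pmf k l'"
  proof (rule pmf_eqI)
    fix x
    have Pz: "?P z * (1 - rho z) = ?P' z" if "z \<noteq> ?e" for z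
      using that step_prob_mono(1)[OF l that] step_prob_nonneg[of k l' z]
      by (cases "?P z = 0") (auto simp: rho_def)
    have "pmf (map_pmf snd s) x =
        (\<integral>z. rho z * of_bool (x = ?e) + (1 - rho z) * of_bool (x = z) \<partial>measure_pmf (step_pmf k l))"
      using rho by (auto simp: s_def map_bind_pmf pmf_bind intro!: Bochner_Integration.integral_cong)
    also have "\<dots> = (\<Sum>z\<in>unit_steps. ?P z * (rho z * of_bool (x = ?e) + (1 - rho z) * of_bool (x = z)))"
      using set_step_pmf[of k l]
      by (subst integral_measure_pmf[OF finite_unit_steps]) (auto simp: pmf_step_pmf)
    also have "\<dots> = ?P' x"
    proof (cases "x = ?e")
      case True
      have "(\<Sum>z\<in>unit_steps. ?P z * (rho z * of_bool (x = ?e) + (1 - rho z) * of_bool (x = z))) =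
          (\<Sum>z\<in>unit_steps. ?P z - (if z = ?e then 0 else ?P' z))"
      proof (rule sum.cong[OF refl])
        fix z
        show "?P z * (rho z * of_bool (x = ?e) + (1 - rho z) * of_bool (x = z)) = ?P z - (if z = ?e then 0 else ?P' z)"
          using Pz[of z] True by (cases "z = ?e") (simp_all add: algebra_simps)
      qed
      also have "\<dots> = (\<Sum>z\<in>unit_steps. ?P z) - (\<Sum>z\<in>unit_steps - {?e}. ?P' z)"
        by (simp add: sum_subtractf sum.remove[OF finite_unit_steps e])
      also have "\<dots> = ?P' ?e"
        using sum_step_prob[of k l] sum_step_prob[of k l'] by (simp add: sum.remove[OF finite_unit_steps e])
      finally show ?thesis using True by simp
    next
      case False
      have "(\<Sum>z\<in>unit_steps. ?P z * (rho z * of_bool (x = ?e) + (1 - rho z) * of_bool (x = z))) =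
          (\<Sum>z\<in>unit_steps. if z = x then ?P' x else 0)"
        using False Pz[of x] by (intro sum.cong refl) auto
      also have "\<dots> = ?P' x" using zero[of x] by (simp add: finite_unit_steps)
      finally show ?thesis .
    qed
    also have "\<dots> = pmf (step_pmf k l') x" by (simp add: pmf_step_pmf)
    finally show "pmf (map_pmf snd s) x = pmf (step_pmf k l') x" .
  qed
  have "\<forall>x\<in>set_pmf s. fst x \<noteq> snd x \<longrightarrow> snd x = ?e"
    by (auto simp: s_def split: if_splits)
  then show ?thesis using fst snd by blast
qed

theorem proposition5p2:
  fixes k :: "'d::finite" and \<mu> :: real
  assumes "CARD('d) \<ge> 2" and "\<mu> > 0"
  shows "\<exists>pt::real. 0 < pt \<and> pt < 1 \<and>
           (\<forall>p\<in>{pt<..<1}. strict_mono_on {0<..} (\<lambda>l. speed k \<mu> p l))"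
proof -
  have \<mu>: "\<mu> > 0" by fact
  obtain C r where b: "alive_bound \<mu> C r" using alive_tail[OF \<mu>] by blast
  then have C: "C > 0" and r: "0 < r" "r < 1" by (auto simp: alive_bound_def)
  define K where "K = C / (1 - sqrt r) ^ 2"
  have K: "K > 0" using C r by (simp add: K_def)
  \<comment> \<open>For \<open>p > pt\<close> this gives \<open>(1 - p) * (4 * K + 2) < 1\<close>,
    so the loss \<open>2 * ((1 - p) * K)\<close> stays below \<open>1 / 2\<close>. Adding 2 keeps
    \<open>pt\<close> positive.\<close>
  define pt where "pt = 1 - 1 / (4 * K + 2)"
  have pt: "0 < pt" "pt < 1" using K by (auto simp: pt_def)
  have "speed k \<mu> p l < speed k \<mu> p l'" if p: "pt < p" "p < 1" and l: "0 < l" "l < l'" for p l l'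
  proof -
    have small: "1 - 2 * ((1 - p) * K) > 0"
    proof -
      have "(1 - p) * (4 * K + 2) < 1 / (4 * K + 2) * (4 * K + 2)"
        using p K by (intro mult_strict_right_mono) (auto simp: pt_def)
      then show ?thesis using p K by (simp add: algebra_simps)
    qed
    obtain v where v: "has_speed k \<mu> p l v"
      "(\<lambda>n. mean_pos k \<mu> p (step_pmf k l) n / real n) \<longlonglongrightarrow> v"
      using has_speed_limit[OF \<mu>] by blast
    obtain v' where v': "has_speed k \<mu> p l' v'"
      "(\<lambda>n. mean_pos k \<mu> p (step_pmf k l') n / real n) \<longlonglongrightarrow> v'"
      using has_speed_limit[OF \<mu>] by blast
    obtain s where s: "map_pmf fst s = step_pmf k l" "map_pmf snd s = step_pmf k l'"
      and top: "\<And>x. x \<in> set_pmf s \<Longrightarrow> fst x \<noteq> snd x \<Longrightarrow> snd x = axis k 1"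
      using step_coupling[OF l, of k] by blast
    have int: "integrable (driver_space \<mu> p (step_pmf k l)) (\<lambda>w. real_of_int (pos_of w n $ k))" for l n
      using pos_second_moment[OF \<mu> set_step_pmf] expectation_limit(2)[OF \<mu> set_step_pmf] by metis
    have unit: "fst x \<in> unit_steps" "snd x \<in> unit_steps" if "x \<in> set_pmf s" for x
    proof -
      have "fst x \<in> set_pmf (map_pmf fst s)" "snd x \<in> set_pmf (map_pmf snd s)" using that by auto
      then show "fst x \<in> unit_steps" "snd x \<in> unit_steps" using set_step_pmf s by auto
    qed
    define q where "q = measure_pmf.prob s {x. fst x \<noteq> snd x}"
    \<comment> \<open>Were the proposals almost surely equal, their laws would agree, although the
      step against the bias has different probabilities.\<close>
    have "q \<noteq> 0"
    proof
      assume "q = 0"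
      then have "set_pmf s \<inter> {x. fst x \<noteq> snd x} = {}"
        by (simp add: q_def measure_pmf_zero_iff)
      then have "map_pmf fst s = map_pmf snd s" by (intro map_pmf_cong) auto
      then have "pmf (step_pmf k l) (axis k (- 1)) = pmf (step_pmf k l') (axis k (- 1))" using s by simp
      then show False using step_prob_mono(2)[OF l, of k] by (simp add: pmf_step_pmf)
    qed
    then have q: "q > 0" by (simp add: q_def zero_less_measure_iff)
    \<comment> \<open>The replaced step is a unit step other than the favoured one, so its
      coordinate along \<open>k\<close> is at most 0, while the new one has 1.\<close>
    have up: "snd x $ k - fst x $ k \<ge> 1" if x: "x \<in> set_pmf s" "fst x \<noteq> snd x" for x
    proof -
      have "fst x \<noteq> axis k 1" using top[OF x] x(2) by simp
      then have "fst x $ k \<le> 0" using unit(1)[OF x(1)] by (auto simp: unit_steps_def axis_def)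
      then show ?thesis using top[OF x] by (simp add: axis_def)
    qed
    have diff: "mean_pos k \<mu> p (step_pmf k l') n / real n -
        mean_pos k \<mu> p (step_pmf k l) n / real n \<ge> q * (1 - 2 * ((1 - p) * K))"
      if n: "n > 0" for n
    proof -
      have "mean_pos k \<mu> p (map_pmf snd s) n -
          mean_pos k \<mu> p (map_pmf fst s) n
        \<ge> real n * (q * (1 - 2 * ((1 - p) * K)))"
        unfolding q_def K_def
        by (rule expectation_pos_coupling[OF \<mu> b]) (use p pt unit up int s in auto)
      then have "real n * (q * (1 - 2 * ((1 - p) * K))) / real n \<le>
          (mean_pos k \<mu> p (step_pmf k l') n -
           mean_pos k \<mu> p (step_pmf k l) n) / real n"
        unfolding s by (rule divide_right_mono) simp
      then show ?thesis using n by (simp add: diff_divide_distrib)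
    qed
    \<comment> \<open>The lower bound for the difference of the means per ring does not depend on
      \<open>n\<close>, so the inequality stays strict in the limit.\<close>
    have "q * (1 - 2 * ((1 - p) * K)) \<le> v' - v"
      by (rule tendsto_lowerbound[OF tendsto_diff[OF v'(2) v(2)]],
          rule eventually_mono[OF eventually_gt_at_top[of 0]], rule diff) simp_all
    moreover have "q * (1 - 2 * ((1 - p) * K)) > 0" using q small by simp
    ultimately have "v < v'" by simp
    then show ?thesis using speed_eqI[OF \<mu> v(1)] speed_eqI[OF \<mu> v'(1)] by simp
  qed
  then have "\<forall>p\<in>{pt<..<1}. strict_mono_on {0<..} (\<lambda>l. speed k \<mu> p l)"
    by (auto intro!: strict_mono_onI)
  then show ?thesis using pt by blast
qed

end
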